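(* Let $0 < \beta \leq \alpha < 1$ and $\kappa > 0$. Then, for every $\gamma \in \left(\frac{\alpha - \beta}{1 - \beta},1\right]$, there exist $\epsilon,\epsilon_{0},\epsilon_{B},\delta_{0} \in (0,\tfrac{1}{2}]$, depending only on $\alpha,\beta,\gamma,\kappa$, such that the following holds. Let $\delta \in 2^{-\mathbb{N}}$ with $\delta \in (0,\delta_{0}]$, and let $A,B \subset (\delta \cdot \mathbb{Z}) \cap [0,1]$ satisfy: (A) $|A| \leq \delta^{-\alpha}$; (B) $|B| \geq \delta^{-\beta}$, $|B \cap B(x,r)| \leq r^{\kappa}|B|$ for all $x \in \mathbb{R}$ and $\delta \leq r \leq \delta^{\epsilon_{0}}$, and moreover $|B + B| \leq \delta^{-\epsilon_{B}}|B|$. Further, let $\nu$ be a Borel probability measure with $\operatorname{spt}(\nu) \subset [-1,1]$ satisfying $\nu(B(x,r)) \leq 40 \cdot r^{\gamma}$ for all $x \in \mathbb{R}$ and all $r \geq \delta$. Then there exists $c \in \operatorname{spt}(\nu)$ such that $|A + cB|_{\delta} \geq \delta^{-\epsilon}|A|$.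
   Context: $|\cdot|$ denotes cardinality, $B(x,r)$ the open interval of radius $r$ centred at $x$, and for a bounded $E \subset \mathbb{R}$, $|E|_{\delta}$ is the least number of dyadic intervals $[k\delta,(k+1)\delta)$, $k \in \mathbb{Z}$, needed to cover $E$. Sumsets are $X + Y = \{x+y : x \in X, y \in Y\}$ and $cB = \{cb : b \in B\}$. *)

theory Defs
  imports "HOL-Probability.Probability"
begin

definition grid :: "real \<Rightarrow> real set" where
  "grid \<delta> = range (\<lambda>k::int. of_int k * \<delta>)"

text \<open>Meaningful only for bounded \<open>E\<close> and
  \<open>\<delta> > 0\<close>: otherwise no finite cover need exist and the value is unspecified.\<close>

definition dyadic_covering_number :: "real \<Rightarrow> real set \<Rightarrow> nat" where
  "dyadic_covering_number \<delta> E =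
     (LEAST n. \<exists>K::int set. finite K \<and> card K = n \<and>
        E \<subseteq> (\<Union>k\<in>K. {of_int k * \<delta> ..< (of_int k + 1) * \<delta>}))"

text \<open>The support in the topological sense, i.e. the complement of the largest open null set
  (for Borel measures on second-countable spaces).\<close>

definition spt :: "'a::topological_space measure \<Rightarrow> 'a set" where
  "spt \<nu> = {x. \<forall>U. open U \<and> x \<in> U \<longrightarrow> emeasure \<nu> U > 0}"

end

theory Submission
  imports Defs
begin

text \<open>Suppose that \<open>A + cB\<close> is not much larger than \<open>A\<close> for any \<open>c\<close> in the support. Scale by \<open>1/\<delta>\<close>, let \<open>Z\<close>
  be uniform on \<open>A\<close>, and let \<open>X\<close> be the random leaf of a binary tree inside \<open>B\<close>, found by pigeonholing,
  whose branchings at one level all happen at the same scale \<open>i\<close>. The entropies of \<open>Z + \<lfloor>cX\<rfloor>\<close> and \<open>Z\<close> are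
  close for all \<open>c\<close>. Revealing the coin flips of \<open>X\<close> one by one, the chain rule shows that at all but few
  levels a single coin flip is nearly invisible in \<open>Z + \<lfloor>cX\<rfloor>\<close> for most \<open>c\<close>. By Pinsker, \<open>Z\<close> can thus be
  coupled with a copy \<open>Z'\<close> of itself such that \<open>Z' - Z\<close> is mostly close to \<open>cp\<close>, where \<open>p\<close> has size \<open>2^i\<close>.
  Iterating the coupling for one \<open>c\<close>, \<open>Z\<close> has almost full entropy just above the scale \<open>i\<close>; averaging
  it over \<open>c\<close>, \<open>Z\<close> has entropy at least \<open>\<gamma>\<close> per scale from \<open>i\<close> down to the next branching. As
  the branchings occupy a proportion at least \<open>\<beta>\<close> of the scales, and the first one is near scale \<open>1\<close>
  by the nonconcentration of \<open>B\<close>, the total entropy of \<open>Z\<close> is almost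
  \<open>(\<beta> + \<gamma> * (1 - \<beta>)) * log (1/\<delta>)\<close>, which exceeds \<open>\<alpha> * log (1/\<delta>)\<close>.\<close>

section \<open>Entropy between dyadic scales\<close>

text \<open>The hypothesis on \<gamma> says exactly that
  \<open>\<beta> + \<gamma> * (1 - \<beta>) > \<alpha>\<close>; \<open>8 * \<eta>\<close> is the
  excess. Levels have base \<open>2^T\<close> because pigeonholing the pattern costs a factor
  \<open>T\<close> per level and every entropy estimate loses a constant per level: both are
  negligible against the \<open>T\<close> scales of a level once \<open>T\<close> is large. A
  coupling has to survive up to \<open>2^T\<close> iterations, so the admissible gap
  \<open>\<theta>^2\<close> is chosen after \<open>T\<close>, and \<epsilon> after \<theta>. The gap
  is averaged over \<open>c\<close> before a node is chosen, so one node serves all directions. One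
  node per level is enough: all nodes of a level branch at the same scale, and all their couplings
  concern the same variable \<open>Z\<close>, so the node with the smallest gap may be taken. The
  displacement \<open>p\<close> is random too, but down to scale \<open>2^e\<close> each half of the
  node occupies at most \<open>2^d\<close> cells, \<open>d\<close> being the number of branchings in
  between; these belong to bad levels, hence are few. Couplings lose mass and are cut into pieces.
  Therefore entropy is left unnormalised, and superadditivity takes the place of concavity.\<close>

definition cell_mass :: "int set \<Rightarrow> (int \<Rightarrow> real) \<Rightarrow> nat \<Rightarrow> int \<Rightarrow> real" where
  "cell_mass A g a z = (\<Sum>y\<in>{y\<in>A. y div 2^a = z div 2^a}. g y)"

text \<open>For a probability \<open>g\<close> on \<open>A\<close> and \<open>a \<le> b\<close>, this is the entropy of the dyadic cell of size \<open>2^a\<close>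
  conditional on the cell of size \<open>2^b\<close>. It is homogeneous of degree one in \<open>g\<close>.\<close>

definition scale_entropy :: "int set \<Rightarrow> nat \<Rightarrow> nat \<Rightarrow> (int \<Rightarrow> real) \<Rightarrow> real" where
  "scale_entropy A a b g = (\<Sum>z\<in>A. g z * ln (cell_mass A g b z / cell_mass A g a z))"

lemma div_pow2_mono:
  fixes y z :: int
  assumes "y div 2^a = z div 2^a" "a \<le> b"
  shows "y div 2^b = z div 2^b"
proof -
  have "(2::int)^b = 2^a * 2^(b-a)" using assms(2) by (simp flip: power_add)
  then show ?thesis using assms(1) by (simp add: zdiv_zmult2_eq)
qed

lemma cell_mass_cong: "y div 2^a = z div 2^a \<Longrightarrow> cell_mass A g a y = cell_mass A g a z"
  by (simp add: cell_mass_def)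

lemma cell_mass_nonneg: "(\<And>z. z \<in> A \<Longrightarrow> 0 \<le> g z) \<Longrightarrow> 0 \<le> cell_mass A g a z"
  unfolding cell_mass_def by (rule sum_nonneg) auto

lemma cell_mass_ge:
  assumes "finite A" "\<And>z. z \<in> A \<Longrightarrow> 0 \<le> g z" "z \<in> A"
  shows "g z \<le> cell_mass A g a z"
  unfolding cell_mass_def using assms by (intro member_le_sum) auto

lemma cell_mass_pos:
  assumes "finite A" "\<And>z. z \<in> A \<Longrightarrow> 0 \<le> g z" "z \<in> A" "0 < g z"
  shows "0 < cell_mass A g a z"
  using cell_mass_ge[of A g z a] assms by force

lemma cell_mass_scale_mono:
  assumes "finite A" "\<And>z. z \<in> A \<Longrightarrow> 0 \<le> g z" "a \<le> b"
  shows "cell_mass A g a z \<le> cell_mass A g b z"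
  unfolding cell_mass_def
proof (rule sum_mono2)
  show "{y\<in>A. y div 2^a = z div 2^a} \<subseteq> {y\<in>A. y div 2^b = z div 2^b}"
    using div_pow2_mono[OF _ assms(3)] by blast
qed (use assms in auto)

lemma cell_mass_le_sum:
  assumes "finite A" "\<And>z. z \<in> A \<Longrightarrow> 0 \<le> g z"
  shows "cell_mass A g a z \<le> sum g A"
  unfolding cell_mass_def using assms by (intro sum_mono2) auto

lemma cell_mass_add: "cell_mass A (\<lambda>z. g z + h z) a z = cell_mass A g a z + cell_mass A h a z"
  by (simp add: cell_mass_def sum.distrib)

text \<open>Dividing by the mass of its own cell gives every charged cell total weight one, so a
  cellwise constant \<open>h\<close> is counted once per charged cell. The right-hand side depends
  on \<open>g\<close> only through the set of charged cells, which makes sums for different weights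
  comparable.\<close>

lemma sum_over_cells:
  fixes h :: "int \<Rightarrow> real"
  assumes "finite A" "\<And>y z. y \<in> A \<Longrightarrow> z \<in> A \<Longrightarrow> y div 2^a = z div 2^a \<Longrightarrow> h y = h z"
    and "\<And>z. z \<in> A \<Longrightarrow> 0 \<le> g z"
  shows "(\<Sum>z\<in>A. g z * h z / cell_mass A g a z)
       = (\<Sum>k\<in>(\<lambda>z. z div 2^a) ` {z\<in>A. cell_mass A g a z > 0}. h (SOME z. z \<in> A \<and> z div 2^a = k))"
proof -
  let ?A = "{z\<in>A. cell_mass A g a z > 0}"
  have "(\<Sum>z\<in>A. g z * h z / cell_mass A g a z) = (\<Sum>z\<in>?A. g z * h z / cell_mass A g a z)"
    using assms cell_mass_nonneg[of A g a]
    by (intro sum.mono_neutral_right) (auto simp: less_le)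
  also have "\<dots> = (\<Sum>k\<in>(\<lambda>z. z div 2^a) ` ?A. \<Sum>z\<in>{z\<in>?A. z div 2^a = k}. g z * h z / cell_mass A g a z)"
    using assms(1) by (subst sum.image_gen[where g="\<lambda>z. z div 2^a"]) auto
  also have "\<dots> = (\<Sum>k\<in>(\<lambda>z. z div 2^a) ` ?A. h (SOME z. z \<in> A \<and> z div 2^a = k))"
  proof (rule sum.cong[OF refl])
    fix k assume "k \<in> (\<lambda>z. z div 2^a) ` ?A"
    then obtain y where y: "y \<in> A" "cell_mass A g a y > 0" "k = y div 2^a" by auto
    have eq: "{z\<in>?A. z div 2^a = k} = {z\<in>A. z div 2^a = y div 2^a}"
      using y by (auto simp: cell_mass_def)
    define s where "s = (SOME z. z \<in> A \<and> z div 2^a = k)"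
    have s: "s \<in> A \<and> s div 2^a = k"
      unfolding s_def by (rule someI[of _ y]) (use y in auto)
    have "(\<Sum>z\<in>{z\<in>?A. z div 2^a = k}. g z * h z / cell_mass A g a z)
        = (\<Sum>z\<in>{z\<in>A. z div 2^a = y div 2^a}. g z * (h s / cell_mass A g a y))"
      unfolding eq
    proof (intro sum.cong refl)
      fix z assume z: "z \<in> {z\<in>A. z div 2^a = y div 2^a}"
      have "h z = h s" using assms(2)[of z s] z s y by auto
      moreover have "cell_mass A g a z = cell_mass A g a y" using z by (auto intro: cell_mass_cong)
      ultimately show "g z * h z / cell_mass A g a z = g z * (h s / cell_mass A g a y)" by simp
    qed
    also have "\<dots> = cell_mass A g a y * (h s / cell_mass A g a y)"
      by (simp only: cell_mass_def sum_distrib_right)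
    also have "\<dots> = h s" using y by simp
    finally show "(\<Sum>z\<in>{z\<in>?A. z div 2^a = k}. g z * h z / cell_mass A g a z) = h s" .
  qed
  finally show ?thesis .
qed

lemma scale_entropy_nonneg:
  assumes "finite A" "\<And>z. z \<in> A \<Longrightarrow> 0 \<le> g z" "a \<le> b"
  shows "0 \<le> scale_entropy A a b g"
  unfolding scale_entropy_def
proof (rule sum_nonneg)
  fix z assume z: "z \<in> A"
  show "0 \<le> g z * ln (cell_mass A g b z / cell_mass A g a z)"
  proof (cases "g z = 0")
    case False
    then have "0 < g z" using assms(2)[OF z] by simp
    then have "0 < cell_mass A g a z" using assms z by (intro cell_mass_pos) auto
    moreover have "cell_mass A g a z \<le> cell_mass A g b z"
      using assms by (intro cell_mass_scale_mono) auto
    ultimately have "1 \<le> cell_mass A g b z / cell_mass A g a z" by (simp add: le_divide_eq)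
    then show ?thesis using assms(2)[OF z] by (intro mult_nonneg_nonneg ln_ge_zero)
  qed simp
qed

lemma scale_entropy_trans:
  assumes "finite A" "\<And>z. z \<in> A \<Longrightarrow> 0 \<le> g z"
  shows "scale_entropy A a c g = scale_entropy A a b g + scale_entropy A b c g"
  unfolding scale_entropy_def sum.distrib[symmetric]
proof (rule sum.cong[OF refl])
  fix z assume z: "z \<in> A"
  show "g z * ln (cell_mass A g c z / cell_mass A g a z) =
    g z * ln (cell_mass A g b z / cell_mass A g a z) + g z * ln (cell_mass A g c z / cell_mass A g b z)"
  proof (cases "g z = 0")
    case False
    then have "0 < g z" using assms(2)[OF z] by simp
    then have q: "0 < cell_mass A g d z" for d using assms z by (intro cell_mass_pos) auto
    have "ln (cell_mass A g c z / cell_mass A g a z) =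
        ln (cell_mass A g b z / cell_mass A g a z) + ln (cell_mass A g c z / cell_mass A g b z)"
      using q[of a] q[of b] q[of c] by (simp add: ln_div)
    then show ?thesis by (simp add: distrib_left)
  qed simp
qed

text \<open>By \<open>ln x \<ge> 1 - 1/x\<close>, this is the log-sum inequality summed over all cells of both scales.\<close>

lemma scale_entropy_superadditive:
  assumes A: "finite A" and g: "\<And>z. z \<in> A \<Longrightarrow> 0 \<le> g z" and h: "\<And>z. z \<in> A \<Longrightarrow> 0 \<le> h z"
    and ab: "a \<le> b"
  shows "scale_entropy A a b g + scale_entropy A a b h \<le> scale_entropy A a b (\<lambda>z. g z + h z)"
proof -
  let ?s = "\<lambda>z. g z + h z"
  let ?R = "\<lambda>z. cell_mass A ?s a z / cell_mass A ?s b z"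
  have s: "\<And>z. z \<in> A \<Longrightarrow> 0 \<le> ?s z" using g h by (simp add: add_nonneg_nonneg)
  \<comment> \<open>This is \<open>ln x \<le> x - 1\<close> at the quotient of two proportions: that
    of the fine cell in the coarse cell for \<open>?s\<close>, divided by the same proportion for
    \<open>u\<close>. It will be used with \<open>u = g\<close> and \<open>u = h\<close>.\<close>
  have pointwise: "u z * ln (cell_mass A u b z / cell_mass A u a z) + u z
      - u z * (?R z * cell_mass A u b z) / cell_mass A u a z
      \<le> u z * ln (cell_mass A ?s b z / cell_mass A ?s a z)"
    if u: "\<And>z. z \<in> A \<Longrightarrow> 0 \<le> u z" "\<And>z. z \<in> A \<Longrightarrow> u z \<le> ?s z" and z: "z \<in> A" for u z
  proof (cases "u z = 0")
    case False
    then have p: "0 < u z" using u(1)[OF z] by simp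
    have q: "0 < cell_mass A u d z" for d using A u(1) z p by (intro cell_mass_pos) auto
    have r: "0 < cell_mass A ?s d z" for d
      using A s z p u(2)[OF z] by (intro cell_mass_pos) auto
    define x where "x = ?R z * cell_mass A u b z / cell_mass A u a z"
    have x: "0 < x" unfolding x_def using q[of a] q[of b] r[of a] r[of b] by simp
    have "ln x \<le> x - 1" using x by (rule ln_le_minus_one)
    moreover have "ln x = ln (cell_mass A u b z / cell_mass A u a z) - ln (cell_mass A ?s b z / cell_mass A ?s a z)"
      unfolding x_def using q[of a] q[of b] r[of a] r[of b] by (simp add: ln_div ln_mult)
    ultimately have "ln (cell_mass A u b z / cell_mass A u a z) + 1 - x
        \<le> ln (cell_mass A ?s b z / cell_mass A ?s a z)" by simp
    from mult_left_mono[OF this, of "u z"] p show ?thesis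
      unfolding x_def by (simp add: algebra_simps)
  qed simp
  \<comment> \<open>In the error term the weight \<open>u\<close> may be replaced by
    \<open>?s\<close>: summed by cells, both sides add the same nonnegative function, on the right
    over possibly more cells.\<close>
  have resum: "(\<Sum>z\<in>A. u z * (?R z * cell_mass A u b z) / cell_mass A u a z)
      \<le> (\<Sum>z\<in>A. ?s z * (?R z * cell_mass A u b z) / cell_mass A ?s a z)"
    if u: "\<And>z. z \<in> A \<Longrightarrow> 0 \<le> u z" "\<And>z. z \<in> A \<Longrightarrow> u z \<le> ?s z" for u
  proof -
    let ?h = "\<lambda>z. ?R z * cell_mass A u b z"
    have hc: "?h y = ?h z" if "y div 2^a = z div 2^a" for y z
      using cell_mass_cong[OF that] cell_mass_cong[OF div_pow2_mono[OF that ab]] by simp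
    have h0: "0 \<le> ?h z" for z
      by (intro mult_nonneg_nonneg divide_nonneg_nonneg cell_mass_nonneg u(1) s)
    have mono: "cell_mass A u a z \<le> cell_mass A ?s a z" for z
      unfolding cell_mass_def by (rule sum_mono) (simp add: u(2))
    have "(\<Sum>z\<in>A. u z * ?h z / cell_mass A u a z)
       = (\<Sum>k\<in>(\<lambda>z. z div 2^a) ` {z\<in>A. cell_mass A u a z > 0}. ?h (SOME z. z \<in> A \<and> z div 2^a = k))"
      by (intro sum_over_cells[where g=u and h="?h"] A u(1) hc)
    also have "\<dots> \<le> (\<Sum>k\<in>(\<lambda>z. z div 2^a) ` {z\<in>A. cell_mass A ?s a z > 0}. ?h (SOME z. z \<in> A \<and> z div 2^a = k))"
    proof (rule sum_mono2)
      show "(\<lambda>z. z div 2^a) ` {z\<in>A. cell_mass A u a z > 0} \<subseteq> (\<lambda>z. z div 2^a) ` {z\<in>A. cell_mass A ?s a z > 0}"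
        by (rule image_mono) (use mono in \<open>auto intro: less_le_trans\<close>)
    qed (use A h0 in auto)
    also have "\<dots> = (\<Sum>z\<in>A. ?s z * ?h z / cell_mass A ?s a z)"
      by (intro sum_over_cells[where g="?s" and h="?h", symmetric] A s hc)
    finally show ?thesis .
  qed
  have *: "scale_entropy A a b u + sum u A - (\<Sum>z\<in>A. ?s z * (?R z * cell_mass A u b z) / cell_mass A ?s a z)
     \<le> (\<Sum>z\<in>A. u z * ln (cell_mass A ?s b z / cell_mass A ?s a z))"
    if u: "\<And>z. z \<in> A \<Longrightarrow> 0 \<le> u z" "\<And>z. z \<in> A \<Longrightarrow> u z \<le> ?s z" for u
  proof -
    have "scale_entropy A a b u + sum u A - (\<Sum>z\<in>A. u z * (?R z * cell_mass A u b z) / cell_mass A u a z)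
       \<le> (\<Sum>z\<in>A. u z * ln (cell_mass A ?s b z / cell_mass A ?s a z))"
      unfolding scale_entropy_def sum.distrib[symmetric] sum_subtractf[symmetric]
      by (rule sum_mono) (rule pointwise[OF u])
    then show ?thesis using resum[OF u] by linarith
  qed
  \<comment> \<open>After this replacement the two error terms have a common denominator, and
    additivity of cell masses makes them cancel the masses \<open>sum g A\<close> and
    \<open>sum h A\<close> exactly.\<close>
  have tot: "(\<Sum>z\<in>A. ?s z * (?R z * cell_mass A g b z) / cell_mass A ?s a z)
      + (\<Sum>z\<in>A. ?s z * (?R z * cell_mass A h b z) / cell_mass A ?s a z) = sum g A + sum h A"
  proof -
    have "?s z * (?R z * cell_mass A g b z) / cell_mass A ?s a z
        + ?s z * (?R z * cell_mass A h b z) / cell_mass A ?s a z = ?s z" if z: "z \<in> A" for z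
    proof (cases "?s z = 0")
      case False
      then have "0 < ?s z" using s[OF z] by simp
      then have r: "0 < cell_mass A ?s d z" for d using A s z by (intro cell_mass_pos) auto
      have "?s z * (?R z * cell_mass A g b z) / cell_mass A ?s a z
        + ?s z * (?R z * cell_mass A h b z) / cell_mass A ?s a z
        = ?s z * ?R z * (cell_mass A g b z + cell_mass A h b z) / cell_mass A ?s a z"
        by (simp add: algebra_simps add_divide_distrib)
      also have "\<dots> = ?s z"
        using r[of a] r[of b] unfolding cell_mass_add[symmetric] by simp
      finally show ?thesis .
    next
      case True then show ?thesis by simp
    qed
    then show ?thesis by (simp add: sum.distrib[symmetric])
  qed
  have "(\<Sum>z\<in>A. g z * ln (cell_mass A ?s b z / cell_mass A ?s a z))
      + (\<Sum>z\<in>A. h z * ln (cell_mass A ?s b z / cell_mass A ?s a z)) = scale_entropy A a b ?s"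
    unfolding scale_entropy_def by (simp add: sum.distrib[symmetric] algebra_simps)
  then show ?thesis using *[of g] *[of h] g h tot by (simp add: add_nonneg_nonneg)
qed

text \<open>Superadditivity for \<open>g\<close> and the remainder \<open>h - g\<close>. Lower
  bounds for \<open>f\<close> can thus be proved on any submeasure, in particular on what a lossy
  coupling retains.\<close>

lemma scale_entropy_mono:
  assumes "finite A" "\<And>z. z \<in> A \<Longrightarrow> 0 \<le> g z" "\<And>z. z \<in> A \<Longrightarrow> g z \<le> h z" "a \<le> b"
  shows "scale_entropy A a b g \<le> scale_entropy A a b h"
proof -
  have "scale_entropy A a b g + scale_entropy A a b (\<lambda>z. h z - g z) \<le> scale_entropy A a b (\<lambda>z. g z + (h z - g z))"
    by (rule scale_entropy_superadditive) (use assms in auto)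
  moreover have "0 \<le> scale_entropy A a b (\<lambda>z. h z - g z)"
    by (rule scale_entropy_nonneg) (use assms in auto)
  ultimately show ?thesis by simp
qed

lemma scale_entropy_sum:
  assumes "finite A" "finite I" "\<And>i z. i \<in> I \<Longrightarrow> z \<in> A \<Longrightarrow> 0 \<le> g i z" "a \<le> b"
  shows "(\<Sum>i\<in>I. scale_entropy A a b (g i)) \<le> scale_entropy A a b (\<lambda>z. \<Sum>i\<in>I. g i z)"
  using assms(2,3)
proof (induction I rule: finite_induct)
  case empty then show ?case by (simp add: scale_entropy_def)
next
  case (insert i I)
  have "scale_entropy A a b (g i) + scale_entropy A a b (\<lambda>z. \<Sum>i\<in>I. g i z)
     \<le> scale_entropy A a b (\<lambda>z. g i z + (\<Sum>i\<in>I. g i z))"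
    by (rule scale_entropy_superadditive) (use assms insert in \<open>auto intro!: sum_nonneg\<close>)
  then show ?case using insert by force
qed

text \<open>The logarithm is \<open>ln (M / fine) - ln (M / coarse)\<close> in terms of the two cell
  masses. The first term is at least \<open>ln (1 / p)\<close>; the second is at most
  \<open>M / coarse\<close>, whose \<open>g\<close>-sum is \<open>M\<close> for each charged coarse
  cell. The reference mass \<open>M\<close> is separate from the mass of \<open>g\<close>, so that
  thresholds and losses do not change when \<open>g\<close> has lost mass.\<close>

lemma scale_entropy_lower:
  assumes A: "finite A" and g: "\<And>z. z \<in> A \<Longrightarrow> 0 \<le> g z" and ab: "a \<le> b" and M: "0 < M"
    and mass: "sum g A \<le> M" and p: "0 < p"
    and fine: "\<And>z. z \<in> A \<Longrightarrow> g z > 0 \<Longrightarrow> cell_mass A g a z \<le> M * p"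
    and K: "finite K" "card K \<le> n" "\<And>z. z \<in> A \<Longrightarrow> g z > 0 \<Longrightarrow> z div 2^b \<in> K"
  shows "sum g A * ln (1 / p) - real n * M \<le> scale_entropy A a b g"
proof -
  have "(\<Sum>z\<in>A. g z * M / cell_mass A g b z)
    = (\<Sum>k\<in>(\<lambda>z. z div 2^b) ` {z\<in>A. cell_mass A g b z > 0}. M)"
    by (intro sum_over_cells[where g=g and h="\<lambda>_. M"] A g refl)
  also have "\<dots> \<le> (\<Sum>k\<in>K. M)"
  proof (rule sum_mono2)
    show "(\<lambda>z. z div 2^b) ` {z\<in>A. cell_mass A g b z > 0} \<subseteq> K"
    proof safe
      fix z assume z: "z \<in> A" "0 < cell_mass A g b z"
      have "\<not> (\<forall>y\<in>{y\<in>A. y div 2^b = z div 2^b}. g y \<le> 0)"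
        using z(2) sum_nonpos[of "{y\<in>A. y div 2^b = z div 2^b}" g] unfolding cell_mass_def by auto
      then obtain y where "y \<in> A" "y div 2^b = z div 2^b" "g y > 0" by auto
      then show "z div 2^b \<in> K" using K(3)[of y] by simp
    qed
  qed (use K M in auto)
  also have "\<dots> \<le> real n * M" using K M by simp
  finally have 1: "(\<Sum>z\<in>A. g z * M / cell_mass A g b z) \<le> real n * M" .
  have "(\<Sum>z\<in>A. g z * ln (1/p) - g z * M / cell_mass A g b z) \<le> scale_entropy A a b g"
    unfolding scale_entropy_def
  proof (rule sum_mono)
    fix z assume z: "z \<in> A"
    show "g z * ln (1/p) - g z * M / cell_mass A g b z \<le> g z * ln (cell_mass A g b z / cell_mass A g a z)"
    proof (cases "g z = 0")
      case False
      then have gz: "0 < g z" using g[OF z] by simp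
      have q: "0 < cell_mass A g d z" for d using A g z gz by (intro cell_mass_pos) auto
      have "ln (M / cell_mass A g b z) \<le> M / cell_mass A g b z - 1"
        using q[of b] M by (intro ln_le_minus_one) simp
      moreover have "ln (1/p) \<le> ln (M / cell_mass A g a z)"
        using fine[OF z gz] q[of a] p M by (simp add: field_simps)
      moreover have "ln (M / cell_mass A g a z) - ln (M / cell_mass A g b z) = ln (cell_mass A g b z / cell_mass A g a z)"
        using q[of a] q[of b] M by (simp add: ln_div)
      ultimately have "ln (1/p) - M / cell_mass A g b z \<le> ln (cell_mass A g b z / cell_mass A g a z)" by linarith
      from mult_left_mono[OF this, of "g z"] gz show ?thesis by (simp add: algebra_simps)
    qed simp
  qed
  then show ?thesis using 1 by (simp add: sum_subtractf sum_distrib_right)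
qed

lemma scale_entropy_uniform_le:
  assumes "finite A" "A \<noteq> {}"
  shows "scale_entropy A a b (\<lambda>z. 1 / real (card A)) \<le> ln (real (card A))"
proof -
  let ?g = "\<lambda>z::int. 1 / real (card A)"
  have c: "0 < real (card A)" using assms by (simp add: card_gt_0_iff)
  have "scale_entropy A a b ?g \<le> (\<Sum>z\<in>A. ?g z * ln (real (card A)))"
    unfolding scale_entropy_def
  proof (intro sum_mono mult_left_mono)
    fix z assume z: "z \<in> A"
    have 1: "?g z \<le> cell_mass A ?g d z" for d by (rule cell_mass_ge) (use assms z in auto)
    have p: "0 < cell_mass A ?g d z" for d using 1[of d] c by (smt (verit) divide_pos_pos)
    have 2: "cell_mass A ?g b z \<le> sum ?g A" by (rule cell_mass_le_sum) (use assms in auto)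
    have "cell_mass A ?g b z / cell_mass A ?g a z \<le> 1 / ?g z"
      by (rule frac_le) (use 1[of a] 2 c in auto)
    then show "ln (cell_mass A ?g b z / cell_mass A ?g a z) \<le> ln (real (card A))"
      using p[of a] p[of b] c by simp
  qed (use c in auto)
  also have "\<dots> = ln (real (card A))" using c by simp
  finally show ?thesis .
qed

section \<open>Entropy gaps and couplings\<close>

definition shannon :: "'a set \<Rightarrow> ('a \<Rightarrow> real) \<Rightarrow> real" where
  "shannon Q g = (\<Sum>q\<in>Q. - g q * ln (g q))"

lemma shannon_le_ln_card:
  assumes "finite Q" "Q \<noteq> {}" "\<And>q. q \<in> Q \<Longrightarrow> 0 \<le> g q" "sum g Q = 1"
  shows "shannon Q g \<le> ln (real (card Q))"
proof -
  let ?n = "real (card Q)"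
  have n: "0 < ?n" using assms by (simp add: card_gt_0_iff)
  have "shannon Q g \<le> (\<Sum>q\<in>Q. g q * ln ?n + (1 / ?n - g q))"
    unfolding shannon_def
  proof (rule sum_mono)
    fix q assume q: "q \<in> Q"
    show "- g q * ln (g q) \<le> g q * ln ?n + (1 / ?n - g q)"
    proof (cases "g q = 0")
      case True then show ?thesis using n by simp
    next
      case False
      then have p: "0 < g q" using assms(3)[OF q] by simp
      have "ln (1 / (?n * g q)) \<le> 1 / (?n * g q) - 1"
        using p n by (intro ln_le_minus_one) simp
      moreover have "ln (1 / (?n * g q)) = - ln ?n - ln (g q)"
        using p n by (simp add: ln_div ln_mult)
      ultimately have "- ln (g q) \<le> ln ?n + (1 / (?n * g q) - 1)" by linarith
      from mult_left_mono[OF this, of "g q"] p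
      have "g q * (- ln (g q)) \<le> g q * (ln ?n + (1 / (?n * g q) - 1))" by simp
      also have "\<dots> = g q * ln ?n + (1 / ?n - g q)" using p n by (simp add: field_simps)
      finally show ?thesis by simp
    qed
  qed
  also have "\<dots> = sum g Q * ln ?n + (1 - sum g Q)"
    using n by (simp add: sum.distrib sum_subtractf sum_distrib_right)
  finally show ?thesis using assms(4) by simp
qed

text \<open>The gap is the mean divergence of \<open>a\<close> and \<open>b\<close> from their
  midpoint \<open>m\<close>. The inequality \<open>ln y \<le> y - 1\<close> at
  \<open>y = sqrt (m / x)\<close> bounds such a divergence below by a Hellinger distance, which
  makes sense also when \<open>a\<close> or \<open>b\<close> vanishes.\<close>

lemma entropy_midpoint_gap:
  fixes a b :: real
  assumes "0 \<le> a" "0 \<le> b"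
  shows "(sqrt a - sqrt b)\<^sup>2 / 4
    \<le> - ((a + b) / 2) * ln ((a + b) / 2) - (- a * ln a + - b * ln b) / 2"
proof (cases "a + b = 0")
  case True then show ?thesis using assms by (simp add: add_nonneg_eq_0_iff)
next
  case False
  define m where "m = (a + b) / 2"
  have m: "0 < m" unfolding m_def using False assms by simp
  have *: "2 * x - 2 * sqrt x * sqrt m \<le> x * ln x - x * ln m" if "0 \<le> x" for x
  proof (cases "x = 0")
    case False
    then have x: "0 < x" using that by simp
    have "ln (sqrt (m / x)) \<le> sqrt (m / x) - 1" using x m by (intro ln_le_minus_one) simp
    then have "(ln m - ln x) / 2 \<le> sqrt (m / x) - 1" using x m by (simp add: ln_sqrt ln_div)
    then have "ln m - ln x \<le> 2 * sqrt (m / x) - 2" by simp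
    from mult_left_mono[OF this, of x] x
    have "x * (ln m - ln x) \<le> 2 * (x * sqrt (m / x)) - 2 * x" by (simp add: algebra_simps)
    moreover have "x * sqrt (m / x) = sqrt x * sqrt m"
      using x m by (simp add: real_sqrt_divide field_simps)
    ultimately show ?thesis by (simp add: algebra_simps)
  qed simp
  define s t r where "s = sqrt a" and "t = sqrt b" and "r = sqrt m"
  have sq: "a = s^2" "b = t^2" "m = r^2" unfolding s_def t_def r_def using assms m by simp_all
  have "0 \<le> (2 * r - (s + t))\<^sup>2" by simp
  then have "4 * (r * (s + t)) \<le> 4 * r^2 + (s + t)^2" by (simp add: power2_eq_square algebra_simps)
  moreover have "2 * r^2 = s^2 + t^2" using sq m_def by simp
  moreover have "(s - t)^2 + (s + t)^2 = 2 * (s^2 + t^2)" by (simp add: power2_eq_square algebra_simps)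
  moreover have "d / 4 \<le> 2 * R - u" if "4 * u \<le> 4 * R + V" "2 * R = S" "d + V = 2 * S" for u R V S d :: real
    using that by linarith
  ultimately have "(s - t)\<^sup>2 / 4 \<le> 2 * r^2 - r * (s + t)" by blast
  then have "(sqrt a - sqrt b)\<^sup>2 / 4 \<le> 2 * m - sqrt m * (sqrt a + sqrt b)"
    unfolding sq(3)[symmetric] unfolding s_def t_def r_def .
  also have "\<dots> \<le> ((a * ln a - a * ln m) + (b * ln b - b * ln m)) / 2"
  proof -
    have "2 * m = a + b" unfolding m_def by simp
    then show ?thesis using *[OF assms(1)] *[OF assms(2)] by (simp add: distrib_left mult.commute[of "sqrt m"])
  qed
  also have "\<dots> = - m * ln m - (- a * ln a + - b * ln b) / 2"
    by (simp add: m_def field_simps)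
  finally show ?thesis unfolding m_def .
qed

lemma shannon_midpoint:
  assumes "\<And>q. q \<in> Q \<Longrightarrow> 0 \<le> g q" "\<And>q. q \<in> Q \<Longrightarrow> 0 \<le> h q"
  shows "(shannon Q g + shannon Q h) / 2 \<le> shannon Q (\<lambda>q. (g q + h q) / 2)"
proof -
  have "(\<Sum>q\<in>Q. (- g q * ln (g q) + - h q * ln (h q)) / 2) \<le> shannon Q (\<lambda>q. (g q + h q) / 2)"
    unfolding shannon_def
  proof (rule sum_mono)
    fix q assume "q \<in> Q"
    then have "0 \<le> (sqrt (g q) - sqrt (h q))\<^sup>2 / 4" "0 \<le> g q" "0 \<le> h q" using assms by auto
    with entropy_midpoint_gap[of "g q" "h q"]
    show "(- g q * ln (g q) + - h q * ln (h q)) / 2 \<le> - ((g q + h q) / 2) * ln ((g q + h q) / 2)"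
      by linarith
  qed
  then show ?thesis by (simp add: shannon_def sum.distrib[symmetric] sum_divide_distrib)
qed

text \<open>Pinsker's inequality for the midpoint gap, linearised by AM-GM so that it can be averaged.\<close>

lemma l1_dist_le_shannon_gap:
  assumes g: "\<And>q. q \<in> Q \<Longrightarrow> 0 \<le> g q" and h: "\<And>q. q \<in> Q \<Longrightarrow> 0 \<le> h q"
    and "sum g Q \<le> 1" "sum h Q \<le> 1" and l: "0 < \<epsilon>"
  shows "(\<Sum>q\<in>Q. \<bar>g q - h q\<bar>)
    \<le> 2 / \<epsilon> * (shannon Q (\<lambda>q. (g q + h q) / 2) - (shannon Q g + shannon Q h) / 2) + 2 * \<epsilon>"
proof -
  let ?G = "\<lambda>q. - ((g q + h q) / 2) * ln ((g q + h q) / 2) - (- g q * ln (g q) + - h q * ln (h q)) / 2"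
  have "(\<Sum>q\<in>Q. \<bar>g q - h q\<bar>) \<le> (\<Sum>q\<in>Q. 2 / \<epsilon> * ?G q + \<epsilon> * (g q + h q))"
  proof (rule sum_mono)
    fix q assume q: "q \<in> Q"
    define s t where "s = sqrt (g q)" and "t = sqrt (h q)"
    have st: "g q = s^2" "h q = t^2" "0 \<le> s" "0 \<le> t" unfolding s_def t_def using g[OF q] h[OF q] by auto
    have "\<bar>g q - h q\<bar> = \<bar>s - t\<bar> * (s + t)"
    proof -
      have "g q - h q = (s - t) * (s + t)" unfolding st(1,2) by (simp add: power2_eq_square algebra_simps)
      then show ?thesis using st(3,4) by (simp add: abs_mult)
    qed
    also have "\<dots> \<le> (s - t)^2 / (2 * \<epsilon>) + \<epsilon> / 2 * (s + t)^2"
    proof -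
      have *: "d * u \<le> d^2 / (2 * \<epsilon>) + \<epsilon> / 2 * u^2" for d u :: real
      proof -
        have "0 \<le> (d - \<epsilon> * u)^2 / (2 * \<epsilon>)" using l by simp
        also have "\<dots> = d^2 / (2 * \<epsilon>) + \<epsilon> / 2 * u^2 - d * u"
          using l by (simp add: field_simps power2_eq_square)
        finally show ?thesis by simp
      qed
      show ?thesis using *[of "\<bar>s - t\<bar>" "s + t"] by simp
    qed
    also have "\<epsilon> / 2 * (s + t)^2 \<le> \<epsilon> * (g q + h q)"
    proof -
      have "0 \<le> (s - t)^2" by simp
      then have "(s + t)^2 \<le> 2 * (g q + h q)" using st by (simp add: power2_eq_square algebra_simps)
      then show ?thesis using l by simp
    qed
    also have "(s - t)^2 / (2 * \<epsilon>) \<le> 2 / \<epsilon> * ?G q"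
    proof -
      have "(s - t)^2 / 4 \<le> ?G q" unfolding s_def t_def by (rule entropy_midpoint_gap) (use g h q in auto)
      from mult_left_mono[OF this, of "2 / \<epsilon>"] l show ?thesis by simp
    qed
    finally show "\<bar>g q - h q\<bar> \<le> 2 / \<epsilon> * ?G q + \<epsilon> * (g q + h q)" by simp
  qed
  also have "\<dots> = 2 / \<epsilon> * (\<Sum>q\<in>Q. ?G q) + \<epsilon> * (sum g Q + sum h Q)"
    by (simp only: sum.distrib sum_distrib_left[symmetric])
  also have "(\<Sum>q\<in>Q. ?G q) = shannon Q (\<lambda>q. (g q + h q) / 2) - (shannon Q g + shannon Q h) / 2"
    by (simp only: shannon_def sum_subtractf sum.distrib sum_divide_distrib[symmetric])
  also have "\<epsilon> * (sum g Q + sum h Q) \<le> 2 * \<epsilon>" using assms(3,4) l by simp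
  finally show ?thesis by simp
qed

text \<open>The maximal coupling of \<open>f * v\<close> and \<open>f * w\<close>, projected to the two \<open>f\<close>-coordinates.
  Quotients by a vanishing maximum are harmless, as the numerators vanish too.\<close>

definition subcoupling ::
    "int set \<Rightarrow> int set \<Rightarrow> (int \<Rightarrow> real) \<Rightarrow> (int \<Rightarrow> real) \<Rightarrow> (int \<Rightarrow> real) \<Rightarrow> int \<Rightarrow> int \<Rightarrow> real" where
  "subcoupling A Q f v w z z' = (\<Sum>q\<in>Q. f z * v (q - z) * (f z' * w (q - z'))
     / max (\<Sum>y\<in>A. f y * v (q - y)) (\<Sum>y\<in>A. f y * w (q - y)))"

lemma subcoupling_nonneg:
  assumes "\<And>z. 0 \<le> f z" "\<And>y. 0 \<le> v y" "\<And>y. 0 \<le> w y"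
  shows "0 \<le> subcoupling A Q f v w z z'"
  unfolding subcoupling_def
  by (intro sum_nonneg divide_nonneg_nonneg mult_nonneg_nonneg assms) (simp add: assms le_max_iff_disj sum_nonneg)

lemma subcoupling_commute: "subcoupling A Q f v w z z' = subcoupling A Q f w v z' z"
  unfolding subcoupling_def by (simp add: max.commute mult.commute)

text \<open>Summing out \<open>z'\<close> leaves the factor \<open>?h / max ?g ?h \<le> 1\<close>:
  the part of one sum that the other cannot match is discarded.\<close>

lemma subcoupling_marginal:
  assumes f: "\<And>z. 0 \<le> f z" and v: "\<And>y. 0 \<le> v y" and w: "\<And>y. 0 \<le> w y"
    and "(\<Sum>q\<in>Q. v (q - z)) \<le> 1"
  shows "(\<Sum>z'\<in>A. subcoupling A Q f v w z z') \<le> f z"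
proof -
  let ?g = "\<lambda>q. \<Sum>y\<in>A. f y * v (q - y)" and ?h = "\<lambda>q. \<Sum>y\<in>A. f y * w (q - y)"
  have "(\<Sum>z'\<in>A. subcoupling A Q f v w z z') = (\<Sum>q\<in>Q. f z * v (q - z) * (?h q / max (?g q) (?h q)))"
    unfolding subcoupling_def
    by (subst sum.swap) (simp add: sum_distrib_left sum_divide_distrib algebra_simps)
  also have "\<dots> \<le> (\<Sum>q\<in>Q. f z * v (q - z))"
  proof (rule sum_mono)
    fix q
    have "0 \<le> ?h q" by (intro sum_nonneg mult_nonneg_nonneg f w)
    moreover have "b / max a b \<le> 1" if "0 \<le> b" for a b :: real
      using that by (cases "b = 0") (auto simp: divide_le_eq_1)
    ultimately have "?h q / max (?g q) (?h q) \<le> 1" by blast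
    then show "f z * v (q - z) * (?h q / max (?g q) (?h q)) \<le> f z * v (q - z)"
      using f v by (intro mult_left_le) auto
  qed
  also have "\<dots> \<le> f z" unfolding sum_distrib_left[symmetric] using assms(4) f by (intro mult_left_le) auto
  finally show ?thesis .
qed

text \<open>At a common value \<open>q\<close> the matched mass is
  \<open>?g * ?h / max ?g ?h = min ?g ?h\<close>, so exactly half the L1 distance of the two laws is
  lost.\<close>

lemma subcoupling_mass:
  assumes f: "\<And>z. 0 \<le> f z" and v: "\<And>y. 0 \<le> v y" and w: "\<And>y. 0 \<le> w y"
    and A: "finite A" "sum f A = 1" and Q: "finite Q"
    and v1: "\<And>z. z \<in> A \<Longrightarrow> (\<Sum>q\<in>Q. v (q - z)) = 1" and w1: "\<And>z. z \<in> A \<Longrightarrow> (\<Sum>q\<in>Q. w (q - z)) = 1"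
  shows "(\<Sum>z\<in>A. \<Sum>z'\<in>A. subcoupling A Q f v w z z')
    = 1 - (\<Sum>q\<in>Q. \<bar>(\<Sum>y\<in>A. f y * v (q - y)) - (\<Sum>y\<in>A. f y * w (q - y))\<bar>) / 2"
proof -
  let ?g = "\<lambda>q. \<Sum>y\<in>A. f y * v (q - y)" and ?h = "\<lambda>q. \<Sum>y\<in>A. f y * w (q - y)"
  have "(\<Sum>z\<in>A. \<Sum>z'\<in>A. subcoupling A Q f v w z z')
     = (\<Sum>z\<in>A. \<Sum>q\<in>Q. f z * v (q - z) * (?h q / max (?g q) (?h q)))"
  proof (rule sum.cong[OF refl])
    fix z
    show "(\<Sum>z'\<in>A. subcoupling A Q f v w z z') = (\<Sum>q\<in>Q. f z * v (q - z) * (?h q / max (?g q) (?h q)))"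
      unfolding subcoupling_def
      by (subst sum.swap) (simp add: sum_distrib_left sum_divide_distrib algebra_simps)
  qed
  also have "\<dots> = (\<Sum>q\<in>Q. ?g q * (?h q / max (?g q) (?h q)))"
    by (subst sum.swap) (simp add: sum_distrib_right sum_divide_distrib)
  also have "\<dots> = (\<Sum>q\<in>Q. (?g q + ?h q - \<bar>?g q - ?h q\<bar>) / 2)"
  proof (rule sum.cong[OF refl])
    fix q
    have "0 \<le> ?g q" "0 \<le> ?h q" by (intro sum_nonneg mult_nonneg_nonneg f v w)+
    then show "?g q * (?h q / max (?g q) (?h q)) = (?g q + ?h q - \<bar>?g q - ?h q\<bar>) / 2"
      by (auto simp: max_def abs_if)
  qed
  also have "\<dots> = ((\<Sum>q\<in>Q. ?g q) + (\<Sum>q\<in>Q. ?h q) - (\<Sum>q\<in>Q. \<bar>?g q - ?h q\<bar>)) / 2"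
    by (simp add: sum_divide_distrib[symmetric] sum.distrib sum_subtractf)
  also have "(\<Sum>q\<in>Q. ?g q) = 1"
    by (subst sum.swap) (simp add: sum_distrib_left[symmetric] v1 A)
  also have "(\<Sum>q\<in>Q. ?h q) = 1"
    by (subst sum.swap) (simp add: sum_distrib_left[symmetric] w1 A)
  finally show ?thesis by simp
qed

lemma subcoupling_support:
  assumes "subcoupling A Q f v w z z' \<noteq> 0"
  shows "\<exists>q. v (q - z) \<noteq> 0 \<and> w (q - z') \<noteq> 0"
proof -
  obtain q where "f z * v (q - z) * (f z' * w (q - z'))
     / max (\<Sum>y\<in>A. f y * v (q - y)) (\<Sum>y\<in>A. f y * w (q - y)) \<noteq> 0"
    using assms unfolding subcoupling_def by (rule sum.not_neutral_contains_not_neutral)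
  then have "v (q - z) \<noteq> 0 \<and> w (q - z') \<noteq> 0" by auto
  then show ?thesis by blast
qed

section \<open>Random leaves of binary trees and their sums with an independent variable\<close>

datatype btree = Leaf int | Node btree btree

primrec leaves :: "btree \<Rightarrow> int set" where
  "leaves (Leaf x) = {x}"
| "leaves (Node s t) = leaves s \<union> leaves t"

primrec leaf_law :: "(int \<Rightarrow> int) \<Rightarrow> btree \<Rightarrow> int \<Rightarrow> real" where
  "leaf_law \<phi> (Leaf x) y = (if y = \<phi> x then 1 else 0)"
| "leaf_law \<phi> (Node s t) y = (leaf_law \<phi> s y + leaf_law \<phi> t y) / 2"

lemma leaves_nonempty: "leaves t \<noteq> {}"
  by (induction t) auto

lemma leaf_law_nonneg: "0 \<le> leaf_law \<phi> t y"
  by (induction t) auto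

lemma leaf_law_support: "leaf_law \<phi> t y \<noteq> 0 \<Longrightarrow> \<exists>x\<in>leaves t. y = \<phi> x"
proof (induction t)
  case (Node s t)
  then have "leaf_law \<phi> s y \<noteq> 0 \<or> leaf_law \<phi> t y \<noteq> 0" by auto
  then show ?case using Node.IH by (metis UnI1 UnI2 leaves.simps(2))
qed (auto split: if_splits)

lemma leaf_law_sum:
  assumes "finite Q" "\<And>x. x \<in> leaves t \<Longrightarrow> z + \<phi> x \<in> Q"
  shows "(\<Sum>q\<in>Q. leaf_law \<phi> t (q - z)) = 1"
  using assms(2)
proof (induction t)
  case (Leaf x)
  have "(\<Sum>q\<in>Q. leaf_law \<phi> (Leaf x) (q - z)) = (\<Sum>q\<in>Q. if q = z + \<phi> x then 1 else 0)"
    by (intro sum.cong) auto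
  then show ?case using Leaf assms(1) by simp
qed (simp add: sum_divide_distrib[symmetric] sum.distrib)

text \<open>For a probability \<open>f\<close> this is the law of \<open>Z + \<phi> X\<close>, with
  \<open>Z\<close> of law \<open>f\<close> and \<open>X\<close> an independent random leaf.\<close>

definition conv_law :: "int set \<Rightarrow> (int \<Rightarrow> real) \<Rightarrow> (int \<Rightarrow> int) \<Rightarrow> btree \<Rightarrow> int \<Rightarrow> real" where
  "conv_law A f \<phi> t q = (\<Sum>z\<in>A. f z * leaf_law \<phi> t (q - z))"

lemma conv_law_nonneg: "(\<And>z. 0 \<le> f z) \<Longrightarrow> 0 \<le> conv_law A f \<phi> t q"
  unfolding conv_law_def by (intro sum_nonneg mult_nonneg_nonneg leaf_law_nonneg)

lemma conv_law_Node: "conv_law A f \<phi> (Node s t) q = (conv_law A f \<phi> s q + conv_law A f \<phi> t q) / 2"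
proof -
  have "conv_law A f \<phi> (Node s t) q = (\<Sum>z\<in>A. (f z * leaf_law \<phi> s (q - z) + f z * leaf_law \<phi> t (q - z)) / 2)"
    unfolding conv_law_def by (intro sum.cong) (auto simp: distrib_left)
  then show ?thesis by (simp add: conv_law_def sum_divide_distrib[symmetric] sum.distrib)
qed

lemma conv_law_sum:
  assumes "finite Q" "\<And>x z. x \<in> leaves t \<Longrightarrow> z \<in> A \<Longrightarrow> z + \<phi> x \<in> Q"
  shows "(\<Sum>q\<in>Q. conv_law A f \<phi> t q) = sum f A"
proof -
  have "(\<Sum>q\<in>Q. conv_law A f \<phi> t q) = (\<Sum>z\<in>A. f z * (\<Sum>q\<in>Q. leaf_law \<phi> t (q - z)))"
    unfolding conv_law_def by (subst sum.swap) (simp add: sum_distrib_left)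
  also have "\<dots> = sum f A"
    using assms by (intro sum.cong refl) (simp add: leaf_law_sum)
  finally show ?thesis .
qed

text \<open>For a single leaf the sum is a translate of \<open>Z\<close>. This is the end value of
  the chain rule along a tree.\<close>

lemma shannon_conv_law_Leaf:
  assumes "finite A" "A \<noteq> {}" "finite Q" "\<And>z. z \<in> A \<Longrightarrow> z + \<phi> x \<in> Q"
  shows "shannon Q (conv_law A (\<lambda>z. 1 / real (card A)) \<phi> (Leaf x)) = ln (real (card A))"
proof -
  let ?n = "real (card A)"
  have n: "0 < ?n" using assms by (simp add: card_gt_0_iff)
  have eq: "conv_law A (\<lambda>z. 1 / ?n) \<phi> (Leaf x) q = (if q - \<phi> x \<in> A then 1 / ?n else 0)" for q
  proof -
    have "conv_law A (\<lambda>z. 1 / ?n) \<phi> (Leaf x) q = (\<Sum>z\<in>A. if z = q - \<phi> x then 1 / ?n else 0)"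
      unfolding conv_law_def by (intro sum.cong) auto
    then show ?thesis using assms(1) by simp
  qed
  have "shannon Q (conv_law A (\<lambda>z. 1 / ?n) \<phi> (Leaf x))
      = (\<Sum>q\<in>(\<lambda>z. z + \<phi> x) ` A. 1 / ?n * ln ?n)"
    unfolding shannon_def
  proof (rule sum.mono_neutral_cong_right)
    show "\<forall>i\<in>Q - (\<lambda>z. z + \<phi> x) ` A.
       - conv_law A (\<lambda>z. 1 / ?n) \<phi> (Leaf x) i * ln (conv_law A (\<lambda>z. 1 / ?n) \<phi> (Leaf x) i) = 0"
      unfolding eq by (auto simp: image_iff) (metis add.commute add_diff_cancel_left' diff_add_cancel)
  qed (use assms n in \<open>auto simp: eq ln_div\<close>)
  also have "\<dots> = (\<Sum>z\<in>A. 1 / ?n * ln ?n)" by (subst sum.reindex) (auto simp: inj_on_def)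
  also have "\<dots> = ln ?n" using n by simp
  finally show ?thesis .
qed

section \<open>Entropy gained from couplings\<close>

text \<open>Paths of the Markov chain with initial law \<open>f\<close> and (substochastic) kernel \<open>J z z' / f z\<close>;
  lists carry the most recent point first.\<close>

fun path_weight :: "(int \<Rightarrow> real) \<Rightarrow> (int \<Rightarrow> int \<Rightarrow> real) \<Rightarrow> int list \<Rightarrow> real" where
  "path_weight f J [] = 0"
| "path_weight f J [z] = f z"
| "path_weight f J (z' # z # p) = path_weight f J (z # p) * (J z z' / f z)"

abbreviation lists_of_length :: "int set \<Rightarrow> nat \<Rightarrow> int list set" where
  "lists_of_length A n \<equiv> {xs. set xs \<subseteq> A \<and> length xs = n}"

lemma sum_lists_Suc:
  fixes F :: "int list \<Rightarrow> real"
  assumes "finite A"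
  shows "(\<Sum>xs\<in>lists_of_length A (Suc n). F xs) = (\<Sum>p\<in>lists_of_length A n. \<Sum>z\<in>A. F (z # p))"
proof -
  have "lists_of_length A (Suc n) = (\<lambda>(p, z). z # p) ` (lists_of_length A n \<times> A)"
    by (auto simp: image_iff length_Suc_conv)
  then have "(\<Sum>xs\<in>lists_of_length A (Suc n). F xs) = (\<Sum>(p, z)\<in>lists_of_length A n \<times> A. F (z # p))"
    by (simp add: sum.reindex inj_on_def case_prod_unfold)
  then show ?thesis by (simp add: sum.cartesian_product)
qed

lemma path_weight_nonneg:
  assumes "\<And>z. 0 \<le> f z" "\<And>z z'. 0 \<le> J z z'"
  shows "0 \<le> path_weight f J xs"
proof (induction xs rule: induct_list012)
  case (3 z' z p)
  then show ?case using assms by (simp add: divide_nonneg_nonneg)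
qed (use assms in auto)

lemma path_weight_Cons_sum_le:
  assumes "\<And>z. 0 \<le> f z" "\<And>z z'. 0 \<le> J z z'" "\<And>z. z \<in> A \<Longrightarrow> (\<Sum>z'\<in>A. J z z') \<le> f z"
    and "set p \<subseteq> A" "p \<noteq> []"
  shows "(\<Sum>z\<in>A. path_weight f J (z # p)) \<le> path_weight f J p"
proof -
  obtain z p' where p: "p = z # p'" using assms(5) by (cases p) auto
  have "(\<Sum>z'\<in>A. path_weight f J (z' # p)) = path_weight f J p * ((\<Sum>z'\<in>A. J z z') / f z)"
    unfolding p by (simp add: sum_distrib_left sum_divide_distrib)
  moreover have "(\<Sum>z'\<in>A. J z z') / f z \<le> 1"
    using assms(1)[of z] assms(3)[of z] assms(4) p by (auto simp: divide_le_eq_1 less_le)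
  moreover have "0 \<le> path_weight f J p" by (rule path_weight_nonneg[OF assms(1,2)])
  ultimately show ?thesis by (metis mult_left_le)
qed

text \<open>If the law before a step is at most \<open>f\<close>, then \<open>y\<close> sends at
  most \<open>J y z\<close> to \<open>z\<close>, and by the column sums of \<open>J\<close> these
  contributions add up to at most \<open>f z\<close>. So the law of the newest point never exceeds
  \<open>f\<close>.\<close>

lemma path_weight_head_marginal:
  assumes A: "finite A" and f: "\<And>z. 0 \<le> f z" and J: "\<And>z z'. 0 \<le> J z z'"
    and r: "\<And>z'. z' \<in> A \<Longrightarrow> (\<Sum>z\<in>A. J z z') \<le> f z'" and z: "z \<in> A"
  shows "(\<Sum>p\<in>lists_of_length A n. path_weight f J (z # p)) \<le> f z"
  using z
proof (induction n arbitrary: z)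
  case 0
  have "lists_of_length A 0 = {[]}" by auto
  then show ?case by simp
next
  case (Suc n)
  have "(\<Sum>p\<in>lists_of_length A (Suc n). path_weight f J (z # p))
      = (\<Sum>y\<in>A. (\<Sum>p\<in>lists_of_length A n. path_weight f J (y # p)) * (J y z / f y))"
    unfolding sum_lists_Suc[OF A] by (subst sum.swap) (simp add: sum_distrib_right sum_divide_distrib)
  also have "\<dots> \<le> (\<Sum>y\<in>A. J y z)"
  proof (rule sum_mono)
    fix y assume y: "y \<in> A"
    have "(\<Sum>p\<in>lists_of_length A n. path_weight f J (y # p)) * (J y z / f y) \<le> f y * (J y z / f y)"
      using Suc.IH[OF y] J f by (intro mult_right_mono) auto
    also have "\<dots> \<le> J y z" using J by simp
    finally show "(\<Sum>p\<in>lists_of_length A n. path_weight f J (y # p)) * (J y z / f y) \<le> J y z" .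
  qed
  also have "\<dots> \<le> f z" using r[OF Suc.prems] .
  finally show ?case .
qed

text \<open>A step loses at \<open>z\<close> the proportion by which row \<open>z\<close> of
  \<open>J\<close> falls short of \<open>f z\<close>. As the current law is dominated by
  \<open>f\<close>, no step loses more than the whole deficit \<tau> of the coupling.\<close>

lemma path_weight_total:
  assumes A: "finite A" and f: "\<And>z. 0 \<le> f z" "sum f A = 1" and J: "\<And>z z'. 0 \<le> J z z'"
    and l: "\<And>z. z \<in> A \<Longrightarrow> (\<Sum>z'\<in>A. J z z') \<le> f z"
    and r: "\<And>z'. z' \<in> A \<Longrightarrow> (\<Sum>z\<in>A. J z z') \<le> f z'"
    and mass: "1 - \<tau> \<le> (\<Sum>z\<in>A. \<Sum>z'\<in>A. J z z')"
  shows "1 - real n * \<tau> \<le> (\<Sum>p\<in>lists_of_length A (Suc n). path_weight f J p)"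
proof (induction n)
  case 0
  have "lists_of_length A 0 = {[]}" by auto
  then show ?case using f by (simp add: sum_lists_Suc[OF A])
next
  case (Suc n)
  define h where "h z = (\<Sum>p\<in>lists_of_length A n. path_weight f J (z # p))" for z
  have "(\<Sum>p\<in>lists_of_length A (Suc n). path_weight f J p)
      - (\<Sum>p\<in>lists_of_length A (Suc (Suc n)). path_weight f J p)
      = (\<Sum>z\<in>A. h z * (1 - (\<Sum>z'\<in>A. J z z') / f z))"
  proof -
    have "(\<Sum>p\<in>lists_of_length A (Suc (Suc n)). path_weight f J p)
       = (\<Sum>p\<in>lists_of_length A n. \<Sum>z\<in>A. path_weight f J (z # p) * ((\<Sum>z'\<in>A. J z z') / f z))"
      unfolding sum_lists_Suc[OF A] by (simp add: sum_distrib_left sum_divide_distrib)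
    also have "\<dots> = (\<Sum>z\<in>A. h z * ((\<Sum>z'\<in>A. J z z') / f z))"
      unfolding h_def by (subst sum.swap) (simp add: sum_distrib_right sum_divide_distrib)
    moreover have "(\<Sum>p\<in>lists_of_length A (Suc n). path_weight f J p) = (\<Sum>z\<in>A. h z)"
      unfolding sum_lists_Suc[OF A] h_def by (rule sum.swap)
    ultimately show ?thesis by (simp add: sum_subtractf[symmetric] algebra_simps)
  qed
  also have "\<dots> \<le> (\<Sum>z\<in>A. f z - (\<Sum>z'\<in>A. J z z'))"
  proof (rule sum_mono)
    fix z assume z: "z \<in> A"
    have h: "h z \<le> f z" unfolding h_def by (rule path_weight_head_marginal[OF A f(1) J r z])
    show "h z * (1 - (\<Sum>z'\<in>A. J z z') / f z) \<le> f z - (\<Sum>z'\<in>A. J z z')"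
    proof (cases "f z = 0")
      case True then show ?thesis using h l[OF z] by simp
    next
      case False
      then have p: "0 < f z" using f(1)[of z] by simp
      have "h z * (1 - (\<Sum>z'\<in>A. J z z') / f z) \<le> f z * (1 - (\<Sum>z'\<in>A. J z z') / f z)"
        using h l[OF z] p by (intro mult_right_mono) auto
      also have "\<dots> = f z - (\<Sum>z'\<in>A. J z z')" using p by (simp add: field_simps)
      finally show ?thesis .
    qed
  qed
  also have "\<dots> \<le> \<tau>" using mass f(2) by (simp add: sum_subtractf)
  finally show ?case using Suc by (simp add: algebra_simps)
qed

text \<open>Linearity over the \<open>n\<close> positions: the newest point is controlled by its
  marginal, the older ones by the fact that extending a path never increases the total
  weight.\<close>

lemma path_weight_count:
  assumes A: "finite A" and f: "\<And>z. 0 \<le> f z" and J: "\<And>z z'. 0 \<le> J z z'"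
    and l: "\<And>z. z \<in> A \<Longrightarrow> (\<Sum>z'\<in>A. J z z') \<le> f z"
    and r: "\<And>z'. z' \<in> A \<Longrightarrow> (\<Sum>z\<in>A. J z z') \<le> f z'" and z: "z \<in> A"
  shows "(\<Sum>p\<in>lists_of_length A n. path_weight f J p * count_list p z) \<le> real n * f z"
proof (induction n)
  case 0
  have "lists_of_length A 0 = {[]}" by auto
  then show ?case by simp
next
  case (Suc n)
  have "(\<Sum>p\<in>lists_of_length A (Suc n). path_weight f J p * count_list p z)
     = (\<Sum>p\<in>lists_of_length A n. (\<Sum>y\<in>A. path_weight f J (y # p)) * count_list p z)
     + (\<Sum>p\<in>lists_of_length A n. \<Sum>y\<in>A. if y = z then path_weight f J (y # p) else 0)"
    unfolding sum_lists_Suc[OF A] sum.distrib[symmetric] sum_distrib_right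
    by (intro sum.cong refl) (auto simp: algebra_simps)
  also have "(\<Sum>p\<in>lists_of_length A n. \<Sum>y\<in>A. if y = z then path_weight f J (y # p) else 0)
     = (\<Sum>p\<in>lists_of_length A n. path_weight f J (z # p))"
    using A z by simp
  also have "\<dots> \<le> f z" by (rule path_weight_head_marginal[OF A f J r z])
  also have "(\<Sum>p\<in>lists_of_length A n. (\<Sum>y\<in>A. path_weight f J (y # p)) * count_list p z)
     \<le> (\<Sum>p\<in>lists_of_length A n. path_weight f J p * count_list p z)"
  proof (rule sum_mono)
    fix p assume p: "p \<in> lists_of_length A n"
    show "(\<Sum>y\<in>A. path_weight f J (y # p)) * real (count_list p z) \<le> path_weight f J p * real (count_list p z)"
    proof (cases "p = []")
      case False
      show ?thesis
        by (rule mult_right_mono[OF path_weight_Cons_sum_le[OF f J l]]) (use p False in auto)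
    qed simp
  qed
  finally show ?case using Suc.IH by (simp add: algebra_simps)
qed

text \<open>All steps have the same sign, so a path cannot turn back: any two of its points, not
  only consecutive ones, are \<open>q\<close>-separated.\<close>

lemma path_weight_spread:
  assumes step: "\<And>z z'. J z z' \<noteq> 0 \<Longrightarrow> z + q \<le> z' \<and> z' \<le> z + q'" and q: "0 \<le> q"
  shows "path_weight f J (z # p) \<noteq> 0 \<Longrightarrow>
    sorted_wrt (\<lambda>x y. y + q \<le> x) (z # p) \<and> (\<forall>x\<in>set (z # p). x \<le> z \<and> z \<le> x + int (length p) * q')"
proof (induction p arbitrary: z)
  case (Cons y p)
  from Cons.prems have "path_weight f J (y # p) \<noteq> 0" "J y z \<noteq> 0" by auto
  then have IH: "sorted_wrt (\<lambda>x y. y + q \<le> x) (y # p)"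
      "\<And>x. x \<in> set (y # p) \<Longrightarrow> x \<le> y \<and> y \<le> x + int (length p) * q'"
    and yz: "y + q \<le> z" "z \<le> y + q'"
    using Cons.IH[of y] step[of y z] by auto
  have "0 \<le> int (length p) * q'" using yz q by (intro mult_nonneg_nonneg) auto
  moreover have "int (length (y # p)) * q' = int (length p) * q' + q'" by (simp add: algebra_simps)
  ultimately have "x \<le> z \<and> z \<le> x + int (length (y # p)) * q'" if "x \<in> set (z # y # p)" for x
    using that IH(2)[of x] yz q by fastforce
  moreover have "x + q \<le> z" if "x \<in> set (y # p)" for x using IH(2)[OF that] yz(1) by linarith
  ultimately show ?case using IH(1) by simp
qed simp

lemma sorted_gap_length:
  fixes q :: int
  assumes "sorted_wrt (\<lambda>x y. y + q \<le> x) xs" "\<And>x. x \<in> set xs \<Longrightarrow> lo \<le> x \<and> x < lo + s" "0 \<le> q" "0 \<le> s"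
  shows "int (length xs) * q \<le> s + q"
proof -
  have "sorted_wrt (\<lambda>x y. y + q \<le> x) (z # p) \<Longrightarrow> (\<forall>x\<in>set (z # p). lo \<le> x) \<Longrightarrow> lo + int (length p) * q \<le> z" for z p
  proof (induction p arbitrary: z)
    case (Cons y p)
    then have "lo + int (length p) * q \<le> y" "y + q \<le> z" by auto
    then show ?case by (simp add: algebra_simps)
  qed simp
  note * = this
  show ?thesis
  proof (cases xs)
    case Nil then show ?thesis using assms(3,4) by simp
  next
    case (Cons z p)
    have "lo + int (length p) * q \<le> z" using *[of z p] assms(1,2) Cons by auto
    moreover have "z < lo + s" using assms(2) Cons by auto
    moreover have "int (length xs) * q = int (length p) * q + q" using Cons by (simp add: algebra_simps)
    ultimately show ?thesis by linarith
  qed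
qed

text \<open>Flowing along the coupling for \<open>2^(b - a)\<close> steps exhibits most of \<open>f\<close> as a mixture of
  the empirical measures of paths, each of which is spread out evenly between the two scales.\<close>

lemma scale_entropy_full:
  assumes A: "finite A" and f: "\<And>z. 0 \<le> f z" "sum f A = 1" and J: "\<And>z z'. 0 \<le> J z z'"
    and l: "\<And>z. z \<in> A \<Longrightarrow> (\<Sum>z'\<in>A. J z z') \<le> f z"
    and r: "\<And>z'. z' \<in> A \<Longrightarrow> (\<Sum>z\<in>A. J z z') \<le> f z'"
    and mass: "1 - \<tau> \<le> (\<Sum>z\<in>A. \<Sum>z'\<in>A. J z z')"
    and step: "\<And>z z'. J z z' \<noteq> 0 \<Longrightarrow> z + q \<le> z' \<and> z' \<le> z + 4 * 2^a"
    and q: "1 \<le> q" "2^a \<le> C * real_of_int q" and ab: "a \<le> b" and C: "0 \<le> C"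
    and tau: "0 \<le> \<tau>" "2^(b - a) * \<tau> \<le> 1"
  shows "(1 - 2^(b - a) * \<tau>) * (real (b - a) * ln 2 - ln (C + 1) - 6) \<le> scale_entropy A a b f"
proof (cases "real (b - a) * ln 2 - ln (C + 1) - 6 \<le> 0")
  \<comment> \<open>For a nonpositive bracket the trivial bound suffices. In the other case the
    bracket may be multiplied by lower bounds for the mass of the paths.\<close>
  case True
  have "0 \<le> scale_entropy A a b f" by (rule scale_entropy_nonneg) (use A f ab in auto)
  moreover have "(1 - 2^(b - a) * \<tau>) * (real (b - a) * ln 2 - ln (C + 1) - 6) \<le> 0"
    using True tau by (intro mult_nonneg_nonpos) auto
  ultimately show ?thesis by linarith
next
  case False
  define n :: nat where "n = 2^(b - a)"
  have n: "0 < n" unfolding n_def by simp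
  let ?W = "path_weight f J" and ?P = "lists_of_length A n"
  define g where "g p z = ?W p / n * count_list p z" for p z
  have fin: "finite ?P" using finite_lists_length_eq[OF A, of n] by simp
  have W0: "0 \<le> ?W p" for p by (rule path_weight_nonneg[OF f(1) J])
  have g0: "0 \<le> g p z" for p z unfolding g_def using W0 by simp
  have "scale_entropy A a b (\<lambda>z. \<Sum>p\<in>?P. g p z) \<le> scale_entropy A a b f"
  proof (rule scale_entropy_mono[OF A _ _ ab])
    fix z assume z: "z \<in> A"
    show "0 \<le> (\<Sum>p\<in>?P. g p z)" by (intro sum_nonneg g0)
    have "(\<Sum>p\<in>?P. g p z) = (\<Sum>p\<in>?P. ?W p * count_list p z) / n"
      unfolding g_def by (simp add: sum_divide_distrib)
    also have "\<dots> \<le> f z"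
      using path_weight_count[OF A f(1) J l r z, of n] n by (simp add: divide_le_eq mult.commute)
    finally show "(\<Sum>p\<in>?P. g p z) \<le> f z" .
  qed
  moreover have "(\<Sum>p\<in>?P. scale_entropy A a b (g p)) \<le> scale_entropy A a b (\<lambda>z. \<Sum>p\<in>?P. g p z)"
    by (rule scale_entropy_sum[OF A fin _ ab]) (rule g0)
  moreover have "(\<Sum>p\<in>?P. ?W p * (real (b - a) * ln 2 - ln (C + 1) - 6)) \<le> (\<Sum>p\<in>?P. scale_entropy A a b (g p))"
  proof (rule sum_mono)
    fix p assume p: "p \<in> ?P"
    show "?W p * (real (b - a) * ln 2 - ln (C + 1) - 6) \<le> scale_entropy A a b (g p)"
    proof (cases "?W p = 0")
      case True
      have "0 \<le> scale_entropy A a b (g p)" by (rule scale_entropy_nonneg[OF A g0 ab])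
      then show ?thesis using True by simp
    next
      case False
      then have W: "0 < ?W p" using W0[of p] by simp
      obtain z p' where zp: "p = z # p'" using p n by (cases p) auto
      have sp: "sorted_wrt (\<lambda>x y. y + q \<le> x) p"
        "\<And>x. x \<in> set p \<Longrightarrow> x \<le> z \<and> z \<le> x + int (length p') * (4 * 2^a)"
        using path_weight_spread[of J q "4 * 2^a" f z p'] step q(1) False zp by auto
      have tot: "sum (g p) A = ?W p"
      proof -
        have "sum (g p) A = ?W p / n * (\<Sum>z\<in>A. real (count_list p z))"
          unfolding g_def by (simp add: sum_distrib_left)
        also have "(\<Sum>z\<in>A. real (count_list p z)) = n"
          using sum_count_set[of p A] p A by (simp flip: of_nat_sum)
        finally show ?thesis using n by simp
      qed
      \<comment> \<open>A path visits a fine cell at most \<open>C + 1\<close> times in its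
        \<open>n\<close> points, since it is \<open>q\<close>-separated and
        \<open>2^a \<le> C * q\<close>. Its extent is at most \<open>n * 4 * 2^a = 4 * 2^b\<close>,
        so it meets at most five coarse cells.\<close>
      have "sum (g p) A * ln (1 / ((C + 1) / n)) - real 6 * ?W p \<le> scale_entropy A a b (g p)"
      proof (rule scale_entropy_lower[OF A g0 ab W])
        show "sum (g p) A \<le> ?W p" using tot by simp
        show "0 < (C + 1) / real n" using C n by simp
        fix y assume y: "y \<in> A" "0 < g p y"
        define ys where "ys = filter (\<lambda>x. x div 2^a = y div 2^a) p"
        have cnt: "count_list ys x = (if x div 2^a = y div 2^a then count_list p x else 0)" for x
          unfolding ys_def by (induction p) auto
        have "cell_mass A (g p) a y = ?W p / n * (\<Sum>x\<in>{x\<in>A. x div 2^a = y div 2^a}. real (count_list p x))"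
          unfolding g_def cell_mass_def by (simp add: sum_distrib_left)
        also have "(\<Sum>x\<in>{x\<in>A. x div 2^a = y div 2^a}. real (count_list p x)) = (\<Sum>x\<in>A. real (count_list ys x))"
          using A by (intro sum.mono_neutral_cong_left) (auto simp: cnt)
        also have "\<dots> = real (length ys)"
          using sum_count_set[of ys A] p A by (auto simp: ys_def simp flip: of_nat_sum)
        also have "real (length ys) \<le> C + 1"
        proof -
          have "int (length ys) * q \<le> 2^a + q"
          proof (rule sorted_gap_length)
            show "sorted_wrt (\<lambda>x y. y + q \<le> x) ys" unfolding ys_def by (rule sorted_wrt_filter[OF sp(1)])
            fix x assume "x \<in> set ys"
            then have "x div 2^a = y div 2^a" unfolding ys_def by auto
            then show "y div 2^a * 2^a \<le> x \<and> x < y div 2^a * 2^a + 2^a"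
              using div_mult_mod_eq[of x "2^a"] pos_mod_bound[of "2^a" x] pos_mod_sign[of "2^a" x]
              by (metis add.commute add_le_cancel_left add_less_cancel_left le_add_same_cancel1 zero_less_numeral zero_less_power)
          qed (use q in auto)
          then have "real (length ys) * real_of_int q \<le> 2^a + real_of_int q"
            by (metis (mono_tags, lifting) of_int_add of_int_le_iff of_int_mult of_int_numeral of_int_of_nat_eq of_int_power)
          also have "\<dots> \<le> (C + 1) * real_of_int q" using q by (simp add: algebra_simps)
          finally show ?thesis using q by simp
        qed
        finally show "cell_mass A (g p) a y \<le> ?W p * ((C + 1) / real n)"
          using W n by (simp add: mult_left_mono divide_right_mono field_simps)
      next
        fix y assume y: "y \<in> A" "0 < g p y"
        then have "count_list p y \<noteq> 0" unfolding g_def by (intro notI) simp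
        then have "y \<in> set p" by (metis count_notin)
        from sp(2)[OF this] have y1: "y \<le> z" "z \<le> y + int (length p') * (4 * 2^a)" by auto
        have "int (length p') \<le> 2^(b - a)" using p zp unfolding n_def by auto
        then have "int (length p') * (4 * 2^a) \<le> 2^(b - a) * (4 * 2^a)" by (intro mult_right_mono) auto
        also have "\<dots> = 4 * 2^b" using ab by (simp add: power_add[symmetric])
        finally have "z - 4 * 2^b \<le> y" using y1 by linarith
        then have "(z + (-4) * 2^b) div 2^b \<le> y div 2^b" by (intro zdiv_mono1) auto
        moreover have "(z + (-4) * 2^b) div 2^b = -4 + z div 2^b" by (rule div_mult_self1) simp
        moreover have "y div 2^b \<le> z div 2^b" using y1 by (intro zdiv_mono1) auto
        ultimately show "y div 2^b \<in> {z div 2^b - 4 .. z div 2^b}" by simp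
      qed auto
      moreover have "ln (1 / ((C + 1) / real n)) = real (b - a) * ln 2 - ln (C + 1)"
        using C by (simp add: n_def ln_div ln_realpow)
      ultimately have "?W p * (real (b - a) * ln 2 - ln (C + 1)) - real 6 * ?W p \<le> scale_entropy A a b (g p)"
        using tot by (simp only:)
      then show ?thesis by (simp add: algebra_simps)
    qed
  qed
  moreover have "(1 - 2^(b - a) * \<tau>) * (real (b - a) * ln 2 - ln (C + 1) - 6)
     \<le> (\<Sum>p\<in>?P. ?W p) * (real (b - a) * ln 2 - ln (C + 1) - 6)"
  proof (rule mult_right_mono)
    have "1 - real (n - 1) * \<tau> \<le> (\<Sum>p\<in>?P. ?W p)"
      using path_weight_total[OF A f J l r mass, of "n - 1"] n by simp
    moreover have "real (n - 1) * \<tau> \<le> 2^(b - a) * \<tau>" using tau by (intro mult_right_mono) (auto simp: n_def)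
    ultimately show "1 - 2^(b - a) * \<tau> \<le> (\<Sum>p\<in>?P. ?W p)" by linarith
  qed (use False in auto)
  ultimately show ?thesis by (simp add: sum_distrib_right)
qed

text \<open>Here \<open>f\<close> dominates the sum over its atoms \<open>z\<close> of the \<open>w\<close>-averaged couplings issuing from \<open>z\<close>,
  and these averages have no concentrated cells at the finer scale.\<close>

lemma scale_entropy_average:
  fixes w :: "'k \<Rightarrow> real"
  assumes A: "finite A" and f: "\<And>z. 0 \<le> f z" "sum f A = 1" and I: "finite I"
    and w: "\<And>k. k \<in> I \<Longrightarrow> 0 \<le> w k" "sum w I = 1"
    and J: "\<And>k z z'. 0 \<le> J k z z'"
    and l: "\<And>k z. k \<in> I \<Longrightarrow> z \<in> A \<Longrightarrow> (\<Sum>z'\<in>A. J k z z') \<le> f z"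
    and r: "\<And>k z'. k \<in> I \<Longrightarrow> z' \<in> A \<Longrightarrow> (\<Sum>z\<in>A. J k z z') \<le> f z'"
    and mass: "1 - \<tau> \<le> (\<Sum>k\<in>I. w k * (\<Sum>z\<in>A. \<Sum>z'\<in>A. J k z z'))"
    and step: "\<And>k z z'. k \<in> I \<Longrightarrow> J k z z' \<noteq> 0 \<Longrightarrow> \<bar>z' - z\<bar> \<le> 4 * 2^b"
    and conc: "\<And>z m. z \<in> A \<Longrightarrow> (\<Sum>k\<in>{k\<in>I. \<exists>z'\<in>A. z' div 2^a = m \<and> J k z z' \<noteq> 0}. w k) \<le> p"
    and p: "0 < p" "p \<le> 1" and ab: "a \<le> b"
  shows "(1 - \<tau>) * ln (1 / p) - 9 \<le> scale_entropy A a b f"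
proof -
  define g where "g z z' = (\<Sum>k\<in>I. w k * J k z z')" for z z'
  have g0: "0 \<le> g z z'" for z z' unfolding g_def by (intro sum_nonneg mult_nonneg_nonneg w(1) J)
  have "scale_entropy A a b (\<lambda>z'. \<Sum>z\<in>A. g z z') \<le> scale_entropy A a b f"
  proof (rule scale_entropy_mono[OF A _ _ ab])
    fix z' assume z': "z' \<in> A"
    show "0 \<le> (\<Sum>z\<in>A. g z z')" by (intro sum_nonneg g0)
    have "(\<Sum>z\<in>A. g z z') = (\<Sum>k\<in>I. w k * (\<Sum>z\<in>A. J k z z'))"
      unfolding g_def by (subst sum.swap) (simp add: sum_distrib_left)
    also have "\<dots> \<le> (\<Sum>k\<in>I. w k * f z')" using r z' w by (intro sum_mono mult_left_mono) auto
    also have "\<dots> = f z'" using w by (simp add: sum_distrib_right[symmetric])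
    finally show "(\<Sum>z\<in>A. g z z') \<le> f z'" .
  qed
  moreover have "(\<Sum>z\<in>A. scale_entropy A a b (g z)) \<le> scale_entropy A a b (\<lambda>z'. \<Sum>z\<in>A. g z z')"
    by (rule scale_entropy_sum[OF A A _ ab]) (rule g0)
  moreover have "(\<Sum>z\<in>A. sum (g z) A * ln (1 / p) - 9 * f z) \<le> (\<Sum>z\<in>A. scale_entropy A a b (g z))"
  proof (rule sum_mono)
    fix z assume z: "z \<in> A"
    have gf: "sum (g z) A \<le> f z"
    proof -
      have "sum (g z) A = (\<Sum>k\<in>I. w k * (\<Sum>z'\<in>A. J k z z'))"
        unfolding g_def by (subst sum.swap) (simp add: sum_distrib_left)
      also have "\<dots> \<le> (\<Sum>k\<in>I. w k * f z)" using l z w by (intro sum_mono mult_left_mono) auto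
      also have "\<dots> = f z" using w by (simp add: sum_distrib_right[symmetric])
      finally show ?thesis .
    qed
    show "sum (g z) A * ln (1 / p) - 9 * f z \<le> scale_entropy A a b (g z)"
    proof (cases "f z = 0")
      case True
      then have "sum (g z) A = 0" using gf g0 by (simp add: antisym sum_nonneg)
      moreover have "0 \<le> scale_entropy A a b (g z)" by (rule scale_entropy_nonneg[OF A g0 ab])
      ultimately show ?thesis using True by simp
    next
      case False
      then have fz: "0 < f z" using f(1)[of z] by simp
      \<comment> \<open>The \<open>9\<close> counts the coarse cells within \<open>4 * 2^b\<close>
        of \<open>z\<close>. The loss is charged to \<open>f z\<close>, hence amounts to
        \<open>9\<close> after summation over \<open>z\<close>.\<close>
      have "sum (g z) A * ln (1 / p) - real 9 * f z \<le> scale_entropy A a b (g z)"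
      proof (rule scale_entropy_lower[OF A g0 ab fz gf p(1)])
        fix y assume y: "y \<in> A" "0 < g z y"
        let ?I = "{k\<in>I. \<exists>z'\<in>A. z' div 2^a = y div 2^a \<and> J k z z' \<noteq> 0}"
        have "cell_mass A (g z) a y = (\<Sum>k\<in>I. w k * (\<Sum>z'\<in>{z'\<in>A. z' div 2^a = y div 2^a}. J k z z'))"
          unfolding cell_mass_def g_def by (subst sum.swap) (simp add: sum_distrib_left)
        also have "\<dots> = (\<Sum>k\<in>?I. w k * (\<Sum>z'\<in>{z'\<in>A. z' div 2^a = y div 2^a}. J k z z'))"
          using I by (intro sum.mono_neutral_right) auto
        also have "\<dots> \<le> (\<Sum>k\<in>?I. w k * f z)"
        proof (intro sum_mono mult_left_mono)
          fix k assume k: "k \<in> ?I"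
          have "(\<Sum>z'\<in>{z'\<in>A. z' div 2^a = y div 2^a}. J k z z') \<le> (\<Sum>z'\<in>A. J k z z')"
            using A J by (intro sum_mono2) auto
          then show "(\<Sum>z'\<in>{z'\<in>A. z' div 2^a = y div 2^a}. J k z z') \<le> f z" using l[of k z] k z by auto
        qed (use w in auto)
        also have "\<dots> \<le> f z * p"
          unfolding sum_distrib_right[symmetric] using conc[OF z, of "y div 2^a"] fz by (simp add: mult.commute)
        finally show "cell_mass A (g z) a y \<le> f z * p" .
      next
        fix y assume y: "y \<in> A" "0 < g z y"
        then have "(\<Sum>k\<in>I. w k * J k z y) \<noteq> 0" unfolding g_def by simp
        then obtain k where "k \<in> I" "w k * J k z y \<noteq> 0" by (rule sum.not_neutral_contains_not_neutral)
        then have "\<bar>y - z\<bar> \<le> 4 * 2^b" using step by auto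
        then have "z + (-4) * 2^b \<le> y" "y \<le> z + 4 * 2^b" by auto
        then have "(z + (-4) * 2^b) div 2^b \<le> y div 2^b" "y div 2^b \<le> (z + 4 * 2^b) div 2^b"
          by (intro zdiv_mono1; simp)+
        moreover have "(z + (-4) * 2^b) div 2^b = -4 + z div 2^b" by (rule div_mult_self1) simp
        moreover have "(z + 4 * 2^b) div 2^b = 4 + z div 2^b" by (rule div_mult_self1) simp
        ultimately show "y div 2^b \<in> {z div 2^b - 4 .. z div 2^b + 4}" by simp
      qed auto
      then show ?thesis by simp
    qed
  qed
  moreover have "(1 - \<tau>) * ln (1 / p) - 9 \<le> (\<Sum>z\<in>A. sum (g z) A * ln (1 / p) - 9 * f z)"
  proof -
    have "(\<Sum>z\<in>A. sum (g z) A) = (\<Sum>z\<in>A. \<Sum>k\<in>I. w k * (\<Sum>z'\<in>A. J k z z'))"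
      unfolding g_def by (intro sum.cong refl, subst sum.swap) (simp add: sum_distrib_left)
    also have "\<dots> = (\<Sum>k\<in>I. w k * (\<Sum>z\<in>A. \<Sum>z'\<in>A. J k z z'))"
      by (subst sum.swap) (simp add: sum_distrib_left)
    finally have "1 - \<tau> \<le> (\<Sum>z\<in>A. sum (g z) A)" using mass by simp
    then have "(1 - \<tau>) * ln (1 / p) \<le> (\<Sum>z\<in>A. sum (g z) A) * ln (1 / p)"
      using p by (intro mult_right_mono) auto
    then show ?thesis using f by (simp add: sum_subtractf sum_distrib_right sum_distrib_left[symmetric])
  qed
  ultimately show ?thesis by linarith
qed

section \<open>Binary trees in sets of integers\<close>

text \<open>A pattern lists the levels of base \<open>2^T\<close> from coarse to fine. The entry \<open>0\<close> stands for a level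
  without branching, and \<open>k > 0\<close> for a branching into two halves at distance comparable to
  \<open>2^(- k)\<close> times the cell size of the level.\<close>

fun fits :: "nat \<Rightarrow> nat list \<Rightarrow> btree \<Rightarrow> bool" where
  "fits T [] t \<longleftrightarrow> (\<exists>x. t = Leaf x)"
| "fits T (k # P) t \<longleftrightarrow>
     (if k = 0 then fits T P t
      else \<exists>r s. t = Node r s \<and> fits T P r \<and> fits T P s \<and>
        (\<exists>m. \<forall>x\<in>leaves t. x div 2^(T * Suc (length P)) = m) \<and>
        (\<forall>x\<in>leaves r. \<forall>y\<in>leaves s.
           2^(T * Suc (length P) - k) \<le> 2 * (x - y) \<and> x - y \<le> 2 * 2^(T * Suc (length P) - k)))"

lemma div_pow2_coarse:
  fixes x :: int
  shows "x div 2^(a + b) = x div 2^a div 2^b"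
  by (simp add: power_add zdiv_zmult2_eq)

lemma cell_bounds:
  fixes x :: int
  assumes "x div 2^a = m"
  shows "m * 2^a \<le> x" "x < m * 2^a + 2^a"
proof -
  have "x = m * 2^a + x mod 2^a" using assms div_mult_mod_eq[of x "2^a"] by simp
  moreover have "0 \<le> x mod 2^a" "x mod 2^a < 2^a" by simp_all
  ultimately show "m * 2^a \<le> x" "x < m * 2^a + 2^a" by linarith+
qed

lemma fits_cell: "fits T P t \<Longrightarrow> \<exists>m. \<forall>x\<in>leaves t. x div 2^(T * length P) = m"
proof (induction P)
  case (Cons k P)
  show ?case
  proof (cases "k = 0")
    case True
    then obtain m where "\<forall>x\<in>leaves t. x div 2^(T * length P) = m" using Cons by auto
    then have "\<forall>x\<in>leaves t. x div 2^(T * length P + T) = m div 2^T" by (simp add: div_pow2_coarse)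
    then show ?thesis by (auto simp: add.commute)
  qed (use Cons in auto)
qed auto

text \<open>The leaves of a tree fitting \<open>P'\<close> share one cell, and each branching above
  at most doubles the number of such trees.\<close>

lemma fits_cover:
  "fits T (P @ P') t \<Longrightarrow> \<exists>K. finite K \<and> card K \<le> 2^length (filter (\<lambda>k. k \<noteq> 0) P) \<and>
     (\<forall>x\<in>leaves t. x div 2^(T * length P') \<in> K)"
proof (induction P arbitrary: t)
  case Nil
  then obtain m where "\<forall>x\<in>leaves t. x div 2^(T * length P') = m" using fits_cell[of T P' t] by auto
  then show ?case by (intro exI[of _ "{m}"]) auto
next
  case (Cons k P)
  show ?case
  proof (cases "k = 0")
    case False
    then obtain r s where t: "t = Node r s" "fits T (P @ P') r" "fits T (P @ P') s" using Cons.prems by auto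
    obtain K where K: "finite K" "card K \<le> 2^length (filter (\<lambda>k. k \<noteq> 0) P)" "\<forall>x\<in>leaves r. x div 2^(T * length P') \<in> K"
      using Cons.IH[OF t(2)] by auto
    obtain L where L: "finite L" "card L \<le> 2^length (filter (\<lambda>k. k \<noteq> 0) P)" "\<forall>x\<in>leaves s. x div 2^(T * length P') \<in> L"
      using Cons.IH[OF t(3)] by auto
    have "card (K \<union> L) \<le> 2^length (filter (\<lambda>k. k \<noteq> 0) (k # P))"
      using card_Un_le[of K L] K(2) L(2) False by simp
    then show ?thesis using K L t(1) by (intro exI[of _ "K \<union> L"]) auto
  qed (use Cons in auto)
qed

text \<open>Either \<open>I\<close> has at most two points, or the pigeonhole principle at the finest dyadic
  scale with three points of \<open>I\<close> in one cell yields two nonadjacent points.\<close>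

lemma separated_pair:
  fixes I :: "int set"
  assumes I: "finite I" "I \<noteq> {}" "\<forall>x\<in>I. x div 2^T = m" and T: "1 \<le> T"
  shows "\<exists>k<T. card I \<le> 2^(k + 1) \<and> (k > 0 \<longrightarrow> (\<exists>x\<in>I. \<exists>y\<in>I. 2^(T - k) \<le> x - y \<and> x - y < 2^(T - k + 1)))"
proof (cases "card I \<le> 2")
  case True
  then show ?thesis using T by (intro exI[of _ 0]) auto
next
  case False
  \<comment> \<open>More than \<open>2 * 2^j\<close> points lie in the \<open>2^j\<close> subcells
    of size \<open>2^(T - j)\<close>, so some subcell contains three of them, and two of these
    differ by at least two.\<close>
  define j where "j = (GREATEST j. 2^(j + 1) < card I)"
  have P0: "2^(0 + 1) < card I" using False by simp
  have bnd: "\<forall>j. 2^(j + 1) < card I \<longrightarrow> j \<le> card I"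
    by (metis add_lessD1 less_exp less_imp_le less_trans power_add power_one_right mult_2_right)
  have j: "2^(j + 1) < card I" unfolding j_def by (rule GreatestI_nat[where P="\<lambda>j. 2^(j + 1) < card I", OF P0]) (use bnd in blast)
  have jmax: "card I \<le> 2^(j + 2)"
  proof (rule ccontr)
    assume "\<not> card I \<le> 2^(j + 2)"
    then have "2^(Suc j + 1) < card I" by simp
    then have "Suc j \<le> j" unfolding j_def
      by (rule Greatest_le_nat[where P="\<lambda>j. 2^(j + 1) < card I"]) (use bnd in blast)
    then show False by simp
  qed
  have sub: "I \<subseteq> {m * 2^T ..< m * 2^T + 2^T}"
  proof
    fix x assume "x \<in> I"
    then have "x div 2^T = m" using I by auto
    then show "x \<in> {m * 2^T ..< m * 2^T + 2^T}" using cell_bounds[of x T m] by simp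
  qed
  have "card I \<le> 2^T" using card_mono[OF _ sub] by (simp add: nat_power_eq)
  then have jT: "j + 1 < T" using j by (metis less_le_trans nat_power_less_imp_less zero_less_numeral)
  have "\<exists>x\<in>I. \<exists>y\<in>I. 2 \<le> x - y \<and> x - y < 2^(T - j)"
  proof (rule ccontr)
    assume neg: "\<not> (\<exists>x\<in>I. \<exists>y\<in>I. 2 \<le> x - y \<and> x - y < 2^(T - j))"
    have two: "card {x\<in>I. x div 2^(T - j) = c} \<le> 2" for c
    proof (cases "{x\<in>I. x div 2^(T - j) = c} = {}")
      case False
      let ?S = "{x\<in>I. x div 2^(T - j) = c}"
      have fin: "finite ?S" using I by simp
      define y where "y = Min ?S"
      have y: "y \<in> ?S" unfolding y_def by (rule Min_in[OF fin False])
      have "?S \<subseteq> {y, y + 1}"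
      proof
        fix x assume x: "x \<in> ?S"
        have "y \<le> x" unfolding y_def by (rule Min_le[OF fin x])
        moreover have "x - y < 2^(T - j)"
        proof -
          have "x div 2^(T - j) = c" "y div 2^(T - j) = c" using x y by auto
          from cell_bounds[OF this(1)] cell_bounds[OF this(2)] show ?thesis by linarith
        qed
        ultimately have "x - y < 2" using neg x y by force
        then show "x \<in> {y, y + 1}" using \<open>y \<le> x\<close> by auto
      qed
      then have "card ?S \<le> card {y, y + 1}" by (intro card_mono) auto
      then show ?thesis by simp
    next
      case True then show ?thesis by (simp only: card.empty)
    qed
    let ?C = "(\<lambda>x. x div 2^(T - j)) ` I"
    have "?C \<subseteq> {m * 2^j ..< m * 2^j + 2^j}"
    proof safe
      fix x assume "x \<in> I"
      then have "x div 2^(T - j) div 2^j = m"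
        using I(3) jT div_pow2_coarse[of x "T - j" j] by auto
      then show "x div 2^(T - j) \<in> {m * 2^j ..< m * 2^j + 2^j}"
        using cell_bounds[of "x div 2^(T - j)" j m] by simp
    qed
    from card_mono[OF _ this] have cC: "card ?C \<le> 2^j" by (simp add: nat_power_eq)
    have "card I = card (\<Union>c\<in>?C. {x\<in>I. x div 2^(T - j) = c})" by (rule arg_cong[where f=card]) auto
    also have "\<dots> \<le> (\<Sum>c\<in>?C. card {x\<in>I. x div 2^(T - j) = c})"
      by (rule card_UN_le) (use I in auto)
    also have "\<dots> \<le> (\<Sum>c\<in>?C. 2)" by (rule sum_mono) (rule two)
    also have "\<dots> \<le> 2^(j + 1)" using cC by simp
    finally show False using j by simp
  qed
  then obtain x y where xy: "x \<in> I" "y \<in> I" "2 \<le> x - y" "x - y < 2^(T - j)" by blast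
  \<comment> \<open>The witness for \<open>k\<close> will be \<open>T - e\<close>. From
    \<open>x - y < 2^(T - j)\<close> follows \<open>e < T - j\<close>, so \<open>2^(k + 1)\<close>
    is at least \<open>2^(j + 2)\<close>, which bounds \<open>card I\<close>; and
    \<open>x - y \<ge> 2\<close> gives \<open>e \<ge> 1\<close>, that is
    \<open>k < T\<close>.\<close>
  define e where "e = (GREATEST e. 2^e \<le> x - y)"
  have bnd': "e \<le> T" if "2^e \<le> x - y" for e
  proof -
    have "(2::int)^e < 2^(T - j)" using that xy by linarith
    then show ?thesis by (simp add: power_strict_increasing_iff)
  qed
  have e: "2^e \<le> x - y" unfolding e_def
    by (rule GreatestI_nat[where P="\<lambda>e. 2^e \<le> x - y" and k=1 and b=T]) (use xy bnd' in auto)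
  have e1: "1 \<le> e" unfolding e_def
    by (rule Greatest_le_nat[where P="\<lambda>e. 2^e \<le> x - y" and b=T]) (use xy bnd' in auto)
  have emax: "x - y < 2^(e + 1)"
  proof (rule ccontr)
    assume "\<not> x - y < 2^(e + 1)"
    then have "2^Suc e \<le> x - y" by simp
    then have "Suc e \<le> e" unfolding e_def
      by (rule Greatest_le_nat[where P="\<lambda>e. 2^e \<le> x - y"]) (use bnd' in auto)
    then show False by simp
  qed
  have "(2::int)^e < 2^(T - j)" using e xy by linarith
  then have eT: "e < T - j" by (simp add: power_strict_increasing_iff)
  have "card I \<le> 2^(T - e + 1)"
  proof -
    have "(2::nat)^(j + 2) \<le> 2^(T - e + 1)" using eT by (intro power_increasing) auto
    then show ?thesis using jmax by linarith
  qed
  moreover have "T - (T - e) = e" using eT by simp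
  ultimately show ?thesis using e1 eT e emax xy(1,2)
    by (intro exI[of _ "T - e"]) auto
qed

text \<open>Induction from fine to coarse. Points with a common lower pattern \<open>P\<close>
  occupy a set \<open>N P\<close> of cells one level down, and \<open>separated_pair\<close> for
  \<open>N P\<close> yields the new entry. The two cells found both contain a tree for the same
  \<open>P\<close>, so these can be joined by a node. Choosing the entry per class and not per cell
  is what synchronises the branchings. The entry also pays for \<open>card (N P)\<close>, so the
  pattern bounds the number of cells that its class meets at every level.\<close>

lemma pattern_partition:
  fixes B :: "int set"
  assumes T: "1 \<le> T" and B: "finite B" "\<forall>x\<in>B. x div 2^(T * l) = m"
  shows "\<exists>\<pi>. (\<forall>b\<in>B. length (\<pi> b) = l \<and> set (\<pi> b) \<subseteq> {..<T}) \<and>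
     (\<forall>P\<in>\<pi> ` B. (\<exists>t. fits T P t \<and> leaves t \<subseteq> {b\<in>B. \<pi> b = P}) \<and>
        (\<forall>j\<le>l. card ((\<lambda>b. b div 2^(T * (l - j))) ` {b\<in>B. \<pi> b = P}) \<le> (\<Prod>i<j. 2^(P ! i + 1))))"
  using B
proof (induction l arbitrary: B m)
  case 0
  then have "b = m" if "b \<in> B" for b using that by simp
  then have "fits T [] (Leaf m) \<and> leaves (Leaf m) \<subseteq> {b\<in>B. [] = []}" if "B \<noteq> {}" using that by auto
  moreover have "card ((\<lambda>b. b) ` {b\<in>B. [] = []}) \<le> 1"
  proof -
    have "\<forall>a\<in>B. \<forall>b\<in>B. a = b" using \<open>\<And>b. b \<in> B \<Longrightarrow> b = m\<close> by metis
    then show ?thesis by (simp add: card_le_Suc0_iff_eq[OF 0(1)])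
  qed
  moreover have "\<exists>t. fits T [] t \<and> leaves t \<subseteq> {b\<in>B. [] = []}" if "B \<noteq> {}"
    using calculation(1)[OF that] by blast
  ultimately show ?case by (intro exI[of _ "\<lambda>_. []"]) auto
next
  case (Suc l)
  let ?c = "\<lambda>b. b div 2^(T * l)"
  define \<Phi> where "\<Phi> \<kappa> \<pi> \<longleftrightarrow> (\<forall>b\<in>{b\<in>B. ?c b = \<kappa>}. length (\<pi> b) = l \<and> set (\<pi> b) \<subseteq> {..<T}) \<and>
     (\<forall>P\<in>\<pi> ` {b\<in>B. ?c b = \<kappa>}. (\<exists>t. fits T P t \<and> leaves t \<subseteq> {b\<in>{b\<in>B. ?c b = \<kappa>}. \<pi> b = P}) \<and>
        (\<forall>j\<le>l. card ((\<lambda>b. b div 2^(T * (l - j))) ` {b\<in>{b\<in>B. ?c b = \<kappa>}. \<pi> b = P}) \<le> (\<Prod>i<j. 2^(P ! i + 1))))"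
    for \<kappa> \<pi>
  have "\<exists>\<pi>. \<Phi> \<kappa> \<pi>" for \<kappa>
    unfolding \<Phi>_def by (rule Suc.IH[where m=\<kappa>]) (use Suc.prems in auto)
  then obtain \<rho> where \<rho>\<Phi>: "\<And>\<kappa>. \<Phi> \<kappa> (\<rho> \<kappa>)" by metis
  have \<rho>: "length (\<rho> \<kappa> b) = l \<and> set (\<rho> \<kappa> b) \<subseteq> {..<T}" if "b \<in> B" "?c b = \<kappa>" for \<kappa> b
    using \<rho>\<Phi>[of \<kappa>, unfolded \<Phi>_def, THEN conjunct1] that by blast
  have \<rho>tree: "\<exists>t. fits T P t \<and> leaves t \<subseteq> {b\<in>{b\<in>B. ?c b = \<kappa>}. \<rho> \<kappa> b = P}"
    if "P \<in> \<rho> \<kappa> ` {b\<in>B. ?c b = \<kappa>}" for \<kappa> P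
    using \<rho>\<Phi>[of \<kappa>, unfolded \<Phi>_def, THEN conjunct2, rule_format, OF that] by (rule conjunct1)
  have \<rho>card: "card ((\<lambda>b. b div 2^(T * (l - j))) ` {b\<in>{b\<in>B. ?c b = \<kappa>}. \<rho> \<kappa> b = P}) \<le> (\<Prod>i<j. 2^(P ! i + 1))"
    if "P \<in> \<rho> \<kappa> ` {b\<in>B. ?c b = \<kappa>}" "j \<le> l" for \<kappa> P j
    using \<rho>\<Phi>[of \<kappa>, unfolded \<Phi>_def, THEN conjunct2, THEN bspec, OF that(1), THEN conjunct2] that(2) by blast
  define \<sigma> where "\<sigma> b = \<rho> (?c b) b" for b
  define N where "N P = ?c ` {b\<in>B. \<sigma> b = P}" for P
  have N: "\<exists>k<T. card (N P) \<le> 2^(k + 1) \<and>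
     (k > 0 \<longrightarrow> (\<exists>x\<in>N P. \<exists>y\<in>N P. 2^(T - k) \<le> x - y \<and> x - y < 2^(T - k + 1)))" if P: "P \<in> \<sigma> ` B" for P
  proof (rule separated_pair[OF _ _ _ T])
    show "finite (N P)" unfolding N_def using Suc.prems by simp
    show "N P \<noteq> {}" unfolding N_def using P by auto
    show "\<forall>x\<in>N P. x div 2^T = m"
      using Suc.prems(2) div_pow2_coarse[of _ "T * l" T] by (auto simp: N_def add.commute)
  qed
  then obtain k where k: "\<And>P. P \<in> \<sigma> ` B \<Longrightarrow> k P < T" "\<And>P. P \<in> \<sigma> ` B \<Longrightarrow> card (N P) \<le> 2^(k P + 1)"
    "\<And>P. P \<in> \<sigma> ` B \<Longrightarrow> k P > 0 \<Longrightarrow> \<exists>x\<in>N P. \<exists>y\<in>N P. 2^(T - k P) \<le> x - y \<and> x - y < 2^(T - k P + 1)"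
    by metis
  define \<pi> where "\<pi> b = k (\<sigma> b) # \<sigma> b" for b
  have cls: "{b\<in>B. \<pi> b = k P # P} = {b\<in>B. \<sigma> b = P}" for P unfolding \<pi>_def by auto
  have sub: "\<exists>t. fits T P t \<and> leaves t \<subseteq> {b\<in>B. \<sigma> b = P} \<and> (\<forall>x\<in>leaves t. ?c x = \<kappa>)"
    if "\<kappa> \<in> N P" for \<kappa> P
  proof -
    have "P \<in> \<rho> \<kappa> ` {b\<in>B. ?c b = \<kappa>}" using that unfolding N_def \<sigma>_def by auto
    from \<rho>tree[OF this] show ?thesis unfolding \<sigma>_def by fastforce
  qed
  have tree: "\<exists>t. fits T (k P # P) t \<and> leaves t \<subseteq> {b\<in>B. \<sigma> b = P}" if P: "P \<in> \<sigma> ` B" for P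
  proof (cases "k P = 0")
    case True
    obtain \<kappa> where "\<kappa> \<in> N P" using P unfolding N_def by auto
    from sub[OF this] True show ?thesis by auto
  next
    case False
    have lenP: "length P = l" using P \<rho> unfolding \<sigma>_def by auto
    have kT: "k P < T" using k(1)[OF P] .
    obtain \<kappa>1 \<kappa>2 where \<kappa>: "\<kappa>1 \<in> N P" "\<kappa>2 \<in> N P" "2^(T - k P) \<le> \<kappa>1 - \<kappa>2" "\<kappa>1 - \<kappa>2 < 2^(T - k P + 1)"
      using k(3)[OF P] False by blast
    obtain r where r: "fits T P r" "leaves r \<subseteq> {b\<in>B. \<sigma> b = P}" "\<forall>x\<in>leaves r. ?c x = \<kappa>1" using sub[OF \<kappa>(1)] by blast
    obtain s where s: "fits T P s" "leaves s \<subseteq> {b\<in>B. \<sigma> b = P}" "\<forall>x\<in>leaves s. ?c x = \<kappa>2" using sub[OF \<kappa>(2)] by blast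
    \<comment> \<open>As \<open>k P < T\<close>, the cells are at least two apart. Positions inside
      them shift the distance by less than one cell size \<open>Q\<close>, which costs at most a
      factor two below; above, integrality of the strict bound leaves room for
      \<open>Q\<close>.\<close>
    have dist: "2^(T * Suc (length P) - k P) \<le> 2 * (x - y) \<and> x - y \<le> 2 * 2^(T * Suc (length P) - k P)"
      if x: "x \<in> leaves r" and y: "y \<in> leaves s" for x y
    proof -
      define d where "d = T - k P - 1"
      have d: "T - k P = d + 1" unfolding d_def using kT by simp
      define Q :: int where "Q = 2^(T * l)"
      have Q: "0 < Q" unfolding Q_def by simp
      have e: "(2::int)^(T * Suc (length P) - k P) = 2 * 2^d * Q"
      proof -
        have "T * Suc (length P) - k P = Suc d + T * l" using d kT lenP by (simp add: algebra_simps)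
        then show ?thesis unfolding Q_def by (simp add: power_add)
      qed
      have xx: "x = \<kappa>1 * Q + x mod Q" "y = \<kappa>2 * Q + y mod Q"
        using r(3) s(3) x y div_mult_mod_eq[of x Q] div_mult_mod_eq[of y Q] unfolding Q_def by auto
      have mm: "0 \<le> x mod Q" "x mod Q < Q" "0 \<le> y mod Q" "y mod Q < Q" using Q by simp_all
      have diff: "x - y = (\<kappa>1 - \<kappa>2) * Q + (x mod Q - y mod Q)" using xx by (simp add: left_diff_distrib)
      have b1: "2 * 2^d \<le> \<kappa>1 - \<kappa>2" "\<kappa>1 - \<kappa>2 \<le> 4 * 2^d - 1" using \<kappa>(3,4) unfolding d by simp_all
      have d1: "(1::int) \<le> 2^d" by simp
      have D: "2 * 2^d * Q \<le> (\<kappa>1 - \<kappa>2) * Q" "(\<kappa>1 - \<kappa>2) * Q \<le> (4 * 2^d - 1) * Q" "1 * Q \<le> 2^d * Q"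
        using b1 d1 Q by (intro mult_right_mono; simp)+
      define D E where "D = (\<kappa>1 - \<kappa>2) * Q" and "E = 2^d * Q"
      have "2 * E \<le> D" "D \<le> 4 * E - Q" "Q \<le> E"
        using D by (simp_all add: D_def E_def left_diff_distrib mult.assoc)
      moreover have "2 * E \<le> 2 * (D + (u - v)) \<and> D + (u - v) \<le> 2 * (2 * E)"
        if "2 * E \<le> D" "D \<le> 4 * E - Q" "Q \<le> E" "0 \<le> u" "u < Q" "0 \<le> v" "v < Q" for u v :: int
        using that by auto
      ultimately have "2 * E \<le> 2 * (D + (x mod Q - y mod Q)) \<and> D + (x mod Q - y mod Q) \<le> 2 * (2 * E)"
        using mm by blast
      then show ?thesis unfolding e diff by (simp add: D_def E_def mult.assoc)
    qed
    have "\<forall>x\<in>leaves (Node r s). x div 2^(T * Suc (length P)) = m"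
      using r(2) s(2) Suc.prems(2) lenP by auto
    then have "fits T (k P # P) (Node r s)" using False r(1) s(1) dist by auto
    then show ?thesis using r(2) s(2) by (intro exI[of _ "Node r s"]) auto
  qed
  have cells: "card ((\<lambda>b. b div 2^(T * (Suc l - j))) ` {b\<in>B. \<sigma> b = P}) \<le> (\<Prod>i<j. 2^((k P # P) ! i + 1))"
    if P: "P \<in> \<sigma> ` B" and j: "j \<le> Suc l" for P j
  proof (cases j)
    case 0
    have "(\<lambda>b. b div 2^(T * Suc l)) ` {b\<in>B. \<sigma> b = P} \<subseteq> {m}" using Suc.prems(2) by auto
    then have "card ((\<lambda>b. b div 2^(T * Suc l)) ` {b\<in>B. \<sigma> b = P}) \<le> card {m}" by (intro card_mono) auto
    then show ?thesis using 0 by simp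
  next
    case (Suc i)
    let ?M = "\<Prod>i<i. 2^(P ! i + 1) :: nat"
    have "(\<lambda>b. b div 2^(T * (l - i))) ` {b\<in>B. \<sigma> b = P}
      = (\<Union>\<kappa>\<in>N P. (\<lambda>b. b div 2^(T * (l - i))) ` {b\<in>{b\<in>B. ?c b = \<kappa>}. \<rho> \<kappa> b = P})"
      unfolding N_def \<sigma>_def by auto
    then have "card ((\<lambda>b. b div 2^(T * (l - i))) ` {b\<in>B. \<sigma> b = P})
      \<le> (\<Sum>\<kappa>\<in>N P. card ((\<lambda>b. b div 2^(T * (l - i))) ` {b\<in>{b\<in>B. ?c b = \<kappa>}. \<rho> \<kappa> b = P}))"
      using card_UN_le[of "N P"] Suc.prems(1) by (simp add: N_def)
    also have "\<dots> \<le> (\<Sum>\<kappa>\<in>N P. ?M)"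
    proof (rule sum_mono)
      fix \<kappa> assume "\<kappa> \<in> N P"
      then have "P \<in> \<rho> \<kappa> ` {b\<in>B. ?c b = \<kappa>}" unfolding N_def \<sigma>_def by auto
      then show "card ((\<lambda>b. b div 2^(T * (l - i))) ` {b\<in>{b\<in>B. ?c b = \<kappa>}. \<rho> \<kappa> b = P}) \<le> ?M"
        by (rule \<rho>card) (use j Suc in auto)
    qed
    also have "\<dots> \<le> 2^(k P + 1) * ?M" using k(2)[OF P] by simp
    also have "\<dots> = (\<Prod>i<Suc i. 2^((k P # P) ! i + 1))"
      by (subst prod.lessThan_Suc_shift) simp
    finally show ?thesis using Suc by simp
  qed
  show ?case
  proof (intro exI[of _ \<pi>] conjI ballI allI impI)
    fix b assume b: "b \<in> B"
    then show "length (\<pi> b) = Suc l" using \<rho> unfolding \<pi>_def \<sigma>_def by auto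
    show "set (\<pi> b) \<subseteq> {..<T}" using \<rho>[OF b] k(1)[of "\<sigma> b"] b unfolding \<pi>_def \<sigma>_def by auto
  next
    fix P' assume "P' \<in> \<pi> ` B"
    then obtain P where P: "P \<in> \<sigma> ` B" "P' = k P # P" unfolding \<pi>_def by auto
    show "\<exists>t. fits T P' t \<and> leaves t \<subseteq> {b\<in>B. \<pi> b = P'}" unfolding P(2) cls by (rule tree[OF P(1)])
    fix j assume "j \<le> Suc l"
    then show "card ((\<lambda>b. b div 2^(T * (Suc l - j))) ` {b\<in>B. \<pi> b = P'}) \<le> (\<Prod>i<j. 2^(P' ! i + 1))"
      unfolding P(2) cls by (rule cells[OF P(1)])
  qed
qed

text \<open>Pigeonhole over at most \<open>T^l\<close> patterns. This number is
  \<open>2 powr (l * log 2 T)\<close>, negligible against \<open>2^(T * l)\<close> for large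
  \<open>T\<close>.\<close>

lemma popular_pattern:
  fixes B :: "int set"
  assumes T: "1 \<le> T" and B: "finite B" "B \<noteq> {}" "\<forall>x\<in>B. x div 2^(T * l) = m"
  obtains P B' t where "length P = l" "set P \<subseteq> {..<T}" "B' \<subseteq> B" "card B \<le> T^l * card B'"
    "fits T P t" "leaves t \<subseteq> B'"
    "\<And>j. j \<le> l \<Longrightarrow> card ((\<lambda>b. b div 2^(T * (l - j))) ` B') \<le> (\<Prod>i<j. 2^(P ! i + 1))"
proof -
  obtain \<pi> where \<pi>0: "(\<forall>b\<in>B. length (\<pi> b) = l \<and> set (\<pi> b) \<subseteq> {..<T}) \<and>
     (\<forall>P\<in>\<pi> ` B. (\<exists>t. fits T P t \<and> leaves t \<subseteq> {b\<in>B. \<pi> b = P}) \<and>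
        (\<forall>j\<le>l. card ((\<lambda>b. b div 2^(T * (l - j))) ` {b\<in>B. \<pi> b = P}) \<le> (\<Prod>i<j. 2^(P ! i + 1))))"
    by (rule exE[OF pattern_partition[OF T B(1,3)]])
  note \<pi> = \<pi>0[THEN conjunct1, THEN bspec] \<pi>0[THEN conjunct2, THEN bspec, THEN conjunct1]
  note \<pi>card = \<pi>0[THEN conjunct2, THEN bspec, THEN conjunct2, rule_format]
  have "\<pi> ` B \<subseteq> {xs. set xs \<subseteq> {..<T} \<and> length xs = l}" using \<pi>(1) by auto
  then have cP: "card (\<pi> ` B) \<le> T^l"
    using card_mono[OF finite_lists_length_eq[of "{..<T}" l]] by (simp add: card_lists_length_eq)
  have "\<exists>P\<in>\<pi> ` B. card B \<le> T^l * card {b\<in>B. \<pi> b = P}"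
  proof (rule ccontr)
    assume "\<not> ?thesis"
    then have *: "T^l * card {b\<in>B. \<pi> b = P} \<le> card B - 1" if "P \<in> \<pi> ` B" for P using that by force
    have "card B > 0" using B by (simp add: card_gt_0_iff)
    have "card B = (\<Sum>P\<in>\<pi> ` B. card {b\<in>B. \<pi> b = P})"
      using sum.image_gen[OF B(1), of "\<lambda>_. 1::nat" \<pi>] by simp
    then have "T^l * card B = (\<Sum>P\<in>\<pi> ` B. T^l * card {b\<in>B. \<pi> b = P})" by (simp add: sum_distrib_left)
    also have "\<dots> \<le> (\<Sum>P\<in>\<pi> ` B. card B - 1)" by (rule sum_mono) (rule *)
    also have "\<dots> \<le> T^l * (card B - 1)" using cP by simp
    finally show False using T \<open>card B > 0\<close> by simp
  qed
  then obtain P where P: "P \<in> \<pi> ` B" "card B \<le> T^l * card {b\<in>B. \<pi> b = P}" by blast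
  obtain t where t: "fits T P t" "leaves t \<subseteq> {b\<in>B. \<pi> b = P}" using \<pi>(2)[OF P(1)] by blast
  show ?thesis
  proof (rule that[of P "{b\<in>B. \<pi> b = P}" t])
    show "length P = l" "set P \<subseteq> {..<T}" using P(1) \<pi>(1) by auto
  qed (use P t \<pi>card[OF P(1)] in auto)
qed

section \<open>Small sumsets force large entropy\<close>

lemma sum_UN_le_sum:
  fixes w :: "'b \<Rightarrow> real"
  assumes "finite K" "\<And>k. k \<in> K \<Longrightarrow> finite (V k)" "\<And>k x. k \<in> K \<Longrightarrow> x \<in> V k \<Longrightarrow> 0 \<le> w x"
  shows "sum w (\<Union>k\<in>K. V k) \<le> (\<Sum>k\<in>K. sum w (V k))"
  using assms
proof (induction K rule: finite_induct)
  case (insert k K)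
  have "sum w (V k \<union> (\<Union>k\<in>K. V k)) + sum w (V k \<inter> (\<Union>k\<in>K. V k)) = sum w (V k) + sum w (\<Union>k\<in>K. V k)"
    using insert by (intro sum.union_inter) auto
  moreover have "0 \<le> sum w (V k \<inter> (\<Union>k\<in>K. V k))" using insert by (intro sum_nonneg) auto
  moreover have "sum w (\<Union>k\<in>K. V k) \<le> (\<Sum>k\<in>K. sum w (V k))" using insert by auto
  ultimately have "sum w (V k \<union> (\<Union>k\<in>K. V k)) \<le> sum w (V k) + (\<Sum>k\<in>K. sum w (V k))" by linarith
  then show ?case using insert by simp
qed simp

text \<open>Unfolded from the root, \<open>\<Phi> t - h\<close> telescopes into the sum over levels
  of the mean of \<open>\<Phi> (Node a b) - (\<Phi> a + \<Phi> b) / 2\<close> over the nodes of the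
  level. \<open>J r\<close> is this mean at position \<open>r\<close>, and some node does not exceed
  the mean.\<close>

lemma tree_node_selection:
  fixes \<Phi> :: "btree \<Rightarrow> real"
  assumes "fits T P t" "\<And>x. x \<in> leaves t \<Longrightarrow> \<Phi> (Leaf x) = h"
  shows "\<exists>J. (\<Sum>r<length P. J r) = \<Phi> t - h \<and> (\<forall>r<length P. (P ! r = 0 \<longrightarrow> J r = 0) \<and>
    (P ! r \<noteq> 0 \<longrightarrow> (\<exists>a b. fits T (drop r P) (Node a b) \<and> leaves (Node a b) \<subseteq> leaves t \<and>
       \<Phi> (Node a b) - (\<Phi> a + \<Phi> b) / 2 \<le> J r)))"
  using assms
proof (induction P arbitrary: t)
  case Nil
  then show ?case by auto
next
  case (Cons k P)
  let ?G = "\<lambda>r a b. fits T (drop r P) (Node a b)"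
  show ?case
  proof (cases "k = 0")
    case True
    then have "fits T P t" using Cons.prems by simp
    from Cons.IH[OF this Cons.prems(2)] obtain J where
      J: "(\<Sum>r<length P. J r) = \<Phi> t - h" "\<forall>r<length P. (P ! r = 0 \<longrightarrow> J r = 0) \<and>
    (P ! r \<noteq> 0 \<longrightarrow> (\<exists>a b. fits T (drop r P) (Node a b) \<and> leaves (Node a b) \<subseteq> leaves t \<and>
       \<Phi> (Node a b) - (\<Phi> a + \<Phi> b) / 2 \<le> J r))" by blast
    show ?thesis
    proof (intro exI[of _ "case_nat 0 J"] conjI)
      show "(\<Sum>r<length (k # P). case_nat 0 J r) = \<Phi> t - h"
        unfolding length_Cons by (subst sum.lessThan_Suc_shift) (simp add: J(1))
      show "\<forall>r<length (k # P). ((k # P) ! r = 0 \<longrightarrow> case_nat 0 J r = 0) \<and>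
       ((k # P) ! r \<noteq> 0 \<longrightarrow> (\<exists>a b. fits T (drop r (k # P)) (Node a b) \<and> leaves (Node a b) \<subseteq> leaves t \<and>
       \<Phi> (Node a b) - (\<Phi> a + \<Phi> b) / 2 \<le> case_nat 0 J r))"
      proof (intro allI impI)
        fix r assume "r < length (k # P)"
        then show "((k # P) ! r = 0 \<longrightarrow> case_nat 0 J r = 0) \<and>
       ((k # P) ! r \<noteq> 0 \<longrightarrow> (\<exists>a b. fits T (drop r (k # P)) (Node a b) \<and> leaves (Node a b) \<subseteq> leaves t \<and>
       \<Phi> (Node a b) - (\<Phi> a + \<Phi> b) / 2 \<le> case_nat 0 J r))"
          using J(2) True by (cases r) simp_all
      qed
    qed
  next
    case False
    then obtain u v where t: "t = Node u v" "fits T P u" "fits T P v" using Cons.prems by auto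
    have lu: "leaves u \<subseteq> leaves t" and lv: "leaves v \<subseteq> leaves t" using t by auto
    have hu: "\<And>x. x \<in> leaves u \<Longrightarrow> \<Phi> (Leaf x) = h" using Cons.prems(2) lu by auto
    have hv: "\<And>x. x \<in> leaves v \<Longrightarrow> \<Phi> (Leaf x) = h" using Cons.prems(2) lv by auto
    from Cons.IH[OF t(2) hu] obtain J where
      J: "(\<Sum>r<length P. J r) = \<Phi> u - h" "\<forall>r<length P. (P ! r = 0 \<longrightarrow> J r = 0) \<and>
    (P ! r \<noteq> 0 \<longrightarrow> (\<exists>a b. fits T (drop r P) (Node a b) \<and> leaves (Node a b) \<subseteq> leaves u \<and>
       \<Phi> (Node a b) - (\<Phi> a + \<Phi> b) / 2 \<le> J r))" by blast
    from Cons.IH[OF t(3) hv] obtain K where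
      K: "(\<Sum>r<length P. K r) = \<Phi> v - h" "\<forall>r<length P. (P ! r = 0 \<longrightarrow> K r = 0) \<and>
    (P ! r \<noteq> 0 \<longrightarrow> (\<exists>a b. fits T (drop r P) (Node a b) \<and> leaves (Node a b) \<subseteq> leaves v \<and>
       \<Phi> (Node a b) - (\<Phi> a + \<Phi> b) / 2 \<le> K r))" by blast
    define M where "M = case_nat (\<Phi> t - (\<Phi> u + \<Phi> v) / 2) (\<lambda>r. (J r + K r) / 2)"
    show ?thesis
    proof (intro exI[of _ M] conjI)
      show "(\<Sum>r<length (k # P). M r) = \<Phi> t - h"
        unfolding length_Cons M_def
        by (subst sum.lessThan_Suc_shift) (simp add: sum_divide_distrib[symmetric] sum.distrib J(1) K(1) field_simps)
      show "\<forall>r<length (k # P). ((k # P) ! r = 0 \<longrightarrow> M r = 0) \<and>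
       ((k # P) ! r \<noteq> 0 \<longrightarrow> (\<exists>a b. fits T (drop r (k # P)) (Node a b) \<and> leaves (Node a b) \<subseteq> leaves t \<and>
       \<Phi> (Node a b) - (\<Phi> a + \<Phi> b) / 2 \<le> M r))"
      proof (intro allI impI)
        fix r assume r: "r < length (k # P)"
        show "((k # P) ! r = 0 \<longrightarrow> M r = 0) \<and>
       ((k # P) ! r \<noteq> 0 \<longrightarrow> (\<exists>a b. fits T (drop r (k # P)) (Node a b) \<and> leaves (Node a b) \<subseteq> leaves t \<and>
       \<Phi> (Node a b) - (\<Phi> a + \<Phi> b) / 2 \<le> M r))"
        proof (cases r)
          case 0
          then show ?thesis using Cons.prems(1) False t(1) unfolding M_def
            by (simp del: fits.simps) blast
        next
          case (Suc s)
          then have s: "s < length P" using r by simp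
          show ?thesis
          proof (cases "P ! s = 0")
            case True
            then show ?thesis using J(2) K(2) s Suc unfolding M_def by simp
          next
            case False
            obtain a b where ab: "fits T (drop s P) (Node a b)" "leaves (Node a b) \<subseteq> leaves u"
              "\<Phi> (Node a b) - (\<Phi> a + \<Phi> b) / 2 \<le> J s" using J(2) s False by blast
            obtain a' b' where ab': "fits T (drop s P) (Node a' b')" "leaves (Node a' b') \<subseteq> leaves v"
              "\<Phi> (Node a' b') - (\<Phi> a' + \<Phi> b') / 2 \<le> K s" using K(2) s False by blast
            have "J s \<le> M r \<or> K s \<le> M r" unfolding M_def Suc by (simp, linarith)
            then have "\<exists>a b. fits T (drop s P) (Node a b) \<and> leaves (Node a b) \<subseteq> leaves t \<and>
                \<Phi> (Node a b) - (\<Phi> a + \<Phi> b) / 2 \<le> M r"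
            proof
              assume "J s \<le> M r"
              then show ?thesis using ab lu by (intro exI[of _ a] exI[of _ b]) auto
            next
              assume "K s \<le> M r"
              then show ?thesis using ab' lv by (intro exI[of _ a'] exI[of _ b']) auto
            qed
            then show ?thesis using False Suc by simp
          qed
        qed
      qed
    qed
  qed
qed

text \<open>Lengths are scaled by \<open>2^n\<close>. The directions \<open>c k\<close> with weights
  \<open>w k\<close> are atoms replacing \<nu> at resolution \<open>1 / 2^n\<close>, whence the term
  \<open>2 / 2^n\<close> in the Frostman condition. Directions close to zero give couplings that
  hardly move \<open>Z\<close>; by the choice of \<open>c\<^sub>0\<close> those of size at most
  \<open>c\<^sub>0\<close> carry at most a quarter of the weight.\<close>

locale discretized =
  fixes A B I :: "int set" and w c :: "int \<Rightarrow> real" and \<gamma> c\<^sub>0 \<theta> :: real and n :: nat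
  assumes A: "finite A" "A \<noteq> {}" and B: "B \<subseteq> {0..2^n}"
    and I: "finite I" "\<And>k. k \<in> I \<Longrightarrow> 0 \<le> w k" "sum w I = 1" "\<And>k. k \<in> I \<Longrightarrow> \<bar>c k\<bar> \<le> 1"
    and gam: "0 < \<gamma>" "\<gamma> \<le> 1"
    and frostman: "\<And>x r. 0 \<le> r \<Longrightarrow> (\<Sum>k\<in>{k\<in>I. \<bar>c k - x\<bar> \<le> r}. w k) \<le> 40 * (r + 2 / 2^n) powr \<gamma>"
    and c0: "0 < c\<^sub>0" "40 * (c\<^sub>0 + 2 / 2^n) powr \<gamma> \<le> 1 / 4"
    and lam: "0 < \<theta>"
begin

section \<open>Couplings of the uniform measure on \<open>A\<close> attached to a pair of
  subtrees\<close>

definition f :: "int \<Rightarrow> real" where "f z = (if z \<in> A then 1 / real (card A) else 0)"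
definition \<phi> :: "int \<Rightarrow> int \<Rightarrow> int" where "\<phi> k x = \<lfloor>c k * real_of_int x\<rfloor>"
definition Q :: "int \<Rightarrow> int set" where "Q k = (\<lambda>(z, x). z + \<phi> k x) ` (A \<times> B)"
definition mean_entropy :: "btree \<Rightarrow> real" where
  "mean_entropy t = (\<Sum>k\<in>I. w k * shannon (Q k) (conv_law A f (\<phi> k) t))"
definition gap :: "btree \<Rightarrow> btree \<Rightarrow> real" where
  "gap r s = mean_entropy (Node r s) - (mean_entropy r + mean_entropy s) / 2"
definition l1 :: "int \<Rightarrow> btree \<Rightarrow> btree \<Rightarrow> real" where
  "l1 k r s = (\<Sum>q\<in>Q k. \<bar>conv_law A f (\<phi> k) r q - conv_law A f (\<phi> k) s q\<bar>)"
definition J :: "int \<Rightarrow> btree \<Rightarrow> btree \<Rightarrow> int \<Rightarrow> int \<Rightarrow> real" where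
  "J k r s = subcoupling A (Q k) f (leaf_law (\<phi> k) r) (leaf_law (\<phi> k) s)"

lemma finite_B: "finite B" using B by (rule finite_subset) simp

lemma finite_Q: "finite (Q k)" unfolding Q_def using A finite_B by simp

lemma in_Q: "z \<in> A \<Longrightarrow> x \<in> B \<Longrightarrow> z + \<phi> k x \<in> Q k" unfolding Q_def by auto

lemma f_nonneg: "0 \<le> f z" unfolding f_def by simp

lemma f_sum: "sum f A = 1" unfolding f_def using A by simp

lemma conv_law_f_nonneg: "0 \<le> conv_law A f \<psi> t q"
  by (rule conv_law_nonneg[OF f_nonneg])

lemma conv_law_f_sum: "leaves t \<subseteq> B \<Longrightarrow> (\<Sum>q\<in>Q k. conv_law A f (\<phi> k) t q) = 1"
  using conv_law_sum[OF finite_Q, of t A \<open>\<phi> k\<close> k f] in_Q f_sum by auto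

lemma conv_law_Node': "conv_law A f \<psi> (Node r s) = (\<lambda>q. (conv_law A f \<psi> r q + conv_law A f \<psi> s q) / 2)"
  by (rule ext) (rule conv_law_Node)

lemma gap_eq: "gap r s = (\<Sum>k\<in>I. w k * (shannon (Q k) (\<lambda>q. (conv_law A f (\<phi> k) r q + conv_law A f (\<phi> k) s q) / 2)
    - (shannon (Q k) (conv_law A f (\<phi> k) r) + shannon (Q k) (conv_law A f (\<phi> k) s)) / 2))"
  unfolding gap_def mean_entropy_def conv_law_Node'
  by (simp only: right_diff_distrib sum_subtractf times_divide_eq_right distrib_left sum.distrib
      sum_divide_distrib[symmetric])

lemma gap_nonneg: "0 \<le> gap r s"
  unfolding gap_eq
proof (rule sum_nonneg)
  fix k assume "k \<in> I"
  have "(shannon (Q k) (conv_law A f (\<phi> k) r) + shannon (Q k) (conv_law A f (\<phi> k) s)) / 2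
     \<le> shannon (Q k) (\<lambda>q. (conv_law A f (\<phi> k) r q + conv_law A f (\<phi> k) s q) / 2)"
    by (rule shannon_midpoint) (rule conv_law_f_nonneg)+
  then show "0 \<le> w k * (shannon (Q k) (\<lambda>q. (conv_law A f (\<phi> k) r q + conv_law A f (\<phi> k) s q) / 2)
    - (shannon (Q k) (conv_law A f (\<phi> k) r) + shannon (Q k) (conv_law A f (\<phi> k) s)) / 2)"
    using I(2)[OF \<open>k \<in> I\<close>] by simp
qed

text \<open>The linearised Pinsker inequality with the same parameter \<theta> in every direction
  averages to \<open>2 / \<theta> * gap r s + 2 * \<theta>\<close>.\<close>

lemma mean_l1_le:
  assumes "leaves r \<subseteq> B" "leaves s \<subseteq> B" "gap r s \<le> \<theta>^2"
  shows "(\<Sum>k\<in>I. w k * l1 k r s) \<le> 4 * \<theta>"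
proof -
  let ?g = "\<lambda>k. shannon (Q k) (\<lambda>q. (conv_law A f (\<phi> k) r q + conv_law A f (\<phi> k) s q) / 2)
    - (shannon (Q k) (conv_law A f (\<phi> k) r) + shannon (Q k) (conv_law A f (\<phi> k) s)) / 2"
  have "(\<Sum>k\<in>I. w k * l1 k r s) \<le> (\<Sum>k\<in>I. w k * (2 / \<theta> * ?g k + 2 * \<theta>))"
    unfolding l1_def
  proof (intro sum_mono mult_left_mono l1_dist_le_shannon_gap conv_law_f_nonneg lam)
    fix k
    show "sum (conv_law A f (\<phi> k) r) (Q k) \<le> 1" "sum (conv_law A f (\<phi> k) s) (Q k) \<le> 1"
      using conv_law_f_sum assms by auto
  qed (use I in auto)
  also have "\<dots> = 2 / \<theta> * gap r s + 2 * \<theta>"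
  proof -
    have "(\<Sum>k\<in>I. w k * (2 / \<theta> * ?g k + 2 * \<theta>)) = (\<Sum>k\<in>I. 2 / \<theta> * (w k * ?g k) + 2 * \<theta> * w k)"
      by (intro sum.cong refl) (simp only: distrib_left mult_ac)
    then show ?thesis
      by (simp only: sum.distrib sum_distrib_left[symmetric] gap_eq I(3) mult_1_right)
  qed
  also have "2 / \<theta> * gap r s \<le> 2 / \<theta> * \<theta>^2" using assms(3) lam by (intro mult_left_mono) auto
  also have "\<dots> = 2 * \<theta>" using lam by (simp add: power2_eq_square)
  finally show ?thesis by simp
qed

lemma J_nonneg: "0 \<le> J k r s z z'"
  unfolding J_def by (intro subcoupling_nonneg f_nonneg leaf_law_nonneg)

lemma J_commute: "J k r s z z' = J k s r z' z"
  unfolding J_def by (rule subcoupling_commute)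

lemma J_left: "leaves r \<subseteq> B \<Longrightarrow> z \<in> A \<Longrightarrow> (\<Sum>z'\<in>A. J k r s z z') \<le> f z"
proof -
  assume "leaves r \<subseteq> B" "z \<in> A"
  then have "(\<Sum>q\<in>Q k. leaf_law (\<phi> k) r (q - z)) = 1"
    by (intro leaf_law_sum finite_Q in_Q) auto
  then show ?thesis unfolding J_def
    by (intro subcoupling_marginal f_nonneg leaf_law_nonneg) simp
qed

lemma J_right: "leaves s \<subseteq> B \<Longrightarrow> z \<in> A \<Longrightarrow> (\<Sum>z'\<in>A. J k r s z' z) \<le> f z"
  using J_left[of s z k r] by (simp add: J_commute[of k r s])

lemma J_mass: "leaves r \<subseteq> B \<Longrightarrow> leaves s \<subseteq> B \<Longrightarrow> (\<Sum>z\<in>A. \<Sum>z'\<in>A. J k r s z z') = 1 - l1 k r s / 2"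
  unfolding J_def l1_def conv_law_def
  by (intro subcoupling_mass f_nonneg leaf_law_nonneg A f_sum finite_Q leaf_law_sum) (auto intro: in_Q)

lemma J_support:
  assumes "J k r s z z' \<noteq> 0"
  obtains x y where "x \<in> leaves r" "y \<in> leaves s" "z' - z = \<phi> k x - \<phi> k y"
proof -
  obtain q where q: "leaf_law (\<phi> k) r (q - z) \<noteq> 0" "leaf_law (\<phi> k) s (q - z') \<noteq> 0"
    using subcoupling_support assms unfolding J_def by blast
  obtain x where x: "x \<in> leaves r" "q - z = \<phi> k x" using leaf_law_support[OF q(1)] by blast
  obtain y where y: "y \<in> leaves s" "q - z' = \<phi> k y" using leaf_law_support[OF q(2)] by blast
  show ?thesis by (rule that[OF x(1) y(1)]) (use x y in linarith)
qed

lemma \<phi>_diff: "\<bar>real_of_int (\<phi> k x - \<phi> k y) - c k * (real_of_int x - real_of_int y)\<bar> < 1"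
  unfolding \<phi>_def right_diff_distrib by linarith

text \<open>Small directions have weight at most a quarter, and so, by Markov's inequality and the
  mean bound \<open>4 * \<theta>\<close>, have those with a large L1 distance.\<close>

lemma exists_good_direction:
  assumes "leaves r \<subseteq> B" "leaves s \<subseteq> B" "gap r s \<le> \<theta>^2"
  obtains k where "k \<in> I" "c\<^sub>0 \<le> \<bar>c k\<bar>" "l1 k r s \<le> 16 * \<theta>"
proof -
  have l0: "0 \<le> l1 k r s" for k unfolding l1_def by (simp add: sum_nonneg)
  let ?S = "{k\<in>I. \<bar>c k - 0\<bar> \<le> c\<^sub>0}" and ?L = "{k\<in>I. 16 * \<theta> < l1 k r s}"
  have "sum w ?S \<le> 1 / 4" using frostman[of c\<^sub>0 0] c0 by simp
  moreover have "sum w ?L \<le> 1 / 4"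
  proof -
    have "16 * \<theta> * sum w ?L = (\<Sum>k\<in>?L. w k * (16 * \<theta>))" by (simp add: sum_distrib_left mult.commute)
    also have "\<dots> \<le> (\<Sum>k\<in>?L. w k * l1 k r s)" using I by (intro sum_mono mult_left_mono) auto
    also have "\<dots> \<le> (\<Sum>k\<in>I. w k * l1 k r s)" using I l0 by (intro sum_mono2) auto
    also have "\<dots> \<le> 4 * \<theta>" by (rule mean_l1_le[OF assms])
    finally show ?thesis using lam by simp
  qed
  moreover have "sum w (?S \<union> ?L) \<le> sum w ?S + sum w ?L"
    using sum.union_inter[of ?S ?L w] sum_nonneg[of "?S \<inter> ?L" w] I by simp
  ultimately have "sum w (?S \<union> ?L) < sum w I" using I(3) by linarith
  then have "?S \<union> ?L \<noteq> I" by auto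
  then obtain k where "k \<in> I" "k \<notin> ?S \<union> ?L" by blast
  then show ?thesis using that[of k] by auto
qed

text \<open>In a direction of size at least \<open>c\<^sub>0\<close> the coupling moves every point
  the same way by an amount comparable to \<open>2^i\<close>, so it can be iterated. Its defect is
  half the L1 distance, that is at most \<open>8 * \<theta>\<close>.\<close>

lemma entropy_full:
  assumes sub: "leaves r \<subseteq> B" "leaves s \<subseteq> B" and g: "gap r s \<le> \<theta>^2"
    and dist: "\<And>x y. x \<in> leaves r \<Longrightarrow> y \<in> leaves s \<Longrightarrow> 2^i \<le> 2 * (x - y) \<and> x - y \<le> 2 * 2^i"
    and i: "4 \<le> c\<^sub>0 * 2^i" and ib: "i \<le> b" and small: "2^(b - i) * (8 * \<theta>) \<le> 1"
  shows "(1 - 2^(b - i) * (8 * \<theta>)) * (real (b - i) * ln 2 - ln (4 / c\<^sub>0 + 1) - 6) \<le> scale_entropy A i b f"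
proof -
  obtain k where k: "k \<in> I" "c\<^sub>0 \<le> \<bar>c k\<bar>" "l1 k r s \<le> 16 * \<theta>" by (rule exists_good_direction[OF sub g])
  \<comment> \<open>Distances of at least \<open>2^i / 2\<close> would give
    \<open>c\<^sub>0 * 2^i / 2\<close>; half of it is given up to absorb the rounding error, which
    is less than \<open>1 \<le> c\<^sub>0 * 2^i / 4\<close>.\<close>
  define q where "q = \<lceil>c\<^sub>0 * 2^i / 4\<rceil>"
  have main: "z + q \<le> z' \<and> z' \<le> z + 4 * 2^i"
    if x: "x \<in> leaves r" and y: "y \<in> leaves s"
      and d: "z' - z = \<phi> k x - \<phi> k y \<and> 0 < c k \<or> z - z' = \<phi> k x - \<phi> k y \<and> c k < 0" for x y z z' :: int
  proof -
    define d where "d = real_of_int x - real_of_int y"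
    have "2^i \<le> 2 * (x - y)" "x - y \<le> 2 * 2^i" using dist[OF x y] by auto
    then have "real_of_int (2^i) \<le> real_of_int (2 * (x - y))" "real_of_int (x - y) \<le> real_of_int (2 * 2^i)"
      by (simp_all only: of_int_le_iff)
    then have d': "2^i \<le> 2 * d" "d \<le> 2 * 2^i" unfolding d_def by simp_all
    have one: "(1::real) \<le> 2^i" by simp
    then have dpos: "0 \<le> d" using d' by linarith
    have "c\<^sub>0 * 2^i \<le> c\<^sub>0 * (2 * d)" using d' c0 by (intro mult_left_mono) auto
    also have "\<dots> \<le> \<bar>c k\<bar> * (2 * d)" using k(2) dpos by (intro mult_right_mono) auto
    finally have lo: "c\<^sub>0 * 2^i \<le> 2 * (\<bar>c k\<bar> * d)" by simp
    have hi: "\<bar>c k\<bar> * d \<le> 2 * 2^i" using I(4)[OF k(1)] dpos d' by (meson mult_left_le_one_le abs_ge_zero order_trans)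
    have "\<bar>real_of_int (z' - z) - \<bar>c k\<bar> * d\<bar> < 1"
    proof (cases "0 < c k")
      case True
      then show ?thesis using \<phi>_diff[of k x y] that(3) unfolding d_def by auto
    next
      case False
      then have "z - z' = \<phi> k x - \<phi> k y" "c k < 0" using that(3) by auto
      then have "real_of_int (z' - z) = - real_of_int (\<phi> k x - \<phi> k y)" "\<bar>c k\<bar> * d = - (c k * d)" by linarith+
      then show ?thesis using \<phi>_diff[of k x y] unfolding d_def[symmetric] by linarith
    qed
    then have "c\<^sub>0 * 2^i / 4 \<le> real_of_int (z' - z)" "real_of_int (z' - z) \<le> 4 * 2^i"
      using lo hi i one by linarith+
    then have "q \<le> z' - z" "real_of_int (z' - z) \<le> real_of_int (4 * 2^i)" unfolding q_def by (simp_all add: ceiling_le_iff)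
    then show ?thesis by (simp only: of_int_le_iff) linarith
  qed
  have q: "1 \<le> q" using i unfolding q_def by linarith
  have "c\<^sub>0 * 2^i / 4 \<le> real_of_int q" unfolding q_def by linarith
  then have qC: "2^i \<le> 4 / c\<^sub>0 * real_of_int q" using c0 by (simp add: field_simps)
  have mass: "1 - 8 * \<theta> \<le> (\<Sum>z\<in>A. \<Sum>z'\<in>A. J k r s z z')" unfolding J_mass[OF sub] using k(3) by linarith
  have C: "0 \<le> 4 / c\<^sub>0" "0 \<le> 8 * \<theta>" using c0 lam by auto
  consider "0 < c k" | "c k < 0" using k(2) c0 by fastforce
  then show ?thesis
  proof cases
    case 1
    show ?thesis
    proof (rule scale_entropy_full[OF A(1) f_nonneg f_sum J_nonneg _ _ mass _ q qC ib C(1) C(2) small])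
      fix z z' assume "J k r s z z' \<noteq> 0"
      then show "z + q \<le> z' \<and> z' \<le> z + 4 * 2^i" using main 1 by (blast elim: J_support)
    qed (use J_left J_right sub in auto)
  next
    \<comment> \<open>For a negative direction the transposed coupling is the one that moves
      upwards.\<close>
    case 2
    have mass': "1 - 8 * \<theta> \<le> (\<Sum>z\<in>A. \<Sum>z'\<in>A. J k s r z z')"
      using mass unfolding J_commute[of k s r] by (subst sum.swap)
    show ?thesis
    proof (rule scale_entropy_full[OF A(1) f_nonneg f_sum J_nonneg _ _ mass' _ q qC ib C(1) C(2) small])
      fix z z' assume "J k s r z z' \<noteq> 0"
      then have "J k r s z' z \<noteq> 0" by (simp add: J_commute[of k r s])
      then show "z + q \<le> z' \<and> z' \<le> z + 4 * 2^i" using main 2 by (blast elim: J_support)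
    qed (use J_left J_right sub in auto)
  qed
qed

text \<open>Given \<open>z\<close>, the cell of \<open>z'\<close> and the cells of the two leaves,
  all of size \<open>2^e\<close>, the relation \<open>z' - z \<approx> c k * (x - y)\<close> pins
  \<open>c k\<close> down to an interval of length comparable to \<open>1 / 2^(i - e)\<close>, as
  \<open>x - y\<close> has size \<open>2^i\<close>. The Frostman condition bounds the weight of this
  interval. The unknown cells of the leaves cost a factor \<open>2^(2 * d)\<close>, hence the term
  \<open>2 * d * ln 2\<close>.\<close>

lemma entropy_between:
  assumes sub: "leaves r \<subseteq> B" "leaves s \<subseteq> B" and ne: "leaves r \<noteq> {}" "leaves s \<noteq> {}" and g: "gap r s \<le> \<theta>^2"
    and dist: "\<And>x y. x \<in> leaves r \<Longrightarrow> y \<in> leaves s \<Longrightarrow> 2^i \<le> 2 * (x - y) \<and> x - y \<le> 2 * 2^i"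
    and ei: "e < i" and th: "2 * \<theta> \<le> 1"
    and K: "finite K" "card K \<le> 2^d" "\<And>x. x \<in> leaves r \<Longrightarrow> x div 2^e \<in> K"
    and L: "finite L" "card L \<le> 2^d" "\<And>x. x \<in> leaves s \<Longrightarrow> x div 2^e \<in> L"
  shows "(1 - 2 * \<theta>) * \<gamma> * real (i - e) * ln 2 - 2 * real d * ln 2 - ln 640 - 9 \<le> scale_entropy A e i f"
proof -
  \<comment> \<open>Here \<open>640 = 40 * 16\<close>, where \<open>16 = 12 + 4\<close> comes from
    the radius \<open>R\<close> below and the discretisation error
    \<open>2 / 2^n \<le> 4 / 2^(i - e)\<close>.\<close>
  define p\<^sub>0 where "p\<^sub>0 = 2^(2 * d) * (640 * (2 powr (- real (i - e))) powr \<gamma>)"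
  define p where "p = min 1 p\<^sub>0"
  have p0: "0 < p\<^sub>0" unfolding p\<^sub>0_def by simp
  have p: "0 < p" "p \<le> 1" "p \<le> p\<^sub>0" unfolding p_def using p0 by auto
  have lnp0: "ln (1 / p\<^sub>0) = \<gamma> * real (i - e) * ln 2 - 2 * real d * ln 2 - ln 640"
    unfolding p\<^sub>0_def by (simp add: ln_div ln_mult ln_realpow ln_powr algebra_simps)
  have lnp: "ln (1 / p\<^sub>0) \<le> ln (1 / p)" "0 \<le> ln (1 / p)"
    using p p0 by (simp_all add: ln_div)
  have scale: "16 / 2^(i - e) = 16 * 2 powr (- real (i - e))"
    by (simp add: powr_minus powr_realpow divide_inverse)
  \<comment> \<open>Leaves lie in \<open>{0..2^n}\<close>, so no branching scale exceeds the unit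
    length by more than a factor two. This is what makes \<open>2 / 2^n\<close> comparable to
    \<open>R\<close>.\<close>
  have i_n: "i \<le> n + 1"
  proof -
    obtain x y where xy: "x \<in> leaves r" "y \<in> leaves s" using ne by blast
    have "0 \<le> y" "x \<le> 2^n" using xy sub B by auto
    then have "(2::int)^i \<le> 2 * 2^n" using dist[OF xy] by auto
    then have "(2::int)^i \<le> 2^(n + 1)" by simp
    then show ?thesis by (rule power_le_imp_le_exp[rotated]) simp
  qed
  have "(1 - 2 * \<theta>) * ln (1 / p) - 9 \<le> scale_entropy A e i f"
  proof (rule scale_entropy_average[where I=I and w=w and J="\<lambda>k. J k r s"])
    have "(\<Sum>k\<in>I. w k * (\<Sum>z\<in>A. \<Sum>z'\<in>A. J k r s z z')) = (\<Sum>k\<in>I. w k - w k * l1 k r s / 2)"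
      by (intro sum.cong refl) (simp add: J_mass[OF sub] right_diff_distrib)
    also have "\<dots> = 1 - (\<Sum>k\<in>I. w k * l1 k r s) / 2" using I by (simp add: sum_subtractf sum_divide_distrib)
    finally show "1 - 2 * \<theta> \<le> (\<Sum>k\<in>I. w k * (\<Sum>z\<in>A. \<Sum>z'\<in>A. J k r s z z'))"
      using mean_l1_le[OF sub g] by linarith
  next
    fix k z z' assume k: "k \<in> I" and "J k r s z z' \<noteq> 0"
    then obtain x y where xy: "x \<in> leaves r" "y \<in> leaves s" "z' - z = \<phi> k x - \<phi> k y" by (elim J_support)
    have "real_of_int (x - y) \<le> real_of_int (2 * 2^i)" "real_of_int 0 \<le> real_of_int (x - y)"
      using dist[OF xy(1,2)] by (simp_all only: of_int_le_iff) (smt (verit) zero_le_power)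
    then have d: "0 \<le> real_of_int x - real_of_int y" "real_of_int x - real_of_int y \<le> 2 * 2^i" by simp_all
    have "\<bar>c k * (real_of_int x - real_of_int y)\<bar> \<le> 2 * 2^i"
    proof -
      have "\<bar>c k\<bar> * (real_of_int x - real_of_int y) \<le> 1 * (real_of_int x - real_of_int y)"
        using d I(4)[OF k] by (intro mult_right_mono) auto
      then show ?thesis using d by (simp add: abs_mult)
    qed
    moreover have "(1::real) \<le> 2^i" by simp
    ultimately have "\<bar>real_of_int (z' - z)\<bar> \<le> 4 * 2^i" using \<phi>_diff[of k x y] unfolding xy(3) by linarith
    then have "real_of_int \<bar>z' - z\<bar> \<le> real_of_int (4 * 2^i)" by simp
    then show "\<bar>z' - z\<bar> \<le> 4 * 2^i" by (simp only: of_int_le_iff)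
  next
    fix z m assume z: "z \<in> A"
    let ?U = "{k\<in>I. \<exists>z'\<in>A. z' div 2^e = m \<and> J k r s z z' \<noteq> 0}"
    define x\<^sub>0 where "x\<^sub>0 uv = (real_of_int m * 2^e - real_of_int z) / (real_of_int (fst uv - snd uv) * 2^e)" for uv
    \<comment> \<open>Three errors of at most \<open>2^e\<close>, namely rounding, the leaves in
      their cells and \<open>z'\<close> in its cell, divided by the displacement
      \<open>D \<ge> 2^i / 4\<close>.\<close>
    define R :: real where "R = 12 / 2^(i - e)"
    let ?V = "\<lambda>uv. {k\<in>I. \<bar>c k - x\<^sub>0 uv\<bar> \<le> R}"
    have "?U \<subseteq> (\<Union>uv\<in>K \<times> L. ?V uv)"
    proof
      fix k assume "k \<in> ?U"
      then obtain z' where k: "k \<in> I" and z': "z' div 2^e = m" "J k r s z z' \<noteq> 0" by auto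
      obtain x y where xy: "x \<in> leaves r" "y \<in> leaves s" "z' - z = \<phi> k x - \<phi> k y" by (rule J_support[OF z'(2)])
      define u v where "u = x div 2^e" and "v = y div 2^e"
      have uv: "u \<in> K" "v \<in> L" using K(3) L(3) xy unfolding u_def v_def by auto
      define E :: int where "E = 2^e"
      have E: "1 \<le> E" unfolding E_def by simp
      have bx: "u * E \<le> x" "x < u * E + E" using cell_bounds[of x e u] unfolding u_def E_def by auto
      have by': "v * E \<le> y" "y < v * E + E" using cell_bounds[of y e v] unfolding v_def E_def by auto
      have bz: "m * E \<le> z'" "z' < m * E + E" using cell_bounds[of z' e m] z' unfolding E_def by auto
      have iE: "(2::int)^i = 2^(i - e - 1) * (2 * E)"
        unfolding E_def power_Suc[symmetric] power_add[symmetric] using ei by simp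
      have D: "2^i \<le> 4 * ((u - v) * E)"
      proof -
        define h :: int where "h = 2^(i - e - 1)"
        have "h * (2 * E) \<le> 2 * (x - y)" using dist[OF xy(1,2)] unfolding iE h_def by simp
        then have "h * E < (u - v) * E + E" using bx by' by (simp add: left_diff_distrib)
        then have "h * E < (u - v + 1) * E" by (simp add: algebra_simps)
        then have "h < u - v + 1" using E by simp
        then have "h \<le> u - v" by simp
        then have "h * E \<le> (u - v) * E" using E by (intro mult_right_mono) auto
        then have "h * (2 * E) \<le> 2 * ((u - v) * E)" by simp
        moreover have "0 \<le> h" unfolding h_def by simp
        then have "0 \<le> (u - v) * E" using \<open>h \<le> u - v\<close> E by (intro mult_nonneg_nonneg) auto
        moreover have "a \<le> 4 * b" if "a \<le> 2 * b" "0 \<le> b" for a b :: int using that by simp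
        ultimately show ?thesis unfolding iE h_def[symmetric] by blast
      qed
      define D where "D = real_of_int (u - v) * 2^e"
      have D': "2^i \<le> 4 * D"
      proof -
        have "real_of_int (2^i) \<le> real_of_int (4 * ((u - v) * E))" using \<open>2^i \<le> 4 * ((u - v) * E)\<close> by (simp only: of_int_le_iff)
        then show ?thesis unfolding D_def E_def by simp
      qed
      have Dpos: "0 < D" using D' zero_less_power[of "2::real" i] by linarith
      have dxy: "\<bar>(real_of_int x - real_of_int y) - D\<bar> \<le> 2^e"
      proof -
        have "\<bar>(x - y) - (u - v) * E\<bar> \<le> E" using bx by' by (simp add: left_diff_distrib abs_le_iff)
        then have "real_of_int \<bar>(x - y) - (u - v) * E\<bar> \<le> real_of_int E" by (simp only: of_int_le_iff)
        then show ?thesis unfolding D_def E_def by simp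
      qed
      have "\<bar>c k * (real_of_int x - real_of_int y) - c k * D\<bar> \<le> 2^e"
      proof -
        have "\<bar>c k * (real_of_int x - real_of_int y) - c k * D\<bar> = \<bar>c k\<bar> * \<bar>(real_of_int x - real_of_int y) - D\<bar>"
          by (simp add: abs_mult[symmetric] right_diff_distrib)
        also have "\<dots> \<le> 1 * 2^e" using I(4)[OF k] dxy by (intro mult_mono) auto
        finally show ?thesis by simp
      qed
      moreover have "\<bar>real_of_int (z' - z) - c k * (real_of_int x - real_of_int y)\<bar> < 1"
        unfolding xy(3) by (rule \<phi>_diff)
      moreover have "\<bar>real_of_int (z' - z) - (real_of_int m * 2^e - real_of_int z)\<bar> \<le> 2^e"
      proof -
        have "\<bar>(z' - z) - (m * E - z)\<bar> \<le> E" using bz by (simp add: abs_le_iff)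
        then have "real_of_int \<bar>(z' - z) - (m * E - z)\<bar> \<le> real_of_int E" by (simp only: of_int_le_iff)
        then show ?thesis unfolding E_def by simp
      qed
      moreover have "(1::real) \<le> 2^e" by simp
      ultimately have 3: "\<bar>c k * D - (real_of_int m * 2^e - real_of_int z)\<bar> \<le> 3 * 2^e" by linarith
      have "c k - x\<^sub>0 (u, v) = (c k * D - (real_of_int m * 2^e - real_of_int z)) / D"
        unfolding x\<^sub>0_def fst_conv snd_conv D_def[symmetric] using Dpos by (simp add: field_simps)
      then have "\<bar>c k - x\<^sub>0 (u, v)\<bar> = \<bar>c k * D - (real_of_int m * 2^e - real_of_int z)\<bar> / D"
        using Dpos by (simp add: abs_divide)
      also have "\<dots> \<le> 3 * 2^e / (2^i / 4)" using 3 D' Dpos by (intro frac_le) auto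
      also have "\<dots> = R" unfolding R_def using ei by (simp add: power_diff)
      finally show "k \<in> (\<Union>uv\<in>K \<times> L. ?V uv)" using k uv by blast
    qed
    then have "sum w ?U \<le> sum w (\<Union>uv\<in>K \<times> L. ?V uv)"
      using I K(1) L(1) by (intro sum_mono2) auto
    also have "\<dots> \<le> (\<Sum>uv\<in>K \<times> L. sum w (?V uv))"
      by (rule sum_UN_le_sum) (use I K(1) L(1) in auto)
    also have "\<dots> \<le> (\<Sum>uv\<in>K \<times> L. 640 * (2 powr (- real (i - e))) powr \<gamma>)"
    proof (rule sum_mono)
      fix uv
      have "R + 2 / 2^n \<le> 16 / 2^(i - e)"
      proof -
        have "(2::real)^(i - e) \<le> 2^(n + 1)" using i_n by (intro power_increasing) auto
        then have "2 / 2^n \<le> 4 / (2::real)^(i - e)" by (simp add: field_simps)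
        then show ?thesis unfolding R_def by (simp add: add_divide_distrib[symmetric])
      qed
      moreover have "0 \<le> R" unfolding R_def by simp
      ultimately have "sum w (?V uv) \<le> 40 * (16 / 2^(i - e)) powr \<gamma>"
        using frostman[of R "x\<^sub>0 uv"] powr_mono2[of \<gamma> "R + 2 / 2^n" "16 / 2^(i - e)"] gam by fastforce
      also have "\<dots> = 40 * (16 powr \<gamma> * (2 powr (- real (i - e))) powr \<gamma>)"
        unfolding scale by (simp add: powr_mult)
      also have "\<dots> \<le> 40 * (16 * (2 powr (- real (i - e))) powr \<gamma>)"
        using powr_mono[of \<gamma> 1 16] gam by (intro mult_left_mono mult_right_mono) auto
      finally show "sum w (?V uv) \<le> 640 * (2 powr (- real (i - e))) powr \<gamma>" by simp
    qed
    also have "\<dots> = real (card K * card L) * (640 * (2 powr (- real (i - e))) powr \<gamma>)"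
      by (simp add: card_cartesian_product)
    also have "\<dots> \<le> 2^(2 * d) * (640 * (2 powr (- real (i - e))) powr \<gamma>)"
    proof (rule mult_right_mono)
      have "card K * card L \<le> 2^d * 2^d" using K(2) L(2) by (rule mult_le_mono)
      also have "\<dots> = (2::nat)^(2 * d)" by (simp add: power_add[symmetric] mult_2)
      finally show "real (card K * card L) \<le> 2^(2 * d)" by (metis of_nat_le_iff of_nat_numeral of_nat_power)
    qed simp
    finally have "sum w ?U \<le> p\<^sub>0" unfolding p\<^sub>0_def .
    moreover have "sum w ?U \<le> sum w I" using I by (intro sum_mono2) auto
    ultimately show "sum w ?U \<le> p" unfolding p_def using I(3) by simp
  qed (use A I p ei J_left J_right sub f_nonneg f_sum J_nonneg in auto)
  moreover have "(1 - 2 * \<theta>) * \<gamma> * real (i - e) * ln 2 - 2 * real d * ln 2 - ln 640 \<le> (1 - 2 * \<theta>) * ln (1 / p)"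
  proof -
    have "(1 - 2 * \<theta>) * (2 * real d * ln 2 + ln 640) \<le> 1 * (2 * real d * ln 2 + ln 640)"
      using th lam by (intro mult_right_mono add_nonneg_nonneg) auto
    then have "(1 - 2 * \<theta>) * \<gamma> * real (i - e) * ln 2 - 2 * real d * ln 2 - ln 640 \<le> (1 - 2 * \<theta>) * ln (1 / p\<^sub>0)"
      unfolding lnp0 by (simp add: algebra_simps)
    also have "\<dots> \<le> (1 - 2 * \<theta>) * ln (1 / p)" using lnp th by (intro mult_left_mono) auto
    finally show ?thesis .
  qed
  ultimately show ?thesis by linarith
qed

end

text \<open>From one good level to the next, \<open>between\<close> climbs to the branching scale
  and \<open>full\<close> covers the \<open>p l\<close> scales above it; each constant is paid at
  most once per level. Nothing is known above the last good level, so the induction carries the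
  bound at that level \<open>l'\<close>, or at \<open>0\<close> if there is none.\<close>

lemma sum_over_good_levels:
  fixes F :: "nat \<Rightarrow> nat \<Rightarrow> real" and p :: "nat \<Rightarrow> nat"
  assumes F: "\<And>a b c. F a c = F a b + F b c" and C: "0 \<le> C\<^sub>1" "0 \<le> C\<^sub>2"
    and pT: "\<And>j. p j \<le> T" and gp: "\<And>j. g j \<Longrightarrow> p j \<noteq> 0"
    and full: "\<And>l. 1 \<le> l \<Longrightarrow> l \<le> m \<Longrightarrow> g l \<Longrightarrow> \<rho> * real (p l) - C\<^sub>1 \<le> F (T * l - p l) (T * l)"
    and between: "\<And>l l'. l' < l \<Longrightarrow> l \<le> m \<Longrightarrow> g l \<Longrightarrow>
      \<rho> * (\<gamma> * real (T * l - p l - T * l')) - \<mu> * real (card {j\<in>{l'<..<l}. p j \<noteq> 0}) - C\<^sub>2 \<le> F (T * l') (T * l - p l)"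
    and "l \<le> m"
  defines "S \<equiv> \<lambda>l. \<Sum>j\<in>{j\<in>{1..l}. g j}. real (p j)"
    and "N \<equiv> \<lambda>l. real (card {j\<in>{1..l}. p j \<noteq> 0 \<and> \<not> g j})"
  shows "\<exists>l'\<le>l. (\<forall>j. l' < j \<and> j \<le> l \<longrightarrow> \<not> g j) \<and>
    \<rho> * (S l' + \<gamma> * (real (T * l') - S l')) - (C\<^sub>1 + C\<^sub>2) * real l' - \<mu> * N l' \<le> F 0 (T * l')"
  using \<open>l \<le> m\<close>
proof (induction l)
  case 0
  have "F 0 0 = 0" using F[of 0 0 0] by simp
  moreover have "{1..0::nat} = {}" by simp
  then have "S 0 = 0" "N 0 = 0" unfolding S_def N_def by (simp_all only: empty_iff simp_thms Collect_empty_eq) simp_all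
  ultimately show ?case by simp
next
  case (Suc l)
  then obtain l' where l': "l' \<le> l" "\<forall>j. l' < j \<and> j \<le> l \<longrightarrow> \<not> g j"
    "\<rho> * (S l' + \<gamma> * (real (T * l') - S l')) - (C\<^sub>1 + C\<^sub>2) * real l' - \<mu> * N l' \<le> F 0 (T * l')" by auto
  show ?case
  proof (cases "g (Suc l)")
    case False
    then have "\<forall>j. l' < j \<and> j \<le> Suc l \<longrightarrow> \<not> g j" using l'(2) le_Suc_eq by auto
    then show ?thesis using l' by (intro exI[of _ l']) auto
  next
    case True
    let ?k = "p (Suc l)" and ?i = "T * Suc l - p (Suc l)"
    let ?D = "{j\<in>{l'<..<Suc l}. p j \<noteq> 0}"
    have S: "S (Suc l) = S l' + real ?k"
    proof -
      have "{j\<in>{1..Suc l}. g j} = insert (Suc l) {j\<in>{1..l'}. g j}"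
        using True l' by (auto simp: le_Suc_eq) (meson not_le)
      moreover have "Suc l \<notin> {j\<in>{1..l'}. g j}" using l'(1) by auto
      ultimately show ?thesis unfolding S_def by simp
    qed
    have N: "N (Suc l) = N l' + real (card ?D)"
    proof -
      have "{j\<in>{1..Suc l}. p j \<noteq> 0 \<and> \<not> g j} = {j\<in>{1..l'}. p j \<noteq> 0 \<and> \<not> g j} \<union> ?D"
        using True l' by (auto simp: le_Suc_eq)
      moreover have "{j\<in>{1..l'}. p j \<noteq> 0 \<and> \<not> g j} \<inter> ?D = {}" by auto
      ultimately show ?thesis unfolding N_def by (simp add: card_Un_disjoint)
    qed
    have f1: "\<rho> * real ?k - C\<^sub>1 \<le> F ?i (T * Suc l)" using full[of "Suc l"] True Suc.prems by simp
    have f2: "\<rho> * (\<gamma> * real (?i - T * l')) - \<mu> * real (card ?D) - C\<^sub>2 \<le> F (T * l') ?i"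
      using between[of l' "Suc l"] True Suc.prems l'(1) by simp
    have "T * l' + T \<le> T * Suc l" using l'(1) by simp
    then have len: "real (?i - T * l') = real (T * Suc l) - real ?k - real (T * l')"
    proof -
      have "real (b - k - a) = real b - real k - real a" if "k + a \<le> b" for a b k :: nat using that by linarith
      moreover have "?k + T * l' \<le> T * Suc l" using pT[of "Suc l"] \<open>T * l' + T \<le> T * Suc l\<close> by linarith
      ultimately show ?thesis by blast
    qed
    have "(C\<^sub>1 + C\<^sub>2) * (real l' + 1) \<le> (C\<^sub>1 + C\<^sub>2) * real (Suc l)"
      using l'(1) C by (intro mult_left_mono) auto
    moreover have "F 0 (T * Suc l) = F 0 (T * l') + F (T * l') ?i + F ?i (T * Suc l)"
      using F[of 0 "T * Suc l" "T * l'"] F[of "T * l'" "T * Suc l" ?i] by simp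
    moreover have "\<rho> * (S (Suc l) + \<gamma> * (real (T * Suc l) - S (Suc l)))
       = \<rho> * (S l' + \<gamma> * (real (T * l') - S l')) + \<rho> * real ?k + \<rho> * (\<gamma> * real (?i - T * l'))"
      unfolding S len by (simp add: algebra_simps)
    moreover have "(C\<^sub>1 + C\<^sub>2) * (real l' + 1) = (C\<^sub>1 + C\<^sub>2) * real l' + C\<^sub>1 + C\<^sub>2" by (simp add: algebra_simps)
    moreover have "\<mu> * N (Suc l) = \<mu> * N l' + \<mu> * real (card ?D)" unfolding N by (simp add: algebra_simps)
    ultimately have "\<rho> * (S (Suc l) + \<gamma> * (real (T * Suc l) - S (Suc l))) - (C\<^sub>1 + C\<^sub>2) * real (Suc l) - \<mu> * N (Suc l)
       \<le> F 0 (T * Suc l)" using l'(3) f1 f2 by linarith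
    then show ?thesis by (intro exI[of _ "Suc l"]) auto
  qed
qed

section \<open>The entropy of \<open>A\<close> along the pattern of a tree in
  \<open>B\<close>\<close>

context discretized
begin

lemma f_cong: "z \<in> A \<Longrightarrow> f z = 1 / real (card A)"
  by (simp add: f_def)

lemma mean_entropy_Leaf: "x \<in> B \<Longrightarrow> mean_entropy (Leaf x) = ln (real (card A))"
proof -
  assume x: "x \<in> B"
  have "conv_law A f \<psi> t = conv_law A (\<lambda>z. 1 / real (card A)) \<psi> t" for \<psi> t
    unfolding conv_law_def by (intro ext sum.cong refl) (simp add: f_cong)
  then have "shannon (Q k) (conv_law A f (\<phi> k) (Leaf x)) = ln (real (card A))" for k
    using shannon_conv_law_Leaf[OF A finite_Q, of \<open>\<phi> k\<close> x k] in_Q x by simp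
  then show ?thesis unfolding mean_entropy_def using I(3) by (simp add: sum_distrib_right[symmetric])
qed

lemma mean_entropy_le:
  assumes "leaves t \<subseteq> B" "\<And>k. k \<in> I \<Longrightarrow> ln (real (card (Q k))) \<le> h"
  shows "mean_entropy t \<le> h"
proof -
  obtain x where "x \<in> leaves t" using leaves_nonempty by blast
  then have ne: "Q k \<noteq> {}" for k using in_Q A assms(1) by blast
  have "mean_entropy t \<le> (\<Sum>k\<in>I. w k * h)"
    unfolding mean_entropy_def
  proof (intro sum_mono mult_left_mono)
    fix k assume k: "k \<in> I"
    have "shannon (Q k) (conv_law A f (\<phi> k) t) \<le> ln (real (card (Q k)))"
      by (rule shannon_le_ln_card[OF finite_Q ne conv_law_f_nonneg conv_law_f_sum[OF assms(1)]])
    then show "shannon (Q k) (conv_law A f (\<phi> k) t) \<le> h" using assms(2)[OF k] by linarith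
  qed (use I in auto)
  then show ?thesis using I(3) by (simp add: sum_distrib_right[symmetric])
qed

lemma scale_entropy_f_le: "scale_entropy A a b f \<le> ln (real (card A))"
proof -
  have "cell_mass A f d z = cell_mass A (\<lambda>z. 1 / real (card A)) d z" for d z
    unfolding cell_mass_def by (intro sum.cong refl) (simp add: f_cong)
  then have "scale_entropy A a b f = scale_entropy A a b (\<lambda>z. 1 / real (card A))"
    unfolding scale_entropy_def by (intro sum.cong refl) (simp add: f_cong)
  then show ?thesis using scale_entropy_uniform_le[OF A] by simp
qed

text \<open>The sums live on the sets \<open>Q k\<close>, so the gaps of all levels add up to at
  most \<open>E\<close>, and at most \<open>E / \<theta>^2\<close> levels lack a node with gap at
  most \<open>\<theta>^2\<close>. Levels are counted from the finest: level \<open>j\<close> has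
  cells of size \<open>2^(T * j)\<close> and entry \<open>P ! (m - j)\<close>.\<close>

lemma entropy_of_pattern:
  assumes fit: "fits T P t" and P: "length P = m" "set P \<subseteq> {..<T}" and sub: "leaves t \<subseteq> B"
    and E: "\<And>k. k \<in> I \<Longrightarrow> ln (real (card (Q k))) \<le> ln (real (card A)) + E" and E0: "0 \<le> E"
    and T: "4 \<le> c\<^sub>0 * 2^T" "1 \<le> T" and eta: "2^T * (8 * \<theta>) \<le> \<eta>" "\<eta> \<le> 1"
  shows "\<exists>G l'. G \<subseteq> {1..m} \<and> l' \<le> m \<and> (\<forall>j\<in>G. j \<le> l') \<and>
    real (card {j\<in>{1..m}. P ! (m - j) \<noteq> 0 \<and> j \<notin> G}) \<le> E / \<theta>^2 + 1 \<and>
    (1 - \<eta>) * ln 2 * ((\<Sum>j\<in>G. real (P ! (m - j))) + \<gamma> * (real (T * l') - (\<Sum>j\<in>G. real (P ! (m - j)))))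
      - (ln (4 / c\<^sub>0 + 1) + 6 + (ln 640 + 9)) * real m
      - 2 * ln 2 * real (card {j\<in>{1..m}. P ! (m - j) \<noteq> 0 \<and> j \<notin> G}) \<le> ln (real (card A))"
proof -
  obtain Jr where Jr: "(\<Sum>r<length P. Jr r) = mean_entropy t - ln (real (card A))"
    "\<forall>r<length P. (P ! r = 0 \<longrightarrow> Jr r = 0) \<and>
    (P ! r \<noteq> 0 \<longrightarrow> (\<exists>a b. fits T (drop r P) (Node a b) \<and> leaves (Node a b) \<subseteq> leaves t \<and>
       mean_entropy (Node a b) - (mean_entropy a + mean_entropy b) / 2 \<le> Jr r))"
    using tree_node_selection[OF fit, of mean_entropy "ln (real (card A))"] mean_entropy_Leaf sub by blast
  have node: "\<exists>a b. fits T (drop r P) (Node a b) \<and> leaves (Node a b) \<subseteq> B \<and> gap a b \<le> Jr r"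
    if "r < m" "P ! r \<noteq> 0" for r
    using Jr(2) that P(1) sub unfolding gap_def by blast
  have Jr0: "0 \<le> Jr r" if "r < m" for r
  proof (cases "P ! r = 0")
    case True then show ?thesis using Jr(2) that P(1) by simp
  next
    case False
    from node[OF that False] show ?thesis using gap_nonneg order_trans by blast
  qed
  define p where "p j = (if 1 \<le> j \<and> j \<le> m then P ! (m - j) else 0)" for j
  \<comment> \<open>For \<open>j \<ge> 2\<close> the branching scale \<open>T * j - p j\<close> is
    at least \<open>T\<close>, where displacements dominate rounding. Level \<open>1\<close> is
    given up, whence the \<open>+ 1\<close> in the count of bad levels.\<close>
  define g where "g j \<longleftrightarrow> 2 \<le> j \<and> j \<le> m \<and> p j \<noteq> 0 \<and> Jr (m - j) \<le> \<theta>^2" for j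
  define G where "G = {j. g j}"
  define C\<^sub>1 C\<^sub>2 where "C\<^sub>1 = ln (4 / c\<^sub>0 + 1) + 6" and "C\<^sub>2 = ln 640 + (9::real)"
  define \<rho> where "\<rho> = (1 - \<eta>) * ln 2"
  have C: "0 \<le> C\<^sub>1" "0 \<le> C\<^sub>2" unfolding C\<^sub>1_def C\<^sub>2_def using c0 by auto
  have pT: "p j < T" for j
  proof (cases "1 \<le> j \<and> j \<le> m")
    case True
    then have "P ! (m - j) \<in> set P" using P(1) by (intro nth_mem) auto
    then show ?thesis using P(2) True unfolding p_def by auto
  qed (use T in \<open>auto simp: p_def\<close>)
  have th: "2 * \<theta> \<le> \<eta>"
  proof -
    have "1 * (8 * \<theta>) \<le> 2^T * (8 * \<theta>)" using lam by (intro mult_right_mono) auto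
    then show ?thesis using eta lam by linarith
  qed
  have good: "\<exists>a b. fits T (drop (Suc (m - l)) P) a \<and> fits T (drop (Suc (m - l)) P) b \<and>
      leaves a \<subseteq> B \<and> leaves b \<subseteq> B \<and> gap a b \<le> \<theta>^2 \<and>
      (\<forall>x\<in>leaves a. \<forall>y\<in>leaves b. 2^(T * l - p l) \<le> 2 * (x - y) \<and> x - y \<le> 2 * 2^(T * l - p l))"
    if "g l" for l
  proof -
    have l: "2 \<le> l" "l \<le> m" "p l \<noteq> 0" "Jr (m - l) \<le> \<theta>^2" using that unfolding g_def by auto
    have pl: "p l = P ! (m - l)" using l unfolding p_def by simp
    obtain a b where ab: "fits T (drop (m - l) P) (Node a b)" "leaves (Node a b) \<subseteq> B" "gap a b \<le> Jr (m - l)"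
      using node[of "m - l"] l pl by auto
    have "drop (m - l) P = p l # drop (Suc (m - l)) P"
      using Cons_nth_drop_Suc[of "m - l" P] P(1) l pl by simp
    moreover have "Suc (length (drop (Suc (m - l)) P)) = l" using P(1) l by simp
    ultimately have "fits T (drop (Suc (m - l)) P) a \<and> fits T (drop (Suc (m - l)) P) b \<and>
       (\<forall>x\<in>leaves a. \<forall>y\<in>leaves b. 2^(T * l - p l) \<le> 2 * (x - y) \<and> x - y \<le> 2 * 2^(T * l - p l))"
      using ab(1) l(3) by (simp only: fits.simps if_False) auto
    then show ?thesis using ab l by (intro exI[of _ a] exI[of _ b]) auto
  qed
  have "\<exists>l'\<le>m. (\<forall>j. l' < j \<and> j \<le> m \<longrightarrow> \<not> g j) \<and>
    \<rho> * ((\<Sum>j\<in>{j\<in>{1..l'}. g j}. real (p j)) + \<gamma> * (real (T * l') - (\<Sum>j\<in>{j\<in>{1..l'}. g j}. real (p j))))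
      - (C\<^sub>1 + C\<^sub>2) * real l' - 2 * ln 2 * real (card {j\<in>{1..l'}. p j \<noteq> 0 \<and> \<not> g j}) \<le> scale_entropy A 0 (T * l') f"
  proof (rule sum_over_good_levels[where F="\<lambda>a b. scale_entropy A a b f" and m=m, OF _ C])
    show "scale_entropy A a b f = scale_entropy A a d f + scale_entropy A d b f" for a b d
      by (rule scale_entropy_trans[OF A(1) f_nonneg])
    show "p j \<le> T" for j using pT[of j] by simp
    show "g j \<Longrightarrow> p j \<noteq> 0" for j unfolding g_def by simp
  next
    fix l assume l: "1 \<le> l" "l \<le> m" "g l"
    let ?i = "T * l - p l"
    obtain a b where ab: "leaves a \<subseteq> B" "leaves b \<subseteq> B" "gap a b \<le> \<theta>^2"
      "\<forall>x\<in>leaves a. \<forall>y\<in>leaves b. 2^?i \<le> 2 * (x - y) \<and> x - y \<le> 2 * 2^?i"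
      using good[OF l(3)] by blast
    have "2 * T \<le> l * T" using l(3) unfolding g_def by (intro mult_right_mono) auto
    then have i: "T \<le> ?i" "?i \<le> T * l" "T * l - ?i = p l"
      using pT[of l] unfolding mult.commute[of l T] by linarith+
    have "4 \<le> c\<^sub>0 * 2^?i"
    proof -
      have "c\<^sub>0 * 2^T \<le> c\<^sub>0 * 2^?i" using i c0 by (intro mult_left_mono power_increasing) auto
      then show ?thesis using T by linarith
    qed
    define x where "x = 2^(p l) * (8 * \<theta>)"
    have x: "0 \<le> x" "x \<le> \<eta>"
    proof -
      show "0 \<le> x" unfolding x_def using lam by simp
      have "x \<le> 2^T * (8 * \<theta>)" unfolding x_def using pT[of l] lam by (intro mult_right_mono power_increasing) auto
      then show "x \<le> \<eta>" using eta by linarith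
    qed
    have "(1 - x) * (real (p l) * ln 2 - C\<^sub>1) \<le> scale_entropy A ?i (T * l) f"
    proof -
      have "2^(T * l - ?i) * (8 * \<theta>) \<le> 1" using x eta unfolding i(3) x_def by linarith
      from entropy_full[OF ab(1-3) _ \<open>4 \<le> c\<^sub>0 * 2^?i\<close> i(2) this] ab(4)
      show ?thesis unfolding i(3) x_def C\<^sub>1_def by (simp add: diff_diff_eq[symmetric])
    qed
    moreover have "(1 - \<eta>) * (real (p l) * ln 2) \<le> (1 - x) * (real (p l) * ln 2)"
      using x by (intro mult_right_mono) auto
    moreover have "(1 - x) * C\<^sub>1 \<le> 1 * C\<^sub>1" using x C by (intro mult_right_mono) auto
    ultimately show "\<rho> * real (p l) - C\<^sub>1 \<le> scale_entropy A ?i (T * l) f"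
      unfolding \<rho>_def by (simp add: algebra_simps)
  next
    fix l l' assume l: "l' < l" "l \<le> m" "g l"
    let ?i = "T * l - p l"
    define R where "R = drop (Suc (m - l)) P"
    obtain a b where ab: "fits T R a" "fits T R b" "leaves a \<subseteq> B" "leaves b \<subseteq> B" "gap a b \<le> \<theta>^2"
      "\<forall>x\<in>leaves a. \<forall>y\<in>leaves b. 2^?i \<le> 2 * (x - y) \<and> x - y \<le> 2 * 2^?i"
      using good[OF l(3)] unfolding R_def by blast
    have lenR: "length R = l - 1" using P(1) l(1,2) unfolding R_def by simp
    define q where "q = l - 1 - l'"
    have lenD: "length (drop q R) = l'" using l(1) lenR unfolding q_def by simp
    define d where "d = length (filter (\<lambda>k. k \<noteq> 0) (take q R))"
    have split: "take q R @ drop q R = R" by simp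
    obtain K where K: "finite K" "card K \<le> 2^d" "\<forall>x\<in>leaves a. x div 2^(T * l') \<in> K"
      using fits_cover[of T "take q R" "drop q R" a] ab(1) unfolding split lenD d_def by blast
    obtain L where L: "finite L" "card L \<le> 2^d" "\<forall>x\<in>leaves b. x div 2^(T * l') \<in> L"
      using fits_cover[of T "take q R" "drop q R" b] ab(2) unfolding split lenD d_def by blast
    have "T * l' + T \<le> T * l" using l(1) by (metis Suc_leI mult_Suc_right mult_le_mono2 add.commute)
    then have ei: "T * l' < ?i" using pT[of l] by linarith
    \<comment> \<open>Positions run from coarse to fine and levels the other way: position
      \<open>i\<close> of \<open>R\<close> is level \<open>l - 1 - i\<close>.\<close>
    have dle: "d \<le> card {j\<in>{l'<..<l}. p j \<noteq> 0}"
    proof -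
      have "d = card {i. i < q \<and> R ! i \<noteq> 0}"
        unfolding d_def length_filter_conv_card using lenR by (intro arg_cong[where f=card]) (auto simp: q_def)
      also have "\<dots> \<le> card {j\<in>{l'<..<l}. p j \<noteq> 0}"
      proof (rule card_inj_on_le[where f="\<lambda>i. l - 1 - i"])
        show "inj_on (\<lambda>i. l - 1 - i) {i. i < q \<and> R ! i \<noteq> 0}" unfolding inj_on_def q_def by auto
        show "(\<lambda>i. l - 1 - i) ` {i. i < q \<and> R ! i \<noteq> 0} \<subseteq> {j\<in>{l'<..<l}. p j \<noteq> 0}"
        proof safe
          fix i assume i: "i < q" "0 < R ! i"
          have "R ! i = P ! (Suc (m - l) + i)" unfolding R_def using P(1) i l unfolding q_def by (intro nth_drop) auto
          also have "Suc (m - l) + i = m - (l - 1 - i)" using i l unfolding q_def by auto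
          finally have "R ! i = p (l - 1 - i)" using i l unfolding p_def q_def by auto
          then show "0 < p (l - 1 - i)" using i by simp
        qed (auto simp: q_def)
      qed simp
      finally show ?thesis .
    qed
    have "(1 - 2 * \<theta>) * \<gamma> * real (?i - T * l') * ln 2 - 2 * real d * ln 2 - ln 640 - 9 \<le> scale_entropy A (T * l') ?i f"
    proof (rule entropy_between[OF ab(3,4) leaves_nonempty leaves_nonempty ab(5) _ ei _ K(1,2) _ L(1,2)])
      show "2 * \<theta> \<le> 1" using th eta by linarith
    qed (use ab(6) K(3) L(3) in auto)
    moreover have "(1 - \<eta>) * (\<gamma> * real (?i - T * l') * ln 2) \<le> (1 - 2 * \<theta>) * (\<gamma> * real (?i - T * l') * ln 2)"
      using th gam by (intro mult_right_mono) auto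
    moreover have "2 * ln 2 * real d \<le> 2 * ln 2 * real (card {j\<in>{l'<..<l}. p j \<noteq> 0})"
      using dle by (intro mult_left_mono) auto
    ultimately show "\<rho> * (\<gamma> * real (?i - T * l')) - 2 * ln 2 * real (card {j\<in>{l'<..<l}. p j \<noteq> 0}) - C\<^sub>2
      \<le> scale_entropy A (T * l') ?i f"
    proof -
      have "\<rho> * (\<gamma> * real (?i - T * l')) = (1 - \<eta>) * (\<gamma> * real (?i - T * l') * ln 2)"
        "(1 - 2 * \<theta>) * (\<gamma> * real (?i - T * l') * ln 2) = (1 - 2 * \<theta>) * \<gamma> * real (?i - T * l') * ln 2"
        "2 * real d * ln 2 = 2 * ln 2 * real d"
        by (simp_all only: \<rho>_def mult_ac)
      then show ?thesis
        using \<open>(1 - 2 * \<theta>) * \<gamma> * real (?i - T * l') * ln 2 - 2 * real d * ln 2 - ln 640 - 9 \<le> scale_entropy A (T * l') ?i f\<close>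
          \<open>(1 - \<eta>) * (\<gamma> * real (?i - T * l') * ln 2) \<le> (1 - 2 * \<theta>) * (\<gamma> * real (?i - T * l') * ln 2)\<close>
          \<open>2 * ln 2 * real d \<le> 2 * ln 2 * real (card {j\<in>{l'<..<l}. p j \<noteq> 0})\<close>
        unfolding C\<^sub>2_def by linarith
    qed
  qed simp
  then obtain l' where l': "l' \<le> m" "\<And>j. l' < j \<Longrightarrow> j \<le> m \<Longrightarrow> \<not> g j"
    "\<rho> * ((\<Sum>j\<in>{j\<in>{1..l'}. g j}. real (p j)) + \<gamma> * (real (T * l') - (\<Sum>j\<in>{j\<in>{1..l'}. g j}. real (p j))))
      - (C\<^sub>1 + C\<^sub>2) * real l' - 2 * ln 2 * real (card {j\<in>{1..l'}. p j \<noteq> 0 \<and> \<not> g j}) \<le> scale_entropy A 0 (T * l') f"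
    by blast
  have Geq: "{j\<in>{1..l'}. g j} = G"
  proof -
    have "1 \<le> j \<and> j \<le> l'" if "g j" for j
    proof -
      have "2 \<le> j" "j \<le> m" using that unfolding g_def by auto
      then show ?thesis using l'(2)[of j] that by force
    qed
    then show ?thesis unfolding G_def by auto
  qed
  have Gsub: "G \<subseteq> {1..m}" unfolding G_def g_def by auto
  have Gl: "\<forall>j\<in>G. j \<le> l'" using Geq by auto
  have Sum: "(\<Sum>j\<in>G. real (p j)) = (\<Sum>j\<in>G. real (P ! (m - j)))"
    using Gsub by (intro sum.cong refl) (auto simp: p_def)
  define bad where "bad = {j\<in>{1..m}. P ! (m - j) \<noteq> 0 \<and> j \<notin> G}"
  have bad1: "card {j\<in>{1..l'}. p j \<noteq> 0 \<and> \<not> g j} \<le> card bad"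
    unfolding bad_def using l'(1) by (intro card_mono) (auto simp: p_def G_def)
  have bad2: "real (card bad) \<le> E / \<theta>^2 + 1"
  proof -
    let ?H = "{r. r < m \<and> \<theta>^2 < Jr r}"
    have "bad \<subseteq> insert 1 ((\<lambda>r. m - r) ` ?H)"
    proof
      fix j assume j: "j \<in> bad"
      then have "1 \<le> j" "j \<le> m" "p j \<noteq> 0" "\<not> g j" unfolding bad_def G_def p_def by auto
      then have "j = 1 \<or> \<theta>^2 < Jr (m - j)" unfolding g_def by auto
      then show "j \<in> insert 1 ((\<lambda>r. m - r) ` ?H)"
        using \<open>1 \<le> j\<close> \<open>j \<le> m\<close> by (auto simp: image_iff intro!: exI[of _ "m - j"])
    qed
    then have "card bad \<le> card (insert 1 ((\<lambda>r. m - r) ` ?H))" by (intro card_mono) auto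
    also have "\<dots> \<le> Suc (card ((\<lambda>r. m - r) ` ?H))" by (rule card_insert_le_m1) auto
    also have "\<dots> \<le> Suc (card ?H)" using card_image_le[of ?H "\<lambda>r. m - r"] by simp
    finally have 1: "real (card bad) \<le> real (card ?H) + 1" by linarith
    have "real (card ?H) * \<theta>^2 = (\<Sum>r\<in>?H. \<theta>^2)" by simp
    also have "\<dots> \<le> (\<Sum>r\<in>?H. Jr r)" by (rule sum_mono) auto
    also have "\<dots> \<le> (\<Sum>r<m. Jr r)" using Jr0 by (intro sum_mono2) auto
    also have "\<dots> \<le> E" using Jr(1) mean_entropy_le[OF sub, of "ln (real (card A)) + E"] E P(1) by simp
    finally have "real (card ?H) \<le> E / \<theta>^2" using lam by (simp add: pos_le_divide_eq)
    then show ?thesis using 1 by linarith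
  qed
  have "(C\<^sub>1 + C\<^sub>2) * real l' \<le> (C\<^sub>1 + C\<^sub>2) * real m" using l'(1) C by (intro mult_left_mono) auto
  moreover have "2 * ln 2 * real (card {j\<in>{1..l'}. p j \<noteq> 0 \<and> \<not> g j}) \<le> 2 * ln 2 * real (card bad)"
    using bad1 by (intro mult_left_mono) auto
  ultimately have "(1 - \<eta>) * ln 2 * ((\<Sum>j\<in>G. real (P ! (m - j))) + \<gamma> * (real (T * l') - (\<Sum>j\<in>G. real (P ! (m - j)))))
      - (C\<^sub>1 + C\<^sub>2) * real m - 2 * ln 2 * real (card bad) \<le> ln (real (card A))"
    using l'(3) scale_entropy_f_le[of 0 "T * l'"] unfolding Geq Sum \<rho>_def by linarith
  then show ?thesis using Gsub l'(1) Gl bad2 unfolding bad_def C\<^sub>1_def C\<^sub>2_def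
    by (intro exI[of _ G] exI[of _ l']) simp
qed

end

section \<open>The count that contradicts a small sumset\<close>

lemma prod_two_powr: "real (\<Prod>i<j. 2^(P ! i + 1)) = 2 powr ((\<Sum>i<j. real (P ! i)) + real j)"
proof (induction j)
  case (Suc j)
  have "real (\<Prod>i<Suc j. 2^(P ! i + 1)) = real (\<Prod>i<j. 2^(P ! i + 1)) * 2 powr real (P ! j + 1)"
    by (simp add: powr_realpow powr_add)
  then show ?case unfolding Suc by (simp add: powr_add[symmetric] algebra_simps)
qed simp

context discretized
begin

text \<open>The popular class is so large that the pattern entries sum to about
  \<open>\<beta> * n\<close>; bad levels hide little of this sum, and good levels reach up nearly to
  scale \<open>n\<close>. In the entropy bound all losses together stay below
  \<open>4 * \<eta> * n\<close> plus constants, while the excess over \<open>\<alpha> * n\<close> is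
  at least \<open>8 * \<eta> * n\<close>.\<close>

lemma entropy_contradiction:
  fixes \<alpha> \<beta> \<kappa> \<epsilon> \<eta> \<sigma> K :: real and T m l :: nat
  assumes K_def: "K = (ln (4 / c\<^sub>0 + 1) + 6 + (ln 640 + 9)) / ln 2"
    and T: "4 \<le> c\<^sub>0 * 2^T" "1 \<le> T" and eta: "2^T * (8 * \<theta>) \<le> \<eta>" "\<eta> \<le> 1" "0 < \<eta>"
    and m: "n + 1 \<le> T * m" "T * m \<le> n + T"
    and Bne: "B \<noteq> {}" and cardB: "2 powr (\<beta> * real n) \<le> real (card B)"
    and cardA: "real (card A) \<le> 2 powr (\<alpha> * real n)"
    and cardQ: "\<And>k. k \<in> I \<Longrightarrow> real (card (Q k)) \<le> 2 powr (\<epsilon> * real n) * real (card A)"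
    and nonconc: "\<And>e k. e \<le> n \<Longrightarrow> \<eta> * real n - real T \<le> real n - real e \<Longrightarrow>
      real (card {x\<in>B. x div 2^e = k}) \<le> 2 powr (- \<kappa> * (real n - real e)) * real (card B)"
    and kap: "0 < \<kappa>" and eps: "0 \<le> \<epsilon>" "\<epsilon> * (real T + 2) \<le> \<sigma> * \<theta>^2"
    and beta: "0 \<le> \<beta>" "\<beta> \<le> 1"
    and l: "\<eta> * real m \<le> real l" "real l \<le> \<eta> * real m + 1" "l \<le> m" "1 \<le> l"
    and sig: "log 2 (real T) + 1 + K \<le> \<sigma> * real T" "\<sigma> \<le> \<eta>" "4 * \<sigma> \<le> \<eta> * \<kappa>" "0 \<le> \<sigma>"
    and gain: "8 * \<eta> \<le> \<beta> + \<gamma> * (1 - \<beta>) - \<alpha>"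
    and large: "\<sigma> * real T + 3 * real T + 2 < 4 * \<eta> * real n"
      "2 * (\<kappa> * real T) + 2 * (\<sigma> * real T) + 6 + 2 * real T < \<eta> * \<kappa> * real n"
  shows False
proof -
  define Lg where "Lg = log 2 (real T)"
  have Lg: "0 \<le> Lg" unfolding Lg_def using T by simp
  have K: "0 \<le> K" unfolding K_def using c0 by (intro divide_nonneg_nonneg add_nonneg_nonneg) auto
  have ln2: "0 < ln (2::real)" "ln (2::real) \<le> 1" using ln_le_minus_one[of "2::real"] by auto
  have mn: "real n \<le> real T * real m" "real T * real m \<le> real n + real T"
    using m by (simp_all flip: of_nat_mult of_nat_add)
  have Tm: "1 \<le> real T" using T by simp
  have "\<forall>x\<in>B. x div 2^(T * m) = 0"
  proof
    fix x assume "x \<in> B"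
    then have "0 \<le> x" "x \<le> 2^n" using B by auto
    moreover have "(2::int)^n < 2^(T * m)" using m by (intro power_strict_increasing) auto
    ultimately show "x div 2^(T * m) = 0" by (intro div_pos_pos_trivial) linarith+
  qed
  then obtain P B' t where P: "length P = m" "set P \<subseteq> {..<T}" "B' \<subseteq> B" "card B \<le> T^m * card B'"
    "fits T P t" "leaves t \<subseteq> B'"
    and cells: "\<And>j. j \<le> m \<Longrightarrow> card ((\<lambda>b. b div 2^(T * (m - j))) ` B') \<le> (\<Prod>i<j. 2^(P ! i + 1))"
    using popular_pattern[OF T(2) finite_B Bne] by metis
  have A0: "0 < real (card A)" using A by (simp add: card_gt_0_iff)
  have Q0: "ln (real (card (Q k))) \<le> ln (real (card A)) + \<epsilon> * real n * ln 2" if "k \<in> I" for k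
  proof -
    obtain z x where "z \<in> A" "x \<in> B" using A Bne by blast
    then have "0 < real (card (Q k))" using in_Q[of z x k] finite_Q by (auto simp: card_gt_0_iff)
    then have "ln (real (card (Q k))) \<le> ln (2 powr (\<epsilon> * real n) * real (card A))"
      using cardQ[OF that] by simp
    also have "\<dots> = ln (real (card A)) + \<epsilon> * real n * ln 2" using A0 by (simp add: ln_mult ln_powr)
    finally show ?thesis .
  qed
  have subB: "leaves t \<subseteq> B" using P by blast
  obtain G l' where G: "G \<subseteq> {1..m}" "l' \<le> m" "\<forall>j\<in>G. j \<le> l'"
    and nb0: "real (card {j\<in>{1..m}. P ! (m - j) \<noteq> 0 \<and> j \<notin> G}) \<le> \<epsilon> * real n * ln 2 / \<theta>^2 + 1"
    and main0: "(1 - \<eta>) * ln 2 * ((\<Sum>j\<in>G. real (P ! (m - j))) + \<gamma> * (real (T * l') - (\<Sum>j\<in>G. real (P ! (m - j)))))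
      - (ln (4 / c\<^sub>0 + 1) + 6 + (ln 640 + 9)) * real m
      - 2 * ln 2 * real (card {j\<in>{1..m}. P ! (m - j) \<noteq> 0 \<and> j \<notin> G}) \<le> ln (real (card A))"
    using entropy_of_pattern[OF P(5,1,2) subB Q0 _ T eta(1,2)] eps by (smt (verit) mult_nonneg_nonneg of_nat_0_le_iff ln2)
  define bad where "bad = {j\<in>{1..m}. P ! (m - j) \<noteq> 0 \<and> j \<notin> G}"
  define b where "b = real (card bad)"
  define S where "S = (\<Sum>j\<in>G. real (P ! (m - j)))"
  have PT: "P ! (m - j) \<le> T" if "j \<in> {1..m}" for j
  proof -
    have "P ! (m - j) \<in> set P" using that P(1) by (intro nth_mem) auto
    then show ?thesis using P(2) by auto
  qed
  have finbad: "finite bad" unfolding bad_def by simp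
  have finG: "finite G" using G(1) by (rule finite_subset) simp
  \<comment> \<open>A bad level hides up to \<open>T\<close> scales of branching and costs another
    \<open>2\<close> in the entropy bound, so the product \<open>b * (T + 2)\<close> has to be
    small; this dictates the size of \<epsilon>.\<close>
  have b: "b * (real T + 2) \<le> \<sigma> * real n + real T + 2"
  proof -
    have "\<epsilon> * real n * ln 2 / \<theta>^2 \<le> \<epsilon> * real n / \<theta>^2"
      using eps ln2 by (intro divide_right_mono mult_left_le) auto
    then have "b \<le> \<epsilon> * real n / \<theta>^2 + 1" using nb0 unfolding b_def bad_def by linarith
    then have "b * (real T + 2) \<le> (\<epsilon> * real n / \<theta>^2 + 1) * (real T + 2)" by (intro mult_right_mono) auto
    also have "\<dots> = (\<epsilon> * (real T + 2)) * real n / \<theta>^2 + (real T + 2)" by (simp add: algebra_simps add_divide_distrib)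
    also have "(\<epsilon> * (real T + 2)) * real n / \<theta>^2 \<le> (\<sigma> * \<theta>^2) * real n / \<theta>^2"
      using eps by (intro divide_right_mono mult_right_mono) auto
    also have "\<dots> = \<sigma> * real n" using lam by simp
    finally show ?thesis by simp
  qed
  have b0: "0 \<le> b" unfolding b_def by simp
  have badsum: "(\<Sum>j\<in>bad. real (P ! (m - j))) \<le> real T * b"
  proof -
    have "(\<Sum>j\<in>bad. real (P ! (m - j))) \<le> (\<Sum>j\<in>bad. real T)"
      using PT unfolding bad_def by (intro sum_mono) auto
    then show ?thesis unfolding b_def by (simp add: mult.commute)
  qed
  have reindex: "(\<Sum>i<j. real (P ! i)) = (\<Sum>i\<in>{m - j<..m}. real (P ! (m - i)))" if "j \<le> m" for j
    by (rule sum.reindex_bij_witness[of _ "\<lambda>i. m - i" "\<lambda>i. m - i"]) (use that in auto)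
  have mLg: "real m * (Lg + 1 + K) \<le> \<sigma> * real n + \<sigma> * real T"
  proof -
    have "real m * (Lg + 1 + K) \<le> real m * (\<sigma> * real T)" using sig(1) unfolding Lg_def by (intro mult_left_mono) auto
    also have "\<dots> = \<sigma> * (real T * real m)" by simp
    also have "\<dots> \<le> \<sigma> * (real n + real T)" using mn sig by (intro mult_left_mono) auto
    finally show ?thesis by (simp add: algebra_simps)
  qed
  have mK: "0 \<le> real m * K" using K by simp
  have Tpow: "real (T^m) = 2 powr (real m * Lg)"
    using T unfolding Lg_def by (simp add: powr_realpow powr_powr[symmetric] mult.commute[of "real m"])
  have B'0: "0 < real (card B')"
  proof -
    have "B' \<noteq> {}" using P(6) leaves_nonempty by blast
    then show ?thesis using finite_subset[OF P(3) finite_B] by (simp add: card_gt_0_iff)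
  qed
  have BB': "real (card B) \<le> 2 powr (real m * Lg) * real (card B')"
    unfolding Tpow[symmetric] using P(4) by (metis of_nat_le_iff of_nat_mult)
  have total: "\<beta> * real n - real m * Lg - real m \<le> S + real T * b"
  proof -
    have "(\<lambda>b. b div 2^(T * (m - m))) ` B' = B'" by simp
    then have "real (card B') \<le> 2 powr ((\<Sum>i<m. real (P ! i)) + real m)"
      using cells[of m] unfolding prod_two_powr[symmetric] by (simp only: of_nat_le_iff order_refl)
    then have "2 powr (\<beta> * real n) \<le> 2 powr (real m * Lg) * 2 powr ((\<Sum>i<m. real (P ! i)) + real m)"
      using cardB BB' by (meson mult_left_mono order_trans powr_ge_zero)
    then have "\<beta> * real n \<le> real m * Lg + ((\<Sum>i<m. real (P ! i)) + real m)"
      by (simp add: powr_add[symmetric])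
    moreover have "(\<Sum>i<m. real (P ! i)) \<le> S + real T * b"
    proof -
      have "(\<Sum>i<m. real (P ! i)) = (\<Sum>i\<in>{1..m}. real (P ! (m - i)))"
        using reindex[of m] by (simp add: atLeastSucAtMost_greaterThanAtMost[symmetric])
      also have "\<dots> = (\<Sum>i\<in>G \<union> bad. real (P ! (m - i)))"
        using G(1) by (intro sum.mono_neutral_right) (auto simp: bad_def)
      also have "\<dots> = S + (\<Sum>i\<in>bad. real (P ! (m - i)))"
        unfolding S_def using finG finbad by (intro sum.union_disjoint) (auto simp: bad_def)
      finally show ?thesis using badsum by linarith
    qed
    ultimately show ?thesis by linarith
  qed
  \<comment> \<open>Otherwise the top \<open>l\<close> levels branch only at bad levels, so
    \<open>B'\<close> meets at most \<open>2 powr (T * b + l)\<close> cells of size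
    \<open>2^e\<close>. By nonconcentration these are too light to contain
    \<open>B'\<close>.\<close>
  have top: "m - l \<le> l'"
  proof (rule ccontr)
    assume "\<not> m - l \<le> l'"
    then have noG: "j \<notin> G" if "m - l < j" for j using G(3) that by auto
    define e where "e = T * (m - l)"
    have re: "real e = real T * real m - real T * real l" unfolding e_def using l by (simp add: of_nat_diff right_diff_distrib)
    have Tl: "\<eta> * real n \<le> real T * real l"
    proof -
      have "\<eta> * real n \<le> \<eta> * (real T * real m)" using mn eta by (intro mult_left_mono) auto
      also have "\<dots> = real T * (\<eta> * real m)" by simp
      also have "\<dots> \<le> real T * real l" using l by (intro mult_left_mono) auto
      finally show ?thesis .
    qed
    have "real T * 1 \<le> real T * real l" using l by (intro mult_left_mono) auto
    then have en: "e \<le> n" using re mn by linarith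
    have en2: "\<eta> * real n - real T \<le> real n - real e" using re mn Tl by linarith
    have "(\<Sum>i<l. real (P ! i)) \<le> real T * b"
    proof -
      have "(\<Sum>i<l. real (P ! i)) = (\<Sum>i\<in>{m - l<..m}. real (P ! (m - i)))" by (rule reindex[OF l(3)])
      also have "\<dots> = (\<Sum>i\<in>{i\<in>{m - l<..m}. P ! (m - i) \<noteq> 0}. real (P ! (m - i)))"
        by (intro sum.mono_neutral_right) auto
      also have "\<dots> \<le> (\<Sum>i\<in>bad. real (P ! (m - i)))"
        using finbad noG by (intro sum_mono2) (auto simp: bad_def)
      finally show ?thesis using badsum by linarith
    qed
    let ?C = "(\<lambda>b. b div 2^e) ` B'"
    have finB': "finite B'" using finite_subset[OF P(3) finite_B] .
    have "real (card B') \<le> (\<Sum>k\<in>?C. real (card {x\<in>B'. x div 2^e = k}))"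
      using sum.image_gen[OF finB', of "\<lambda>_. 1::real" "\<lambda>b. b div 2^e"] by simp
    also have "\<dots> \<le> (\<Sum>k\<in>?C. 2 powr (- \<kappa> * (real n - real e)) * real (card B))"
    proof (rule sum_mono)
      fix k
      have "card {x\<in>B'. x div 2^e = k} \<le> card {x\<in>B. x div 2^e = k}"
        using P(3) finite_B by (intro card_mono) auto
      then show "real (card {x\<in>B'. x div 2^e = k}) \<le> 2 powr (- \<kappa> * (real n - real e)) * real (card B)"
        using nonconc[OF en en2, of k] by linarith
    qed
    also have "\<dots> = real (card ?C) * (2 powr (- \<kappa> * (real n - real e)) * real (card B))" by simp
    also have "\<dots> \<le> 2 powr (real T * b + real l) * (2 powr (- \<kappa> * (real n - real e)) * real (card B))"
    proof (rule mult_right_mono)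
      have "real (card ?C) \<le> 2 powr ((\<Sum>i<l. real (P ! i)) + real l)"
        using cells[OF l(3)] unfolding prod_two_powr[symmetric] e_def by (simp only: of_nat_le_iff)
      also have "\<dots> \<le> 2 powr (real T * b + real l)"
        using \<open>(\<Sum>i<l. real (P ! i)) \<le> real T * b\<close> by simp
      finally show "real (card ?C) \<le> 2 powr (real T * b + real l)" .
    qed simp
    also have "\<dots> = 2 powr (real T * b + real l - \<kappa> * (real n - real e)) * real (card B)"
      by (simp add: powr_add[symmetric] mult.assoc[symmetric])
    also have "\<dots> \<le> 2 powr (real T * b + real l - \<kappa> * (real n - real e)) * (2 powr (real m * Lg) * real (card B'))"
      using BB' by (intro mult_left_mono) auto
    finally have "1 * real (card B') \<le> 2 powr (real T * b + real l - \<kappa> * (real n - real e) + real m * Lg) * real (card B')"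
      by (simp add: powr_add[symmetric] mult.assoc[symmetric])
    then have "1 \<le> 2 powr (real T * b + real l - \<kappa> * (real n - real e) + real m * Lg)"
      using B'0 by (simp only: mult_le_cancel_right_pos)
    then have "2 powr 0 \<le> 2 powr (real T * b + real l - \<kappa> * (real n - real e) + real m * Lg)" by simp
    then have 1: "\<kappa> * (real n - real e) \<le> real T * b + real l + real m * Lg" by (simp only: powr_le_cancel_iff)
    have "\<kappa> * (\<eta> * real n - real T) \<le> \<kappa> * (real n - real e)" using en2 kap by (intro mult_left_mono) auto
    then have 2: "\<eta> * \<kappa> * real n - \<kappa> * real T \<le> \<kappa> * (real n - real e)" by (simp add: algebra_simps)
    have 3: "real l \<le> real m + 1"
    proof -
      have "\<eta> * real m \<le> 1 * real m" using eta by (intro mult_right_mono) auto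
      then show ?thesis using l(2) by linarith
    qed
    have 4: "real m * Lg + real m \<le> \<sigma> * real n + \<sigma> * real T" using mLg mK by (simp add: algebra_simps)
    have 5: "real T * b \<le> \<sigma> * real n + real T + 2"
      using b b0 by (simp add: algebra_simps)
    have 6: "4 * (\<sigma> * real n) \<le> \<eta> * \<kappa> * real n" using mult_right_mono[OF sig(3), of "real n"] by simp
    show False using 1 2 3 4 5 6 large(2) by linarith
  qed
  define X where "X = S + \<gamma> * (real (T * l') - S)"
  have main: "(1 - \<eta>) * X - K * real m - 2 * b \<le> \<alpha> * real n"
  proof -
    have "ln (real (card A)) \<le> ln (2 powr (\<alpha> * real n))" using cardA A0 by (subst ln_le_cancel_iff) auto
    also have "\<dots> = \<alpha> * real n * ln 2" by (simp add: ln_powr)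
    finally have "ln (real (card A)) \<le> \<alpha> * real n * ln 2" .
    moreover have "(ln (4 / c\<^sub>0 + 1) + 6 + (ln 640 + 9)) = K * ln 2" unfolding K_def using ln2 by simp
    ultimately have "((1 - \<eta>) * X - K * real m - 2 * b) * ln 2 \<le> (\<alpha> * real n) * ln 2"
      using main0 unfolding X_def S_def b_def bad_def by (simp add: algebra_simps)
    then show ?thesis using ln2 by simp
  qed
  \<comment> \<open>As \<open>\<gamma> \<le> 1\<close>, \<open>X\<close> is increasing in
    \<open>S\<close> as well as in \<open>l'\<close>, so the lower bounds \<open>total\<close> and
    \<open>top\<close> may be inserted.\<close>
  define X\<^sub>0 where "X\<^sub>0 = (\<beta> + \<gamma> * (1 - \<beta>)) * real n - real m * (Lg + 1) - real T * b - real T * real l"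
  have "X\<^sub>0 \<le> X"
  proof -
    have Tl': "real T * real m - real T * real l \<le> real (T * l')"
    proof -
      have "real m - real l \<le> real l'" using top l(3) by linarith
      then have "real T * (real m - real l) \<le> real T * real l'" by (intro mult_left_mono) auto
      then show ?thesis by (simp add: right_diff_distrib)
    qed
    have "X = (1 - \<gamma>) * S + \<gamma> * real (T * l')" unfolding X_def by (simp add: algebra_simps)
    moreover have "(1 - \<gamma>) * (\<beta> * real n - real m * (Lg + 1) - real T * b) \<le> (1 - \<gamma>) * S"
      using total gam by (intro mult_left_mono) (auto simp: algebra_simps)
    moreover have "\<gamma> * (real n - real T * real l) \<le> \<gamma> * real (T * l')"
      using Tl' mn gam by (intro mult_left_mono) auto
    moreover have "(1 - \<gamma>) * (real m * (Lg + 1) + real T * b) \<le> 1 * (real m * (Lg + 1) + real T * b)"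
      using gam Lg b0 by (intro mult_right_mono) auto
    moreover have "\<gamma> * (real T * real l) \<le> 1 * (real T * real l)" using gam by (intro mult_right_mono) auto
    ultimately show ?thesis unfolding X\<^sub>0_def by (simp add: algebra_simps)
  qed
  have "X\<^sub>0 \<le> 1 * real n"
  proof -
    have "\<gamma> * (1 - \<beta>) \<le> 1 * (1 - \<beta>)" using gam beta by (intro mult_right_mono) auto
    then have "(\<beta> + \<gamma> * (1 - \<beta>)) * real n \<le> 1 * real n" by (intro mult_right_mono) auto
    moreover have "0 \<le> real m * (Lg + 1)" "0 \<le> real T * b" "0 \<le> real T * real l" using Lg b0 by simp_all
    ultimately show ?thesis unfolding X\<^sub>0_def by linarith
  qed
  then have "\<eta> * X\<^sub>0 \<le> \<eta> * real n" using eta by (intro mult_left_mono) auto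
  then have "X\<^sub>0 - \<eta> * real n \<le> (1 - \<eta>) * X\<^sub>0" by (simp add: algebra_simps)
  also have "\<dots> \<le> (1 - \<eta>) * X" using \<open>X\<^sub>0 \<le> X\<close> eta by (intro mult_left_mono) auto
  finally have fin: "X\<^sub>0 - \<eta> * real n - K * real m - 2 * b \<le> \<alpha> * real n" using main by linarith
  have g: "8 * \<eta> * real n \<le> (\<beta> + \<gamma> * (1 - \<beta>) - \<alpha>) * real n" using gain by (intro mult_right_mono) auto
  have Tl: "real T * real l \<le> \<eta> * real n + 2 * real T"
  proof -
    have "real T * real l \<le> real T * (\<eta> * real m + 1)" using l by (intro mult_left_mono) auto
    also have "\<dots> = \<eta> * (real T * real m) + real T" by (simp add: algebra_simps)
    also have "\<eta> * (real T * real m) \<le> \<eta> * (real n + real T)" using mn eta by (intro mult_left_mono) auto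
    also have "\<eta> * (real n + real T) \<le> \<eta> * real n + 1 * real T"
      using eta mult_right_mono[of \<eta> 1 "real T"] by (simp add: algebra_simps)
    finally show ?thesis by simp
  qed
  have s: "\<sigma> * real n \<le> \<eta> * real n" using sig by (intro mult_right_mono) auto
  have "(\<beta> + \<gamma> * (1 - \<beta>) - \<alpha>) * real n \<le> \<eta> * real n + (real m * (Lg + 1) + K * real m) + (real T * b + 2 * b) + real T * real l"
    using fin unfolding X\<^sub>0_def by (simp add: algebra_simps)
  moreover have "real m * (Lg + 1) + K * real m \<le> \<sigma> * real n + \<sigma> * real T" using mLg by (simp add: algebra_simps)
  moreover have "real T * b + 2 * b \<le> \<sigma> * real n + real T + 2" using b by (simp add: algebra_simps)
  ultimately show False using g Tl s large(1) by linarith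
qed

end

section \<open>Passage to the discrete setting\<close>

text \<open>A countable basis covers the complement of the support by countably many null open
  sets.\<close>

lemma spt_complement_null:
  fixes \<nu> :: "'a::second_countable_topology measure"
  assumes "sets \<nu> = sets borel"
  obtains N where "N \<in> null_sets \<nu>" "- spt \<nu> \<subseteq> N"
proof -
  obtain \<B> :: "'a set set" where \<B>: "countable \<B>" "topological_basis \<B>" using ex_countable_basis by blast
  define N where "N = \<Union>{U\<in>\<B>. emeasure \<nu> U = 0}"
  have "N = (\<Union>U\<in>{U\<in>\<B>. emeasure \<nu> U = 0}. U)" unfolding N_def by auto
  moreover have "(\<Union>U\<in>{U\<in>\<B>. emeasure \<nu> U = 0}. U) \<in> null_sets \<nu>"
  proof (rule null_sets_UN')
    show "countable {U\<in>\<B>. emeasure \<nu> U = 0}" using \<B>(1) by simp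
    fix U assume U: "U \<in> {U\<in>\<B>. emeasure \<nu> U = 0}"
    then have "open U" using topological_basis_open[OF \<B>(2)] by auto
    then show "U \<in> null_sets \<nu>" using U assms by (auto simp: null_sets_def)
  qed
  ultimately have "N \<in> null_sets \<nu>" by simp
  moreover have "- spt \<nu> \<subseteq> N"
  proof
    fix x assume "x \<in> - spt \<nu>"
    then obtain U where U: "open U" "x \<in> U" "emeasure \<nu> U = 0"
      unfolding spt_def by (auto simp: zero_less_iff_neq_zero)
    obtain V where V: "V \<in> \<B>" "x \<in> V" "V \<subseteq> U" using topological_basisE[OF \<B>(2) U(1,2)] by blast
    have "emeasure \<nu> V \<le> emeasure \<nu> U" using V U assms by (intro emeasure_mono) auto
    then show "x \<in> N" using V U unfolding N_def by auto
  qed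
  ultimately show ?thesis by (rule that)
qed

text \<open>Each dyadic interval of positive measure is represented by a point of the support inside
  it, so the atoms are admissible directions. Mass moves by less than \<open>1 / 2^n\<close>;
  enlarging radii by \<open>2 / 2^n\<close> compensates for this and also brings every
  \<open>r \<ge> 0\<close> into the range of the hypothesis.\<close>

lemma discretize_measure:
  fixes \<nu> :: "real measure" and n :: nat
  assumes sets: "sets \<nu> = sets borel" and "prob_space \<nu>" and spt: "spt \<nu> \<subseteq> {-1..1}"
    and frostman: "\<And>x r. (1/2)^n \<le> r \<Longrightarrow> measure \<nu> (ball x r) \<le> 40 * r powr \<gamma>"
  obtains I :: "int set" and w c :: "int \<Rightarrow> real" where "finite I" "\<And>k. 0 \<le> w k" "sum w I = 1"
    "\<And>k. k \<in> I \<Longrightarrow> c k \<in> spt \<nu>"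
    "\<And>x r. 0 \<le> r \<Longrightarrow> (\<Sum>k\<in>{k\<in>I. \<bar>c k - x\<bar> \<le> r}. w k) \<le> 40 * (r + 2 / 2^n) powr \<gamma>"
proof -
  interpret prob_space \<nu> by fact
  define \<delta> :: real where "\<delta> = (1/2)^n"
  have \<delta>: "0 < \<delta>" "\<delta> * 2^n = 1" unfolding \<delta>_def by (simp_all add: power_one_over)
  have two: "2 / 2^n = 2 * \<delta>" unfolding \<delta>_def by (simp add: power_one_over)
  have space: "space \<nu> = UNIV" using sets_eq_imp_space_eq[OF sets] by simp
  define D where "D k = {of_int k * \<delta> ..< (of_int k + 1) * \<delta>}" for k :: int
  have meas: "D k \<in> sets \<nu>" for k unfolding sets D_def by simp
  have inD: "x \<in> D k \<longleftrightarrow> k = \<lfloor>x / \<delta>\<rfloor>" for x k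
  proof -
    have "x \<in> D k \<longleftrightarrow> of_int k \<le> x / \<delta> \<and> x / \<delta> < of_int k + 1"
      unfolding D_def using \<delta>(1) by (simp add: pos_le_divide_eq pos_divide_less_eq)
    then show ?thesis by (metis floor_eq_iff)
  qed
  have disj: "disjoint_family_on D K" for K
    unfolding disjoint_family_on_def by (auto simp: set_eq_iff inD)
  define w where "w k = measure \<nu> (D k)" for k
  define I where "I = {k\<in>{-(2^n)..2^n}. w k > 0}"
  have finI: "finite I" unfolding I_def by (rule finite_subset[of _ "{-(2^n)..2^n}"]) auto
  obtain N where N: "N \<in> null_sets \<nu>" "- spt \<nu> \<subseteq> N" using spt_complement_null[OF sets] .
  have hit: "\<exists>x. x \<in> spt \<nu> \<and> x \<in> D k" if "k \<in> I" for k
  proof (rule ccontr)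
    assume "\<not> ?thesis"
    then have "D k \<subseteq> N" using N(2) by auto
    then have "D k \<in> null_sets \<nu>" by (rule null_sets_subset[OF N(1) meas])
    then have "w k = 0" unfolding w_def by (simp add: measure_eq_0_null_sets)
    then show False using that unfolding I_def by simp
  qed
  define c where "c k = (SOME x. x \<in> spt \<nu> \<and> x \<in> D k)" for k
  have c: "c k \<in> spt \<nu>" "c k \<in> D k" if "k \<in> I" for k
    using someI_ex[OF hit[OF that]] unfolding c_def by auto
  have "sum w I = sum w {-(2^n)..2^n}"
  proof (rule sum.mono_neutral_left)
    show "\<forall>k\<in>{-(2^n)..2^n} - I. w k = 0"
    proof
      fix k assume "k \<in> {-(2^n)..2^n} - I"
      then have "\<not> 0 < w k" unfolding I_def by blast
      moreover have "0 \<le> w k" unfolding w_def by simp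
      ultimately show "w k = 0" by linarith
    qed
    show "I \<subseteq> {-(2^n)..2^n}" unfolding I_def by blast
  qed (rule finite_atLeastAtMost_int)
  also have "\<dots> = measure \<nu> (\<Union>k\<in>{-(2^n)..2^n}. D k)"
    unfolding w_def using meas disj by (intro finite_measure_finite_Union[symmetric]) auto
  also have "\<dots> = 1"
  proof (rule antisym)
    show "1 \<le> measure \<nu> (\<Union>k\<in>{-(2^n)..2^n}. D k)"
    proof -
      have "UNIV \<subseteq> (\<Union>k\<in>{-(2^n)..2^n}. D k) \<union> N"
      proof
        fix x :: real
        show "x \<in> (\<Union>k\<in>{-(2^n)..2^n}. D k) \<union> N"
        proof (cases "x \<in> spt \<nu>")
          case True
          then have x: "-1 \<le> x" "x \<le> 1" using spt by auto
          have "1 / \<delta> = 2^n" using \<delta> by (simp add: field_simps)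
          then have "- (2^n) \<le> x / \<delta>" "x / \<delta> \<le> 2^n"
            using divide_right_mono[OF x(1), of \<delta>] divide_right_mono[OF x(2), of \<delta>] \<delta> by simp_all
          then have "- (2^n) \<le> \<lfloor>x / \<delta>\<rfloor>" "\<lfloor>x / \<delta>\<rfloor> \<le> 2^n"
            by (simp_all add: le_floor_iff floor_le_iff)
          then show ?thesis using inD by auto
        qed (use N in auto)
      qed
      then have "prob UNIV \<le> prob ((\<Union>k\<in>{-(2^n)..2^n}. D k) \<union> N)"
        using meas N(1) by (intro finite_measure_mono) (auto simp: null_setsD2)
      also have "\<dots> = prob (\<Union>k\<in>{-(2^n)..2^n}. D k)"
        using meas N(1) by (intro measure_Un_null_set) auto
      finally show ?thesis using prob_space space by simp
    qed
  qed simp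
  finally have sumI: "sum w I = 1" .
  have "(\<Sum>k\<in>{k\<in>I. \<bar>c k - x\<bar> \<le> r}. w k) \<le> 40 * (r + 2 / 2^n) powr \<gamma>" if r: "0 \<le> r" for x r
  proof -
    let ?K = "{k\<in>I. \<bar>c k - x\<bar> \<le> r}"
    have "(\<Sum>k\<in>?K. w k) = measure \<nu> (\<Union>k\<in>?K. D k)"
      unfolding w_def using meas disj finI by (intro finite_measure_finite_Union[symmetric]) auto
    also have "\<dots> \<le> measure \<nu> (ball x (r + 2 * \<delta>))"
    proof (rule finite_measure_mono)
      show "ball x (r + 2 * \<delta>) \<in> sets \<nu>" unfolding sets by simp
      show "(\<Union>k\<in>?K. D k) \<subseteq> ball x (r + 2 * \<delta>)"
      proof safe
        fix k y assume "k \<in> I" "\<bar>c k - x\<bar> \<le> r" "y \<in> D k"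
        moreover from this have "\<bar>y - c k\<bar> < \<delta>" using c(2)[of k] unfolding D_def
          by (auto simp: algebra_simps abs_less_iff)
        ultimately show "y \<in> ball x (r + 2 * \<delta>)" using \<delta>(1) by (simp add: dist_real_def)
      qed
    qed
    also have "\<dots> \<le> 40 * (r + 2 * \<delta>) powr \<gamma>"
      using r \<delta> by (intro frostman) (auto simp: \<delta>_def)
    finally show ?thesis unfolding two .
  qed
  then show ?thesis using that[of I w c] finI sumI c(1) by (auto simp: w_def)
qed

text \<open>As \<open>z\<close> is an integer, the point \<open>(z + c * x) * \<delta>\<close> lies
  only in the interval with index \<open>z + floor (c * x)\<close>, so every cover contains all
  these indices. They also form a finite cover, so the minimum is attained.\<close>

lemma dyadic_covering_number_ge:
  fixes A B :: "int set" and c \<delta> :: real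
  assumes \<delta>: "0 < \<delta>" and fin: "finite A" "finite B"
  shows "card ((\<lambda>(z, x). z + \<lfloor>c * real_of_int x\<rfloor>) ` (A \<times> B))
    \<le> dyadic_covering_number \<delta> ((\<lambda>k. of_int k * \<delta>) ` A + (\<lambda>b. c * b) ` (\<lambda>k. of_int k * \<delta>) ` B)"
proof -
  let ?Q = "(\<lambda>(z, x). z + \<lfloor>c * real_of_int x\<rfloor>) ` (A \<times> B)"
  let ?E = "(\<lambda>k. of_int k * \<delta>) ` A + (\<lambda>b. c * b) ` (\<lambda>k. of_int k * \<delta>) ` B"
  let ?P = "\<lambda>n. \<exists>K::int set. finite K \<and> card K = n \<and> ?E \<subseteq> (\<Union>k\<in>K. {of_int k * \<delta> ..< (of_int k + 1) * \<delta>})"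
  have inD: "y * \<delta> \<in> {of_int k * \<delta> ..< (of_int k + 1) * \<delta>} \<longleftrightarrow> k = \<lfloor>y\<rfloor>" for y k
    using \<delta> by (auto intro!: floor_unique[symmetric])
  have E: "?E = (\<lambda>(z, x). (of_int z + c * of_int x) * \<delta>) ` (A \<times> B)"
    by (auto simp: set_plus_def image_iff algebra_simps)
  have fl: "\<lfloor>real_of_int z + c * real_of_int x\<rfloor> = z + \<lfloor>c * real_of_int x\<rfloor>" for z x by simp
  have "?P (card ?Q)"
    using fin unfolding E by (intro exI[of _ ?Q]) (auto simp only: finite_imageI finite_cartesian_product UN_iff image_iff inD fl)
  then have "?P (dyadic_covering_number \<delta> ?E)" unfolding dyadic_covering_number_def by (rule LeastI)
  then obtain K :: "int set" where K: "finite K" "card K = dyadic_covering_number \<delta> ?E"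
    "?E \<subseteq> (\<Union>k\<in>K. {of_int k * \<delta> ..< (of_int k + 1) * \<delta>})" by blast
  have "?Q \<subseteq> K"
  proof safe
    fix z x assume zx: "z \<in> A" "x \<in> B"
    then have "(of_int z + c * of_int x) * \<delta> \<in> ?E" unfolding E by auto
    then obtain k where "k \<in> K" "(of_int z + c * of_int x) * \<delta> \<in> {of_int k * \<delta> ..< (of_int k + 1) * \<delta>}"
      using K(3) by blast
    then show "z + \<lfloor>c * real_of_int x\<rfloor> \<in> K" unfolding inD fl by simp
  qed
  then show ?thesis using card_mono[OF K(1)] K(2) by simp
qed

text \<open>With \<open>T = s^2\<close> the logarithm is \<open>2 * log 2 s \<le> 2 * s\<close>, of
  the order of the square root of \<open>T\<close>.\<close>

lemma exists_base:
  fixes \<sigma> K c :: real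
  assumes "0 < \<sigma>" "0 < c" "0 \<le> K"
  shows "\<exists>T::nat. 1 \<le> T \<and> 4 \<le> c * 2^T \<and> log 2 (real T) + 1 + K \<le> \<sigma> * real T"
proof -
  obtain s :: nat where s: "(3 + K) / \<sigma> + 4 / c + 1 < real s" using reals_Archimedean2 by blast
  have pos: "0 \<le> (3 + K) / \<sigma>" "0 \<le> 4 / c" using assms by simp_all
  then have s1: "(3 + K) / \<sigma> \<le> real s" "4 / c \<le> real s" "1 \<le> real s" using s by linarith+
  have "log 2 (real (s^2)) = 2 * log 2 (real s)" using s1 by (simp add: log_nat_power)
  also have "log 2 (real s) \<le> real s"
  proof -
    have "real s \<le> 2 powr real s" using less_exp[of s] by (simp add: powr_realpow)
    then show ?thesis using s1 by (simp add: log_le_iff)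
  qed
  finally have "log 2 (real (s^2)) + 1 + K \<le> (3 + K) * real s"
    using s1 mult_right_mono[of 1 "real s" "1 + K"] assms by (simp add: algebra_simps)
  also have "\<dots> \<le> (\<sigma> * real s) * real s"
    using s1 assms by (intro mult_right_mono) (auto simp: field_simps)
  finally have 1: "log 2 (real (s^2)) + 1 + K \<le> \<sigma> * real (s^2)" by (simp add: power2_eq_square algebra_simps)
  have "real s \<le> 2^(s^2)"
  proof -
    have "s \<le> s^2" by (simp add: power2_eq_square)
    also have "s^2 < 2^(s^2)" by (rule less_exp)
    finally show ?thesis by (metis less_imp_le of_nat_le_iff of_nat_numeral of_nat_power)
  qed
  then have "4 / c \<le> 2^(s^2)" using s1 by linarith
  then have "4 \<le> c * 2^(s^2)" using assms by (simp add: field_simps)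
  moreover have "1 \<le> s^2" using s1 by simp
  ultimately show ?thesis using 1 by blast
qed

theorem theorem3p5:
  fixes \<alpha> \<beta> \<gamma> \<kappa> :: real
  assumes "0 < \<beta>" and "\<beta> \<le> \<alpha>" and "\<alpha> < 1" and "\<kappa> > 0"
    and "\<gamma> \<in> {(\<alpha> - \<beta>) / (1 - \<beta>) <.. 1}"
  shows "\<exists>\<epsilon> \<epsilon>\<^sub>0 \<epsilon>\<^sub>B \<delta>\<^sub>0 :: real.
    \<epsilon> \<in> {0<..1/2} \<and> \<epsilon>\<^sub>0 \<in> {0<..1/2} \<and> \<epsilon>\<^sub>B \<in> {0<..1/2} \<and> \<delta>\<^sub>0 \<in> {0<..1/2} \<and>
    (\<forall>(\<delta>::real) (A::real set) (B::real set) (\<nu>::real measure).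
      (\<exists>n::nat. \<delta> = (1/2) ^ n) \<longrightarrow>
      \<delta> \<in> {0<..\<delta>\<^sub>0} \<longrightarrow>
      A \<subseteq> grid \<delta> \<inter> {0..1} \<longrightarrow>
      B \<subseteq> grid \<delta> \<inter> {0..1} \<longrightarrow>
      real (card A) \<le> \<delta> powr (- \<alpha>) \<longrightarrow>
      real (card B) \<ge> \<delta> powr (- \<beta>) \<longrightarrow>
      (\<forall>x r. \<delta> \<le> r \<and> r \<le> \<delta> powr \<epsilon>\<^sub>0 \<longrightarrow>
         real (card (B \<inter> ball x r)) \<le> r powr \<kappa> * real (card B)) \<longrightarrow>
      real (card (B + B)) \<le> \<delta> powr (- \<epsilon>\<^sub>B) * real (card B) \<longrightarrow>
      sets \<nu> = sets borel \<longrightarrow>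
      prob_space \<nu> \<longrightarrow>
      spt \<nu> \<subseteq> {-1..1} \<longrightarrow>
      (\<forall>x r. \<delta> \<le> r \<longrightarrow> measure \<nu> (ball x r) \<le> 40 * r powr \<gamma>) \<longrightarrow>
      (\<exists>c\<in>spt \<nu>. real (dyadic_covering_number \<delta> (A + (\<lambda>b. c * b) ` B))
                    \<ge> \<delta> powr (- \<epsilon>) * real (card A)))"
proof -
  have \<beta>: "0 < 1 - \<beta>" using assms by simp
  have "0 \<le> (\<alpha> - \<beta>) / (1 - \<beta>)" using assms \<beta> by simp
  then have \<gamma>: "0 < \<gamma>" "\<gamma> \<le> 1" using assms(5) by auto
  define g where "g = \<gamma> * (1 - \<beta>)"
  have g1: "\<alpha> - \<beta> < g" using assms(5) \<beta> unfolding g_def by (simp add: pos_divide_less_eq)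
  have "\<gamma> * (1 - \<beta>) \<le> 1 * (1 - \<beta>)" using \<gamma> \<beta> by (intro mult_right_mono) auto
  then have g2: "g \<le> 1 - \<beta>" unfolding g_def by simp
  define \<eta> where "\<eta> = (\<beta> + g - \<alpha>) / 8"
  have \<eta>: "0 < \<eta>" "\<eta> \<le> 1" "8 * \<eta> \<le> \<beta> + \<gamma> * (1 - \<beta>) - \<alpha>"
    using g1 g2 assms(1,2) by (simp_all add: \<eta>_def g_def[symmetric])
  define \<sigma> where "\<sigma> = min \<eta> (\<eta> * \<kappa> / 4)"
  have \<sigma>: "0 < \<sigma>" "\<sigma> \<le> \<eta>" "4 * \<sigma> \<le> \<eta> * \<kappa>" unfolding \<sigma>_def using \<eta> assms(4) by auto
  \<comment> \<open>Solves \<open>40 * (2 * c\<^sub>0) powr \<gamma> = 1 / 4\<close>; the factor two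
    makes room for \<open>2 / 2^n \<le> c\<^sub>0\<close>.\<close>
  define c\<^sub>0 :: real where "c\<^sub>0 = (1 / 160) powr (1 / \<gamma>) / 2"
  have c0: "0 < c\<^sub>0" "40 * (2 * c\<^sub>0) powr \<gamma> \<le> 1 / 4" unfolding c\<^sub>0_def using \<gamma> by (simp_all add: powr_powr)
  define K where "K = (ln (4 / c\<^sub>0 + 1) + 6 + (ln 640 + 9)) / ln 2"
  have K: "0 \<le> K" unfolding K_def using c0 by (intro divide_nonneg_nonneg add_nonneg_nonneg) auto
  obtain T :: nat where T: "1 \<le> T" "4 \<le> c\<^sub>0 * 2^T" "log 2 (real T) + 1 + K \<le> \<sigma> * real T"
    using exists_base[OF \<sigma>(1) c0(1) K] by blast
  \<comment> \<open>Up to \<open>2^T\<close> iterations of a coupling with defect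
    \<open>8 * \<theta>\<close> lose at most mass \<eta>.\<close>
  define \<theta> where "\<theta> = \<eta> / (8 * 2^T)"
  have \<theta>: "0 < \<theta>" "2^T * (8 * \<theta>) \<le> \<eta>" unfolding \<theta>_def using \<eta> by simp_all
  define \<epsilon> where "\<epsilon> = min (1/2) (\<sigma> * \<theta>^2 / (real T + 2))"
  have \<epsilon>: "0 < \<epsilon>" unfolding \<epsilon>_def using \<sigma> \<theta> by simp
  have \<epsilon>2: "\<epsilon> \<le> 1/2" unfolding \<epsilon>_def by (rule min.cobounded1)
  have \<epsilon>T: "\<epsilon> * (real T + 2) \<le> \<sigma> * \<theta>^2"
  proof -
    have "\<epsilon> * (real T + 2) \<le> \<sigma> * \<theta>^2 / (real T + 2) * (real T + 2)" unfolding \<epsilon>_def by (intro mult_right_mono) auto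
    then show ?thesis by simp
  qed
  \<comment> \<open>Thresholds for \<open>n\<close>: \<open>b\<^sub>1\<close> and
    \<open>b\<^sub>2\<close> make the additive constants of the count negligible,
    \<open>b\<^sub>3\<close> ensures \<open>2 / 2^n \<le> c\<^sub>0\<close>, and
    \<open>b\<^sub>4\<close> absorbs the rounding of scales to multiples of \<open>T\<close>, which
    is why nonconcentration is required from exponent \<open>\<eta> / 2\<close> on.\<close>
  define b\<^sub>1 b\<^sub>2 b\<^sub>3 b\<^sub>4 where "b\<^sub>1 = (\<sigma> * real T + 3 * real T + 2) / (4 * \<eta>)"
    and "b\<^sub>2 = (2 * (\<kappa> * real T) + 2 * (\<sigma> * real T) + 6 + 2 * real T) / (\<eta> * \<kappa>)"
    and "b\<^sub>3 = 2 / c\<^sub>0" and "b\<^sub>4 = 2 * real T / \<eta>"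
  have b0: "0 \<le> b\<^sub>1" "0 \<le> b\<^sub>2" "0 \<le> b\<^sub>3" "0 \<le> b\<^sub>4"
    unfolding b\<^sub>1_def b\<^sub>2_def b\<^sub>3_def b\<^sub>4_def using \<eta> \<sigma> c0 assms(4) by simp_all
  obtain n\<^sub>0 :: nat where n0: "b\<^sub>1 + b\<^sub>2 + b\<^sub>3 + b\<^sub>4 < real n\<^sub>0" using reals_Archimedean2 by blast
  have main: "\<exists>c\<in>spt \<nu>. real (dyadic_covering_number \<delta> (A + (\<lambda>b. c * b) ` B)) \<ge> \<delta> powr (- \<epsilon>) * real (card A)"
    if \<delta>n: "\<delta> = (1/2)^n" and \<delta>0: "\<delta> \<le> (1/2)^Suc n\<^sub>0"
      and A: "A \<subseteq> grid \<delta> \<inter> {0..1}" and B: "B \<subseteq> grid \<delta> \<inter> {0..1}"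
      and cardA: "real (card A) \<le> \<delta> powr (- \<alpha>)" and cardB: "real (card B) \<ge> \<delta> powr (- \<beta>)"
      and nonconc: "\<forall>x r. \<delta> \<le> r \<and> r \<le> \<delta> powr (\<eta> / 2) \<longrightarrow> real (card (B \<inter> ball x r)) \<le> r powr \<kappa> * real (card B)"
      and \<nu>: "sets \<nu> = sets borel" "prob_space \<nu>" "spt \<nu> \<subseteq> {-1..1}"
      and frost: "\<forall>x r. \<delta> \<le> r \<longrightarrow> measure \<nu> (ball x r) \<le> 40 * r powr \<gamma>"
    for \<delta> :: real and n :: nat and A B :: "real set" and \<nu> :: "real measure"
  proof (rule ccontr)
    assume neg: "\<not> ?thesis"
    have less: "real (dyadic_covering_number \<delta> (A + (\<lambda>b. c * b) ` B)) < \<delta> powr (- \<epsilon>) * real (card A)"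
      if "c \<in> spt \<nu>" for c using neg that by force
    have "Suc n\<^sub>0 \<le> n"
    proof (rule ccontr)
      assume "\<not> Suc n\<^sub>0 \<le> n"
      then have "(1/2::real)^Suc n\<^sub>0 < (1/2)^n" by (intro power_strict_decreasing) auto
      then show False using \<delta>0 \<delta>n by simp
    qed
    then have nb: "b\<^sub>1 < real n" "b\<^sub>2 < real n" "b\<^sub>3 < real n" "b\<^sub>4 < real n" using n0 b0 by linarith+
    have \<delta>: "0 < \<delta>" "\<delta> * 2^n = 1" unfolding \<delta>n by (simp_all add: power_one_over)
    have \<delta>powr: "\<delta> powr x = 2 powr (- x * real n)" for x
    proof -
      have "\<delta> = 2 powr (- real n)" unfolding \<delta>n by (simp add: powr_minus_divide powr_realpow power_one_over)
      then show ?thesis by (simp add: powr_powr mult.commute)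
    qed
    define h where "h k = of_int k * \<delta>" for k :: int
    have h_inj: "inj h" unfolding h_def inj_def using \<delta> by simp
    define A' B' where "A' = {k. h k \<in> A}" and "B' = {k. h k \<in> B}"
    have hA: "A = h ` A'" and hB: "B = h ` B'"
      using A B unfolding A'_def B'_def grid_def h_def by auto
    have box: "k \<in> {0..2^n}" if "h k \<in> {0..1}" for k
    proof -
      have "0 \<le> of_int k * \<delta>" "of_int k * \<delta> \<le> 2^n * \<delta>" using that \<delta> unfolding h_def by (simp_all add: mult.commute)
      then have "0 \<le> real_of_int k" "real_of_int k \<le> 2^n" using \<delta> by (simp_all add: zero_le_mult_iff)
      then have "real_of_int 0 \<le> real_of_int k" "real_of_int k \<le> real_of_int (2^n)" by simp_all
      then show ?thesis unfolding of_int_le_iff by simp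
    qed
    have A'box: "A' \<subseteq> {0..2^n}" and B'box: "B' \<subseteq> {0..2^n}"
      using A B box unfolding A'_def B'_def by blast+
    have fin: "finite A'" "finite B'" using A'box B'box finite_subset by auto
    have card: "card A' = card A" "card B' = card B"
      unfolding hA hB by (simp_all add: card_image inj_on_subset[OF h_inj])
    obtain I w c where wc: "finite I" "\<And>k::int. 0 \<le> w k" "sum w I = 1" "\<And>k. k \<in> I \<Longrightarrow> c k \<in> spt \<nu>"
      and Iw: "\<And>x r. 0 \<le> r \<Longrightarrow> (\<Sum>k\<in>{k\<in>I. \<bar>c k - x\<bar> \<le> r}. w k) \<le> 40 * (r + 2 / 2^n) powr \<gamma>"
      using discretize_measure[OF \<nu>, of n \<gamma>] frost unfolding \<delta>n by blast
    obtain k\<^sub>0 where "k\<^sub>0 \<in> I" using wc(3) by fastforce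
    \<comment> \<open>For empty \<open>A\<close> the strict inequality \<open>less\<close> would
      read \<open>x < 0\<close> with a nonnegative \<open>x\<close>.\<close>
    have "card A \<noteq> 0" using less[OF wc(4)[OF \<open>k\<^sub>0 \<in> I\<close>]] by (intro notI) simp
    then have A'ne: "A' \<noteq> {}" using card by auto
    have "0 < real (card B)" using cardB \<delta> by (smt (verit) powr_gt_zero)
    then have B'ne: "B' \<noteq> {}" using card by auto
    have c0n: "40 * (c\<^sub>0 + 2 / 2^n) powr \<gamma> \<le> 1 / 4"
    proof -
      have "real n \<le> 2^n" by (metis less_exp less_imp_le of_nat_le_iff of_nat_numeral of_nat_power)
      then have "2 / c\<^sub>0 \<le> 2^n" using nb(3) unfolding b\<^sub>3_def by linarith
      then have "2 / 2^n \<le> c\<^sub>0" using c0 by (simp add: field_simps)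
      then have "(c\<^sub>0 + 2 / 2^n) powr \<gamma> \<le> (2 * c\<^sub>0) powr \<gamma>" using c0 \<gamma> by (intro powr_mono2) auto
      then show ?thesis using c0(2) by linarith
    qed
    interpret discretized A' B' I w c \<gamma> c\<^sub>0 \<theta> n
    proof
      show "\<bar>c k\<bar> \<le> 1" if "k \<in> I" for k using wc(4)[OF that] \<nu>(3) by (auto simp: abs_le_iff)
    qed (use fin A'ne B'box wc Iw \<gamma> c0 c0n \<theta> in auto)
    \<comment> \<open>The least number of levels with \<open>2^(T * m) > 2^n\<close>, so that the
      endpoint \<open>2^n\<close> lies in the same top cell as the rest of
      \<open>B'\<close>.\<close>
    define m where "m = n div T + 1"
    have m: "n + 1 \<le> T * m" "T * m \<le> n + T"
      unfolding m_def using T(1) mult_div_mod_eq[of T n] mod_less_divisor[of T n]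
      by (simp_all add: algebra_simps, linarith+)
    have "1 \<le> m" unfolding m_def by simp
    define l where "l = nat \<lceil>\<eta> * real m\<rceil>"
    have em: "0 < \<eta> * real m" "\<eta> * real m \<le> 1 * real m"
      using \<eta> \<open>1 \<le> m\<close> by (auto intro!: mult_right_mono)
    have l: "\<eta> * real m \<le> real l" "real l \<le> \<eta> * real m + 1" "l \<le> m" "1 \<le> l"
      unfolding l_def using em by linarith+
    have nonconc': "real (card {x\<in>B'. x div 2^e = k}) \<le> 2 powr (- \<kappa> * (real n - real e)) * real (card B')"
      if e: "e \<le> n" "\<eta> * real n - real T \<le> real n - real e" for e k
    proof -
      define r where "r = 2^e * \<delta>"
      have r: "r = 2 powr (real e - real n)"
        unfolding r_def \<delta>n by (simp add: powr_diff powr_realpow power_one_over)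
      have "1 * \<delta> \<le> 2^e * \<delta>" using \<delta> by (intro mult_right_mono) auto
      then have "\<delta> \<le> r" unfolding r_def by simp
      moreover have "r \<le> \<delta> powr (\<eta> / 2)"
      proof -
        have "2 * real T < real n * \<eta>" using nb(4) \<eta> unfolding b\<^sub>4_def by (simp add: pos_divide_less_eq)
        then have "real e - real n \<le> - (\<eta> / 2) * real n" using e(2) by (simp add: algebra_simps)
        then show ?thesis unfolding r \<delta>powr by (intro powr_mono) auto
      qed
      \<comment> \<open>The ball is centred at the left endpoint of the cell; as cells are
        half-open, the open ball contains all of it.\<close>
      ultimately have bound: "real (card (B \<inter> ball (h (k * 2^e)) r)) \<le> r powr \<kappa> * real (card B)"
        using nonconc by blast
      have "h ` {x\<in>B'. x div 2^e = k} \<subseteq> B \<inter> ball (h (k * 2^e)) r"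
      proof
        fix y assume "y \<in> h ` {x\<in>B'. x div 2^e = k}"
        then obtain x where x: "x \<in> B'" "x div 2^e = k" "y = h x" by blast
        have "0 \<le> x - k * 2^e" "x - k * 2^e < 2^e" using cell_bounds[OF x(2)] by linarith+
        then have "real_of_int 0 \<le> real_of_int (x - k * 2^e)" "real_of_int (x - k * 2^e) < real_of_int (2^e)"
          by (simp_all only: of_int_le_iff of_int_less_iff)
        then have d: "0 \<le> real_of_int (x - k * 2^e)" "real_of_int (x - k * 2^e) < 2^e" by simp_all
        have "dist (h (k * 2^e)) (h x) = real_of_int (x - k * 2^e) * \<delta>"
        proof -
          have "h x - h (k * 2^e) = real_of_int (x - k * 2^e) * \<delta>" unfolding h_def by (simp add: left_diff_distrib)
          moreover have "0 \<le> real_of_int (x - k * 2^e) * \<delta>" using d(1) \<delta> by (intro mult_nonneg_nonneg) auto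
          ultimately show ?thesis by (simp add: dist_real_def)
        qed
        also have "\<dots> < r" unfolding r_def using d(2) \<delta> by (intro mult_strict_right_mono) auto
        finally show "y \<in> B \<inter> ball (h (k * 2^e)) r" using x unfolding B'_def by simp
      qed
      moreover have "finite B" unfolding hB using fin by simp
      ultimately have "card (h ` {x\<in>B'. x div 2^e = k}) \<le> card (B \<inter> ball (h (k * 2^e)) r)"
        by (intro card_mono) auto
      then have "card {x\<in>B'. x div 2^e = k} \<le> card (B \<inter> ball (h (k * 2^e)) r)"
        by (simp add: card_image inj_on_subset[OF h_inj])
      then have "real (card {x\<in>B'. x div 2^e = k}) \<le> r powr \<kappa> * real (card B)" using bound by linarith
      also have "r powr \<kappa> = 2 powr (- \<kappa> * (real n - real e))" unfolding r by (simp add: powr_powr algebra_simps)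
      finally show ?thesis unfolding card .
    qed
    have cardQ: "real (card (Q k)) \<le> 2 powr (\<epsilon> * real n) * real (card A')" if "k \<in> I" for k
    proof -
      have "Q k = (\<lambda>(z, x). z + \<lfloor>c k * real_of_int x\<rfloor>) ` (A' \<times> B')" unfolding Q_def \<phi>_def ..
      moreover have "A + (\<lambda>b. c k * b) ` B = (\<lambda>k. of_int k * \<delta>) ` A' + (\<lambda>b. c k * b) ` (\<lambda>k. of_int k * \<delta>) ` B'"
        unfolding hA hB h_def ..
      ultimately have "real (card (Q k)) \<le> real (dyadic_covering_number \<delta> (A + (\<lambda>b. c k * b) ` B))"
        using dyadic_covering_number_ge[OF \<delta>(1) fin, of "c k"] by simp
      also have "\<dots> < \<delta> powr (- \<epsilon>) * real (card A)" by (rule less[OF wc(4)[OF that]])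
      finally show ?thesis unfolding \<delta>powr card by simp
    qed
    show False
    proof (rule entropy_contradiction[where T=T and m=m and l=l and \<eta>=\<eta> and \<sigma>=\<sigma> and \<epsilon>=\<epsilon> and \<alpha>=\<alpha> and \<beta>=\<beta> and \<kappa>=\<kappa>])
      show "2 powr (\<beta> * real n) \<le> real (card B')" "real (card A') \<le> 2 powr (\<alpha> * real n)"
        using cardA cardB unfolding \<delta>powr card by simp_all
      show "\<sigma> * real T + 3 * real T + 2 < 4 * \<eta> * real n"
        using nb(1) \<eta> unfolding b\<^sub>1_def by (simp add: pos_divide_less_eq mult.commute)
      show "2 * (\<kappa> * real T) + 2 * (\<sigma> * real T) + 6 + 2 * real T < \<eta> * \<kappa> * real n"
        using nb(2) \<eta> assms(4) unfolding b\<^sub>2_def by (simp add: pos_divide_less_eq mult.commute)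
      show "log 2 (real T) + 1 + K \<le> \<sigma> * real T" by (rule T(3))
      show "K = (ln (4 / c\<^sub>0 + 1) + 6 + (ln 640 + 9)) / ln 2" by (rule K_def)
      show "\<beta> \<le> 1" using \<beta> by simp
    qed (rule T \<theta> \<eta> m B'ne cardQ nonconc' assms(4) less_imp_le[OF assms(1)] less_imp_le[OF \<epsilon>] \<epsilon>T l \<sigma>
        less_imp_le[OF \<sigma>(1)]; assumption)+
  qed
  show ?thesis
  proof (rule exI[of _ \<epsilon>], rule exI[of _ "\<eta> / 2"], rule exI[of _ "1/2"], rule exI[of _ "(1/2)^Suc n\<^sub>0"],
      intro conjI allI impI)
    show "\<epsilon> \<in> {0<..1/2}" "\<eta> / 2 \<in> {0<..1/2}" "(1/2::real) \<in> {0<..1/2}" using \<epsilon> \<epsilon>2 \<eta> by auto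
    show "(1/2::real)^Suc n\<^sub>0 \<in> {0<..1/2}" by (simp add: power_le_one)
  next
    fix \<delta> :: real and A B :: "real set" and \<nu> :: "real measure"
    assume "\<exists>n::nat. \<delta> = (1/2) ^ n" and "\<delta> \<in> {0<..(1/2)^Suc n\<^sub>0}"
      and a: "A \<subseteq> grid \<delta> \<inter> {0..1}" "B \<subseteq> grid \<delta> \<inter> {0..1}"
        "real (card A) \<le> \<delta> powr (- \<alpha>)" "real (card B) \<ge> \<delta> powr (- \<beta>)"
        "\<forall>x r. \<delta> \<le> r \<and> r \<le> \<delta> powr (\<eta> / 2) \<longrightarrow> real (card (B \<inter> ball x r)) \<le> r powr \<kappa> * real (card B)"
      and b: "sets \<nu> = sets borel" "prob_space \<nu>" "spt \<nu> \<subseteq> {-1..1}"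
        "\<forall>x r. \<delta> \<le> r \<longrightarrow> measure \<nu> (ball x r) \<le> 40 * r powr \<gamma>"
    then obtain n where n: "\<delta> = (1/2)^n" "\<delta> \<le> (1/2)^Suc n\<^sub>0" by auto
    show "\<exists>c\<in>spt \<nu>. real (dyadic_covering_number \<delta> (A + (\<lambda>b. c * b) ` B)) \<ge> \<delta> powr (- \<epsilon>) * real (card A)"
      by (rule main[OF n a b])
  qed
qed

end
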